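(* Let $R$ be a countable principal ideal domain which is not a field, let $A\neq 0$ be an $R$-algebra which is free as an $R$-module, and let $\lambda$ be a cardinal with $|A|<\lambda\leq 2^{\aleph_0}$. Then there exists an $\aleph_1$-free $R$-module $G$ of cardinality $\lambda$ with $\operatorname{End}_R G=A$; here equality means that $G$ carries an $A$-module structure extending its $R$-module structure such that the map $a\mapsto a\cdot \mathrm{id}_G$ (scalar multiplication by $a$) identifies $A$ with the full $R$-endomorphism algebra $\operatorname{End}_R G$.
   Context: Algebras are associative with identity, not necessarily commutative, and modules are unital. An $R$-module is $\aleph_1$-free if all its countable submodules are free $R$-modules. $\operatorname{End}_R G$ is the $R$-algebra of all $R$-linear endomorphisms of $G$. *)

theory Defs
  imports
    "HOL-Algebra.Algebra"
    "HOL-Library.Countable_Set"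
    "Jordan_Normal_Form.Missing_VectorSpace"
begin

unbundle cardinal_syntax

text \<open>
  The library locale \<open>algebra\<close> requires the multiplication of the algebra to be commutative;
  here it is not, so scalars have to be moved past either factor.
\<close>

locale assoc_algebra = module R A + ring A for R and A (structure) +
  assumes smult_mult_left:
      "\<lbrakk>r \<in> carrier R; x \<in> carrier A; y \<in> carrier A\<rbrakk> \<Longrightarrow>
        (r \<odot> x) \<otimes> y = r \<odot> (x \<otimes> y)"
    and smult_mult_right:
      "\<lbrakk>r \<in> carrier R; x \<in> carrier A; y \<in> carrier A\<rbrakk> \<Longrightarrow>
        x \<otimes> (r \<odot> y) = r \<odot> (x \<otimes> y)"

text \<open>
  The library locale \<open>module\<close> requires a commutative ring of scalars. Unital left modules
  over an arbitrary ring are therefore given by an action on the additive group of \<open>M\<close>;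
  a multiplication by scalars that \<open>M\<close> may already carry plays no role.
\<close>

locale left_module = S?: ring S + M?: abelian_group M
  for S :: "('s, 'x) ring_scheme" (structure) and M :: "('m, 'y) ring_scheme" (structure)
    and act :: "'s \<Rightarrow> 'm \<Rightarrow> 'm" +
  assumes act_closed:
      "\<lbrakk>a \<in> carrier S; x \<in> carrier M\<rbrakk> \<Longrightarrow> act a x \<in> carrier M"
    and act_add_left:
      "\<lbrakk>a \<in> carrier S; b \<in> carrier S; x \<in> carrier M\<rbrakk> \<Longrightarrow>
        act (a \<oplus>\<^bsub>S\<^esub> b) x = act a x \<oplus>\<^bsub>M\<^esub> act b x"
    and act_add_right:
      "\<lbrakk>a \<in> carrier S; x \<in> carrier M; y \<in> carrier M\<rbrakk> \<Longrightarrow>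
        act a (x \<oplus>\<^bsub>M\<^esub> y) = act a x \<oplus>\<^bsub>M\<^esub> act a y"
    and act_mult:
      "\<lbrakk>a \<in> carrier S; b \<in> carrier S; x \<in> carrier M\<rbrakk> \<Longrightarrow>
        act (a \<otimes>\<^bsub>S\<^esub> b) x = act a (act b x)"
    and act_one:
      "x \<in> carrier M \<Longrightarrow> act \<one>\<^bsub>S\<^esub> x = x"

text \<open>
  \<open>lin_indpt\<close> and \<open>gen_set\<close> (and \<open>module_hom\<close> below) come from the AFP entry VectorSpace.
  That entry also has its own \<open>submodule\<close>; the qualified name selects the one of HOL-Algebra.
\<close>

locale free_module = module +
  assumes ex_basis: "\<exists>B \<subseteq> carrier M. lin_indpt B \<and> gen_set B"

locale aleph1_free_module = module +
  assumes countable_submodule_free: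
    "\<lbrakk>Module.submodule H R M; countable H\<rbrakk> \<Longrightarrow> free_module R (M\<lparr>carrier := H\<rparr>)"

text \<open>
  Endomorphisms are represented by functions that are \<open>undefined\<close> outside of \<open>carrier G\<close>,
  so that two endomorphisms are equal iff they agree on \<open>carrier G\<close>.
\<close>

definition End_alg :: "('r, 'x) ring_scheme \<Rightarrow> ('r, 'g, 'y) module_scheme \<Rightarrow> ('r, 'g \<Rightarrow> 'g) module"
  where "End_alg R G =
    \<lparr>carrier = module_hom R G G \<inter> extensional (carrier G),
     monoid.mult = compose (carrier G),
     one = (\<lambda>x\<in>carrier G. x),
     ring.zero = (\<lambda>x\<in>carrier G. \<zero>\<^bsub>G\<^esub>),
     ring.add = (\<lambda>f g. \<lambda>x\<in>carrier G. f x \<oplus>\<^bsub>G\<^esub> g x),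
     smult = (\<lambda>r f. \<lambda>x\<in>carrier G. r \<odot>\<^bsub>G\<^esub> f x)\<rparr>"

definition algebra_iso ::
  "('r, 'x) ring_scheme \<Rightarrow> ('r, 'a, 'y) module_scheme \<Rightarrow> ('r, 'b, 'z) module_scheme \<Rightarrow> ('a \<Rightarrow> 'b) set"
  where "algebra_iso R A B =
    {h \<in> ring_iso A B. \<forall>r \<in> carrier R. \<forall>a \<in> carrier A. h (r \<odot>\<^bsub>A\<^esub> a) = r \<odot>\<^bsub>B\<^esub> h a}"

end

(* Fix a non-unit p other than 0 of R. The module G lies in the p-adic completion of the direct sum of copies
   A e_j of A, indexed by the nodes j of the binary tree. It is generated by the e_j and, for lambda many
   branches eta, by the elements
     y_eta = sum_n (p^(d_n) e_(eta|n) + p^(c(eta|(n+1))) b_eta)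
   and their quotients by powers of p after removing an initial segment of the sum. Here
   d_0 < c(level 1 nodes) < d_1 < c(level 2 nodes) < ... have growing gaps, and b_eta runs through the vectors
   x e_t + e_s, each of them being attached to lambda many branches.
   Countably many branches have disjoint final segments, and replacing e_j by a quotient of y_eta for the nodes j
   on the final segments yields an A-basis of the submodule they generate; hence G is aleph_1-free.
   If phi is an endomorphism and b = x e_t + e_s, then among the more than |A| many branches eta with b_eta = b
   there are two, eta and eta', for which phi(y_eta) and phi(y_eta') have the same coefficients. In the difference
   y_eta - y_eta' the digit part dominates the tree part, so comparing digits in phi(y_eta - y_eta') forces
   phi(b) to lie in A b. As this holds for all b, phi is multiplication by an element of A on the e_j, and then
   on G by p-adic density. *)
theory Submission
  imports Defs
begin

text \<open>The vectors \<open>b_eta\<close> contain a scalar \<open>x\<close> because an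
  endomorphism is only R-linear: its values at the \<open>e_t\<close> do not determine those at the
  \<open>x e_t\<close>. The summand \<open>e_s\<close>, with coefficient 1, makes the scalar found
  for \<open>b\<close> readable at one coordinate. The two parts of \<open>y_eta\<close> have
  different tasks. The tree part makes branch elements congruent to the \<open>e_j\<close> modulo p,
  which gives independence, and in an image under phi it shows at which level two branches part. The
  digit part carries \<open>b_eta\<close>: if eta and eta' part at level r + 1, their digits sit
  below d_(r+1), where the tree parts first differ. The gaps have to grow because the coefficients
  of phi(y_eta) are arbitrary: for some l none of the nonzero ones is divisible by p^l, but l
  depends on phi and eta. The record used for the pigeonhole argument therefore includes the node of
  eta at level l; two branches with the same record part beyond level l, where the gaps exceed l.
  The record lists the vectors b of the branches occurring in phi(y_eta), not the branches
  themselves, of which there are more than |A|.\<close>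

section \<open>Free modules and coordinates\<close>

text \<open>An intersection argument without factorization into primes: the ideal \<open>I\<close>
  of elements carried into \<open>PIdl r\<close> by some power of \<open>p\<close> is principal, so
  one exponent \<open>n\<close> serves its generator \<open>g\<close>. Writing \<open>r\<close> as
  \<open>p [^] Suc n\<close> times an element of \<open>I\<close> then gives
  \<open>r = (p u t) r\<close>, and \<open>p\<close> would be a unit.\<close>

lemma (in principal_domain) eq_zero_if_all_powers_divide:
  assumes p: "p \<in> carrier R" "p \<notin> Units R" and r: "r \<in> carrier R"
    and dvd: "\<And>n::nat. \<exists>s\<in>carrier R. r = p [^] n \<otimes> s"
  shows "r = \<zero>"
proof (rule ccontr)
  assume r0: "r \<noteq> \<zero>"
  define I where "I = {x \<in> carrier R. \<exists>n::nat. p [^] n \<otimes> x \<in> PIdl r}"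
  have P: "ideal (PIdl r) R" by (rule cgenideal_ideal[OF r])
  interpret P: ideal "PIdl r" R by (rule P)
  have I: "ideal I R"
  proof (rule idealI)
    show "ring R" by (rule ring_axioms)
    show "subgroup I (add_monoid R)"
    proof (rule group.subgroupI)
      show "group (add_monoid R)" by (rule add.is_group)
      show "I \<subseteq> carrier (add_monoid R)" by (auto simp: I_def)
      have "p [^] (0::nat) \<otimes> \<zero> \<in> PIdl r" by (simp add: P.zero_closed)
      then have "\<zero> \<in> I" unfolding I_def mem_Collect_eq by (intro conjI zero_closed exI)
      then show "I \<noteq> {}" by blast
      fix a assume a: "a \<in> I"
      then obtain n :: nat where n: "a \<in> carrier R" "p [^] n \<otimes> a \<in> PIdl r" by (auto simp: I_def)
      have "p [^] n \<otimes> (\<ominus> a) = \<ominus> (p [^] n \<otimes> a)" using n p by (simp add: r_minus)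
      then have "p [^] n \<otimes> (\<ominus> a) \<in> PIdl r" using n(2) P.a_inv_closed by simp
      then show "inv\<^bsub>add_monoid R\<^esub> a \<in> I" using n(1) by (auto simp: I_def a_inv_def[symmetric])
      fix b assume b: "b \<in> I"
      then obtain m :: nat where m: "b \<in> carrier R" "p [^] m \<otimes> b \<in> PIdl r" by (auto simp: I_def)
      have 1: "p [^] (n+m) \<otimes> a = p [^] m \<otimes> (p [^] n \<otimes> a)"
        using p n by (metis add.commute m_assoc nat_pow_closed nat_pow_mult)
      have 2: "p [^] (n+m) \<otimes> b = p [^] n \<otimes> (p [^] m \<otimes> b)"
        using p m by (metis m_assoc nat_pow_closed nat_pow_mult)
      have "p [^] (n+m) \<otimes> (a \<oplus> b) = p [^] m \<otimes> (p [^] n \<otimes> a) \<oplus> p [^] n \<otimes> (p [^] m \<otimes> b)"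
        using p n m by (simp add: r_distr 1[symmetric] 2[symmetric])
      also have "\<dots> \<in> PIdl r"
        using P.a_closed[OF P.I_l_closed[OF n(2), of "p [^] m"] P.I_l_closed[OF m(2), of
          "p [^] n"]] p by simp
      finally show "a \<otimes>\<^bsub>add_monoid R\<^esub> b \<in> I" using n m by (auto simp: I_def)
    qed
  next
    fix a x assume a: "a \<in> I" and x: "x \<in> carrier R"
    from a obtain n :: nat where n: "a \<in> carrier R" "p [^] n \<otimes> a \<in> PIdl r" by (auto simp: I_def)
    have "p [^] n \<otimes> (a \<otimes> x) = (p [^] n \<otimes> a) \<otimes> x" using n p x by (simp add: m_assoc)
    then have "p [^] n \<otimes> (a \<otimes> x) \<in> PIdl r" using P.I_r_closed[OF n(2) x] by simp
    then show "a \<otimes> x \<in> I" using n x by (auto simp: I_def)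
    then show "x \<otimes> a \<in> I" using n x by (simp add: m_comm)
  qed
  obtain g where g: "g \<in> carrier R" "I = PIdl g" using exists_gen[OF I] by auto
  have "g \<in> I" using g cgenideal_self by auto
  then obtain n :: nat where "p [^] n \<otimes> g \<in> PIdl r" unfolding I_def by blast
  then obtain t where nt: "t \<in> carrier R" "p [^] n \<otimes> g = t \<otimes> r" unfolding cgenideal_def by blast
  obtain s where s: "s \<in> carrier R" "r = p [^] Suc n \<otimes> s" using dvd by blast
  have "p [^] Suc n \<otimes> s \<in> PIdl r" using s cgenideal_self[OF r] by simp
  then have "s \<in> I" unfolding I_def mem_Collect_eq using s(1) by (intro conjI exI)
  then obtain u where u: "u \<in> carrier R" "s = u \<otimes> g" unfolding g(2) cgenideal_def by blast
  have "\<one> \<otimes> r = r" using r by simp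
  also have "r = p \<otimes> u \<otimes> (p [^] n \<otimes> g)"
    unfolding s(2) u(2) using p u g by (simp add: m_ac)
  also have "\<dots> = (p \<otimes> (u \<otimes> t)) \<otimes> r" unfolding nt using p u nt r by (simp add: m_ac)
  finally have "\<one> = p \<otimes> (u \<otimes> t)" using m_rcancel[of r \<one> "p \<otimes> (u \<otimes> t)"] r r0 p(1) u(1) nt(1) by simp
  then have "p divides \<one>" using u(1) nt(1) by (intro dividesI[of "u \<otimes> t"]) auto
  then have "p \<in> Units R" using p(1) Units_one_closed divides_unit by blast
  with p show False by simp
qed

lemma finsum_hom:
  assumes G: "abelian_group G" and H: "abelian_group H"
    and f: "\<And>x. x \<in> carrier G \<Longrightarrow> f x \<in> carrier H"
      "\<And>x y. x \<in> carrier G \<Longrightarrow> y \<in> carrier G \<Longrightarrow> f (x \<oplus>\<^bsub>G\<^esub> y) = f x \<oplus>\<^bsub>H\<^esub> f y"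
    and S: "finite S" "\<And>i. i \<in> S \<Longrightarrow> g i \<in> carrier G"
  shows "f (\<Oplus>\<^bsub>G\<^esub>i\<in>S. g i) = (\<Oplus>\<^bsub>H\<^esub>i\<in>S. f (g i))"
proof -
  interpret G: abelian_group G by (rule G)
  interpret H: abelian_group H by (rule H)
  have "f \<zero>\<^bsub>G\<^esub> \<oplus>\<^bsub>H\<^esub> f \<zero>\<^bsub>G\<^esub> = f \<zero>\<^bsub>G\<^esub>" using f(2)[of "\<zero>\<^bsub>G\<^esub>" "\<zero>\<^bsub>G\<^esub>"] by simp
  then have f0: "f \<zero>\<^bsub>G\<^esub> = \<zero>\<^bsub>H\<^esub>" using H.add.r_cancel_one'[of "f \<zero>\<^bsub>G\<^esub>" "f \<zero>\<^bsub>G\<^esub>"] f(1) by simp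
  show ?thesis using S
  proof (induction S)
    case empty then show ?case by (simp add: f0)
  next
    case (insert i S)
    have "(\<Oplus>\<^bsub>G\<^esub>i\<in>insert i S. g i) = g i \<oplus>\<^bsub>G\<^esub> (\<Oplus>\<^bsub>G\<^esub>i\<in>S. g i)"
      using insert.hyps insert.prems by (intro G.finsum_insert) auto
    moreover have "(\<Oplus>\<^bsub>H\<^esub>i\<in>insert i S. f (g i)) = f (g i) \<oplus>\<^bsub>H\<^esub> (\<Oplus>\<^bsub>H\<^esub>i\<in>S. f (g i))"
      using insert.hyps insert.prems f(1) by (intro H.finsum_insert) auto
    moreover have "(\<Oplus>\<^bsub>G\<^esub>i\<in>S. g i) \<in> carrier G" using insert.prems by (intro G.finsum_closed) auto
    ultimately show ?case using insert.IH insert.prems f(2) by simp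
  qed
qed

text \<open>Coordinates with respect to an independent family, uniformly for a basis over \<open>R\<close> and for a
  basis over the noncommutative ring \<open>A\<close>: \<open>m j a\<close> stands for \<open>a\<close> times the \<open>j\<close>-th basis element.\<close>

locale additive_family = A?: abelian_group A + G?: abelian_group G
  for A :: "('a, 'x) ring_scheme" and G :: "('g, 'y) ring_scheme" +
  fixes m :: "'j \<Rightarrow> 'a \<Rightarrow> 'g" and J :: "'j set"
  assumes m_closed: "\<And>j a. j \<in> J \<Longrightarrow> a \<in> carrier A \<Longrightarrow> m j a \<in> carrier G"
    and m_add: "\<And>j a b. j \<in> J \<Longrightarrow> a \<in> carrier A \<Longrightarrow> b \<in> carrier A \<Longrightarrow>
      m j (a \<oplus>\<^bsub>A\<^esub> b) = m j a \<oplus>\<^bsub>G\<^esub> m j b"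
begin

text \<open>A coefficient function is total and zero off a finite support, so that for an
  independent family it is unique as a function and indices outside \<open>J\<close> get coefficient
  zero.\<close>

definition represents :: "('j \<Rightarrow> 'a) \<Rightarrow> 'g \<Rightarrow> bool" where
  "represents c x \<longleftrightarrow> (\<exists>S. finite S \<and> S \<subseteq> J \<and> (\<forall>j. c j \<in> carrier A) \<and> (\<forall>j. j \<notin> S \<longrightarrow> c j = \<zero>\<^bsub>A\<^esub>)
     \<and> x = (\<Oplus>\<^bsub>G\<^esub>j\<in>S. m j (c j)))"

lemma m_zero: assumes "j \<in> J" shows "m j \<zero>\<^bsub>A\<^esub> = \<zero>\<^bsub>G\<^esub>"
proof -
  have "m j \<zero>\<^bsub>A\<^esub> \<oplus>\<^bsub>G\<^esub> m j \<zero>\<^bsub>A\<^esub> = m j \<zero>\<^bsub>A\<^esub>" using m_add[of j "\<zero>\<^bsub>A\<^esub>" "\<zero>\<^bsub>A\<^esub>"] assms by simp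
  then show ?thesis using m_closed[of j "\<zero>\<^bsub>A\<^esub>"] assms by (metis A.zero_closed G.add.r_cancel_one')
qed

lemma sum_superset:
  assumes "finite T" "S \<subseteq> T" "T \<subseteq> J" "\<And>j. c j \<in> carrier A" "\<And>j. j \<notin> S \<Longrightarrow> c j = \<zero>\<^bsub>A\<^esub>"
  shows "(\<Oplus>\<^bsub>G\<^esub>j\<in>S. m j (c j)) = (\<Oplus>\<^bsub>G\<^esub>j\<in>T. m j (c j))"
  by (rule G.add.finprod_mono_neutral_cong_left) (use assms m_zero m_closed in auto)

lemma represents_add:
  assumes "represents c x" "represents d y"
  shows "represents (\<lambda>j. c j \<oplus>\<^bsub>A\<^esub> d j) (x \<oplus>\<^bsub>G\<^esub> y)"
proof -
  obtain S where S: "finite S" "S \<subseteq> J" "\<And>j. c j \<in> carrier A" "\<And>j. j \<notin> S \<Longrightarrow> c j = \<zero>\<^bsub>A\<^esub>"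
    "x = (\<Oplus>\<^bsub>G\<^esub>j\<in>S. m j (c j))" using assms(1) unfolding represents_def by blast
  obtain T where T: "finite T" "T \<subseteq> J" "\<And>j. d j \<in> carrier A" "\<And>j. j \<notin> T \<Longrightarrow> d j = \<zero>\<^bsub>A\<^esub>"
    "y = (\<Oplus>\<^bsub>G\<^esub>j\<in>T. m j (d j))" using assms(2) unfolding represents_def by blast
  have x: "x = (\<Oplus>\<^bsub>G\<^esub>j\<in>S \<union> T. m j (c j))" unfolding S(5) by (rule sum_superset) (use S T in auto)
  have y: "y = (\<Oplus>\<^bsub>G\<^esub>j\<in>S \<union> T. m j (d j))" unfolding T(5) by (rule sum_superset) (use S T in auto)
  have "x \<oplus>\<^bsub>G\<^esub> y = (\<Oplus>\<^bsub>G\<^esub>j\<in>S \<union> T. m j (c j) \<oplus>\<^bsub>G\<^esub> m j (d j))" unfolding x y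
    by (rule G.add.finprod_multf[symmetric]) (use S T m_closed in auto)
  also have "\<dots> = (\<Oplus>\<^bsub>G\<^esub>j\<in>S \<union> T. m j (c j \<oplus>\<^bsub>A\<^esub> d j))"
    by (rule G.add.finprod_cong') (use S T m_closed m_add in \<open>auto simp: subset_iff\<close>)
  finally show ?thesis unfolding represents_def using S T by (intro exI[of _ "S \<union> T"]) auto
qed

text \<open>Serves both negation and the action of a scalar: \<open>U\<close> is the effect on
  coefficients of the additive map \<open>V\<close>.\<close>

lemma represents_map:
  assumes x: "represents c x"
    and U: "\<And>a. a \<in> carrier A \<Longrightarrow> U a \<in> carrier A" "U \<zero>\<^bsub>A\<^esub> = \<zero>\<^bsub>A\<^esub>"
    and V: "\<And>x. x \<in> carrier G \<Longrightarrow> V x \<in> carrier G"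
       "\<And>x y. x \<in> carrier G \<Longrightarrow> y \<in> carrier G \<Longrightarrow> V (x \<oplus>\<^bsub>G\<^esub> y) = V x \<oplus>\<^bsub>G\<^esub> V y"
    and UV: "\<And>j a. j \<in> J \<Longrightarrow> a \<in> carrier A \<Longrightarrow> V (m j a) = m j (U a)"
  shows "represents (\<lambda>j. U (c j)) (V x)"
proof -
  obtain S where S: "finite S" "S \<subseteq> J" "\<And>j. c j \<in> carrier A" "\<And>j. j \<notin> S \<Longrightarrow> c j = \<zero>\<^bsub>A\<^esub>"
    "x = (\<Oplus>\<^bsub>G\<^esub>j\<in>S. m j (c j))" using x unfolding represents_def by blast
  have "V (\<Oplus>\<^bsub>G\<^esub>j\<in>S. m j (c j)) = (\<Oplus>\<^bsub>G\<^esub>j\<in>S. V (m j (c j)))"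
    by (rule finsum_hom) (use S V m_closed G.abelian_group_axioms in auto)
  also have "\<dots> = (\<Oplus>\<^bsub>G\<^esub>j\<in>S. m j (U (c j)))"
    by (rule G.add.finprod_cong') (use S U UV m_closed in auto)
  finally have "V (\<Oplus>\<^bsub>G\<^esub>j\<in>S. m j (c j)) = (\<Oplus>\<^bsub>G\<^esub>j\<in>S. m j (U (c j)))" .
  then show ?thesis unfolding represents_def S(5) using S U by (intro exI[of _ S]) auto
qed

lemma represents_single:
  assumes "j \<in> J" "a \<in> carrier A"
  shows "represents (\<lambda>i. if i = j then a else \<zero>\<^bsub>A\<^esub>) (m j a)"
  unfolding represents_def using assms m_closed by (intro exI[of _ "{j}"]) auto

lemma represents_closed: "represents c x \<Longrightarrow> x \<in> carrier G"
  unfolding represents_def using m_closed by (auto intro!: G.finsum_closed)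

end

locale indep_family = additive_family A G m J for A G m J +
  assumes indep: "\<And>S c j. finite S \<Longrightarrow> S \<subseteq> J \<Longrightarrow> c \<in> S \<rightarrow> carrier A \<Longrightarrow>
      (\<Oplus>\<^bsub>G\<^esub>j\<in>S. m j (c j)) = \<zero>\<^bsub>G\<^esub> \<Longrightarrow> j \<in> S \<Longrightarrow> c j = \<zero>\<^bsub>A\<^esub>"
begin

definition coord where
  "coord j x = (THE c. represents c x) j"

lemma represents_unique:
  assumes c: "represents c x" and d: "represents d x"
  shows "c = d"
proof -
  have m_inv: "m j (\<ominus>\<^bsub>A\<^esub> a) = \<ominus>\<^bsub>G\<^esub> m j a" if "j \<in> J" "a \<in> carrier A" for j a
  proof (rule G.add.inv_equality[symmetric, unfolded a_inv_def[symmetric], simplified])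
    show "m j (\<ominus>\<^bsub>A\<^esub> a) \<oplus>\<^bsub>G\<^esub> m j a = \<zero>\<^bsub>G\<^esub>"
      using m_add[of j "\<ominus>\<^bsub>A\<^esub> a" a] m_zero that by (simp add: A.l_neg)
  qed (use that m_closed in auto)
  have "represents (\<lambda>j. \<ominus>\<^bsub>A\<^esub> d j) (\<ominus>\<^bsub>G\<^esub> x)"
    by (rule represents_map[OF d]) (use m_inv in \<open>auto simp: G.minus_add\<close>)
  then have "represents (\<lambda>j. c j \<oplus>\<^bsub>A\<^esub> \<ominus>\<^bsub>A\<^esub> d j) (x \<oplus>\<^bsub>G\<^esub> \<ominus>\<^bsub>G\<^esub> x)" by (rule represents_add[OF c])
  moreover have "x \<in> carrier G" by (rule represents_closed[OF c])
  ultimately obtain S where S: "finite S" "S \<subseteq> J" "\<And>j. c j \<oplus>\<^bsub>A\<^esub> \<ominus>\<^bsub>A\<^esub> d j \<in> carrier A"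
     "\<And>j. j \<notin> S \<Longrightarrow> c j \<oplus>\<^bsub>A\<^esub> \<ominus>\<^bsub>A\<^esub> d j = \<zero>\<^bsub>A\<^esub>" "(\<Oplus>\<^bsub>G\<^esub>j\<in>S. m j (c j \<oplus>\<^bsub>A\<^esub> \<ominus>\<^bsub>A\<^esub> d j)) = \<zero>\<^bsub>G\<^esub>"
    unfolding represents_def by (auto simp: G.r_neg)
  have "c j \<oplus>\<^bsub>A\<^esub> \<ominus>\<^bsub>A\<^esub> d j = \<zero>\<^bsub>A\<^esub>" for j
    using indep[OF S(1,2), of "\<lambda>j. c j \<oplus>\<^bsub>A\<^esub> \<ominus>\<^bsub>A\<^esub> d j"] S by auto
  moreover have "c j \<in> carrier A" "d j \<in> carrier A" for j using c d unfolding represents_def by auto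
  ultimately have "c j = d j" for j
    using A.minus_equality[of "c j" "\<ominus>\<^bsub>A\<^esub> d j"] by simp
  then show ?thesis by blast
qed

lemma coord_eq: "represents c x \<Longrightarrow> coord j x = c j"
  unfolding coord_def using represents_unique by (metis the_equality)

end

text \<open>The functions are indexed by the whole type and vanish off the basis, so that no basis
  has to be mentioned afterwards. In this form freeness can be composed with coordinates over
  \<open>A\<close> and restricted to submodules.\<close>

lemma (in free_module) coordinates:
  obtains co :: "'c \<Rightarrow> 'c \<Rightarrow> 'a" where
    "\<And>b x. x \<in> carrier M \<Longrightarrow> co b x \<in> carrier R"
    "\<And>b x y. x \<in> carrier M \<Longrightarrow> y \<in> carrier M \<Longrightarrow> co b (x \<oplus>\<^bsub>M\<^esub> y) = co b x \<oplus> co b y"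
    "\<And>b r x. r \<in> carrier R \<Longrightarrow> x \<in> carrier M \<Longrightarrow> co b (r \<odot>\<^bsub>M\<^esub> x) = r \<otimes> co b x"
    "\<And>x. x \<in> carrier M \<Longrightarrow> finite {b. co b x \<noteq> \<zero>}"
    "\<And>x. x \<in> carrier M \<Longrightarrow> (\<And>b. co b x = \<zero>) \<Longrightarrow> x = \<zero>\<^bsub>M\<^esub>"
proof -
  obtain B where B: "B \<subseteq> carrier M" "lin_indpt B" "span B = carrier M" using ex_basis by auto
  interpret F: indep_family R M "\<lambda>b r. r \<odot>\<^bsub>M\<^esub> b" B
  proof unfold_locales
    fix S c j assume "finite S" "S \<subseteq> B" "c \<in> S \<rightarrow> carrier R"
      "(\<Oplus>\<^bsub>M\<^esub>j\<in>S. c j \<odot>\<^bsub>M\<^esub> j) = \<zero>\<^bsub>M\<^esub>" "j \<in> S"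
    then show "c j = \<zero>" using lin_dep_crit[of S B c j] B by (auto simp: lincomb_def)
  qed (use B in \<open>auto simp: smult_l_distr\<close>)
  have ex: "\<exists>c. F.represents c x" if "x \<in> carrier M" for x
  proof -
    obtain S c where S: "finite S" "S \<subseteq> B" "c \<in> S \<rightarrow> carrier R" "x = lincomb c S"
      using \<open>x \<in> carrier M\<close> unfolding B(3)[symmetric] span_def by auto
    have "F.represents (\<lambda>b. if b \<in> S then c b else \<zero>) x" unfolding F.represents_def
    proof (intro exI[of _ S] conjI)
      have cl: "c b \<odot>\<^bsub>M\<^esub> b \<in> carrier M" if "b \<in> S" for b
      proof (rule smult_closed)
        show "c b \<in> carrier R" by (rule funcset_mem[OF S(3) that])
        show "b \<in> carrier M" using S(2) B(1) that by blast
      qed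
      have "lincomb c S = (\<Oplus>\<^bsub>M\<^esub>j\<in>S. (if j \<in> S then c j else \<zero>) \<odot>\<^bsub>M\<^esub> j)"
        unfolding lincomb_def by (rule M.add.finprod_cong') (use cl in auto)
      then show "x = (\<Oplus>\<^bsub>M\<^esub>j\<in>S. (if j \<in> S then c j else \<zero>) \<odot>\<^bsub>M\<^esub> j)" using S(4) by simp
      show "\<forall>j. (if j \<in> S then c j else \<zero>) \<in> carrier R" using S(3) by (simp add: Pi_iff)
    qed (use S(1,2) in auto)
    then show ?thesis by blast
  qed
  show thesis
  proof (rule that[of F.coord])
    fix b x assume "x \<in> carrier M"
    then obtain c where c: "F.represents c x" using ex by blast
    then show "F.coord b x \<in> carrier R" unfolding F.coord_eq[OF c] unfolding F.represents_def
      by blast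
  next
    fix b x y assume "x \<in> carrier M" "y \<in> carrier M"
    then obtain c d where c: "F.represents c x" and d: "F.represents d y" using ex by blast
    show "F.coord b (x \<oplus>\<^bsub>M\<^esub> y) = F.coord b x \<oplus> F.coord b y"
      unfolding F.coord_eq[OF c] F.coord_eq[OF d] F.coord_eq[OF F.represents_add[OF c d]] ..
  next
    fix b r x assume r: "r \<in> carrier R" and x: "x \<in> carrier M"
    obtain c where c: "F.represents c x" using ex x by blast
    have "F.represents (\<lambda>j. r \<otimes> c j) (r \<odot>\<^bsub>M\<^esub> x)"
    proof (rule F.represents_map[OF c])
      fix j a assume "j \<in> B" "a \<in> carrier R"
      then show "r \<odot>\<^bsub>M\<^esub> (a \<odot>\<^bsub>M\<^esub> j) = (r \<otimes> a) \<odot>\<^bsub>M\<^esub> j" using B r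
        by (simp add: smult_assoc1 subset_iff)
    qed (use r in \<open>auto simp: smult_r_distr\<close>)
    from F.coord_eq[OF this] F.coord_eq[OF c]
    show "F.coord b (r \<odot>\<^bsub>M\<^esub> x) = r \<otimes> F.coord b x" by simp
  next
    fix x assume "x \<in> carrier M"
    then obtain c where c: "F.represents c x" using ex by blast
    then obtain S where S: "finite S" "\<And>j. j \<notin> S \<Longrightarrow> c j = \<zero>" unfolding F.represents_def by blast
    have "finite {b. c b \<noteq> \<zero>}" by (rule finite_subset[OF _ S(1)]) (use S(2) in auto)
    then show "finite {b. F.coord b x \<noteq> \<zero>}" using F.coord_eq[OF c] by simp
  next
    fix x assume "x \<in> carrier M" and 0: "\<And>b. F.coord b x = \<zero>"
    then obtain c where c: "F.represents c x" using ex by blast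
    have c0: "c b = \<zero>" for b using 0[of b] F.coord_eq[OF c] by simp
    obtain S where S: "finite S" "S \<subseteq> B" "x = (\<Oplus>\<^bsub>M\<^esub>j\<in>S. c j \<odot>\<^bsub>M\<^esub> j)" using c
      unfolding F.represents_def by blast
    show "x = \<zero>\<^bsub>M\<^esub>" unfolding S(3) by (rule M.add.finprod_one_eqI) (use S B c0 in auto)
  qed
qed

text \<open>The usual proof that a submodule of a free module over a principal ideal domain is free:
  for each \<open>k\<close> pick an element without coordinates beyond \<open>k\<close> whose \<open>k\<close>-th coordinate generates
  the ideal of all such coordinates.\<close>

lemma (in module) free_module_if_coordinates:
  fixes \<theta> :: "nat \<Rightarrow> 'c \<Rightarrow> 'a"
  assumes PID: "principal_domain R"
    and cl: "\<And>k x. x \<in> carrier M \<Longrightarrow> \<theta> k x \<in> carrier R"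
    and add: "\<And>k x y. x \<in> carrier M \<Longrightarrow> y \<in> carrier M \<Longrightarrow> \<theta> k (x \<oplus>\<^bsub>M\<^esub> y) = \<theta> k x \<oplus> \<theta> k y"
    and smult: "\<And>k r x. r \<in> carrier R \<Longrightarrow> x \<in> carrier M \<Longrightarrow> \<theta> k (r \<odot>\<^bsub>M\<^esub> x) = r \<otimes> \<theta> k x"
    and fin: "\<And>x. x \<in> carrier M \<Longrightarrow> finite {k. \<theta> k x \<noteq> \<zero>}"
    and sep: "\<And>x. x \<in> carrier M \<Longrightarrow> (\<And>k. \<theta> k x = \<zero>) \<Longrightarrow> x = \<zero>\<^bsub>M\<^esub>"
  shows "free_module R M"
proof -
  interpret P: principal_domain R by (rule PID)
  have th0: "\<theta> k \<zero>\<^bsub>M\<^esub> = \<zero>" for k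
    using smult[of \<zero> "\<zero>\<^bsub>M\<^esub>" k] cl[of "\<zero>\<^bsub>M\<^esub>" k] by simp
  have thneg: "\<theta> k (\<ominus>\<^bsub>M\<^esub> x) = \<ominus> \<theta> k x" if "x \<in> carrier M" for k x
  proof -
    have "\<theta> k (\<ominus>\<^bsub>M\<^esub> x) \<oplus> \<theta> k x = \<zero>" using add[of "\<ominus>\<^bsub>M\<^esub> x" x k] that th0 by (simp add: M.l_neg)
    then show ?thesis using R.minus_equality[of "\<theta> k (\<ominus>\<^bsub>M\<^esub> x)" "\<theta> k x"] that cl by simp
  qed
  define V where "V k = {x \<in> carrier M. \<forall>m>k. \<theta> m x = \<zero>}" for k
  have ideal: "ideal (\<theta> k ` V k) R" for k
  proof (rule idealI)
    show "ring R" by (rule R.ring_axioms)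
    show "subgroup (\<theta> k ` V k) (add_monoid R)"
    proof (rule group.subgroupI)
      show "group (add_monoid R)" by (rule R.add.is_group)
      show "\<theta> k ` V k \<subseteq> carrier (add_monoid R)" using cl by (auto simp: V_def)
      have "\<zero>\<^bsub>M\<^esub> \<in> V k" by (simp add: V_def th0)
      then show "\<theta> k ` V k \<noteq> {}" by blast
      fix a assume "a \<in> \<theta> k ` V k"
      then obtain x where x: "x \<in> V k" "a = \<theta> k x" by blast
      have "\<ominus>\<^bsub>M\<^esub> x \<in> V k" using x(1) by (simp add: V_def thneg)
      moreover have "inv\<^bsub>add_monoid R\<^esub> a = \<theta> k (\<ominus>\<^bsub>M\<^esub> x)"
        using x thneg[of x k] by (simp add: V_def a_inv_def[symmetric])
      ultimately show "inv\<^bsub>add_monoid R\<^esub> a \<in> \<theta> k ` V k" by blast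
      fix b assume "b \<in> \<theta> k ` V k"
      then obtain y where y: "y \<in> V k" "b = \<theta> k y" by blast
      have "x \<oplus>\<^bsub>M\<^esub> y \<in> V k" using x(1) y(1) by (simp add: V_def add)
      moreover have "a \<otimes>\<^bsub>add_monoid R\<^esub> b = \<theta> k (x \<oplus>\<^bsub>M\<^esub> y)"
        using x y add[of x y k] by (simp add: V_def)
      ultimately show "a \<otimes>\<^bsub>add_monoid R\<^esub> b \<in> \<theta> k ` V k" by blast
    qed
  next
    fix a r assume "a \<in> \<theta> k ` V k" and r: "r \<in> carrier R"
    then obtain x where x: "x \<in> V k" "a = \<theta> k x" by blast
    have "r \<odot>\<^bsub>M\<^esub> x \<in> V k" using x(1) r by (simp add: V_def smult)
    moreover have "r \<otimes> a = \<theta> k (r \<odot>\<^bsub>M\<^esub> x)" using x r smult[of r x k] by (simp add: V_def)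
    ultimately show "r \<otimes> a \<in> \<theta> k ` V k" by blast
    moreover have "a \<otimes> r = r \<otimes> a" using x r cl by (simp add: V_def R.m_comm)
    ultimately show "a \<otimes> r \<in> \<theta> k ` V k" by simp
  qed
  have "\<exists>h\<in>V k. \<forall>x\<in>V k. \<exists>s\<in>carrier R. \<theta> k x = s \<otimes> \<theta> k h" for k
  proof -
    obtain g where g: "g \<in> carrier R" "\<theta> k ` V k = PIdl g" using P.exists_gen[OF ideal] by blast
    have "g \<in> \<theta> k ` V k" unfolding g(2) by (rule R.cgenideal_self[OF g(1)])
    then obtain h where h: "h \<in> V k" "g = \<theta> k h" by blast
    have "\<exists>s\<in>carrier R. \<theta> k x = s \<otimes> \<theta> k h" if "x \<in> V k" for x
    proof -
      have "\<theta> k x \<in> PIdl g" using that g(2) by blast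
      then show ?thesis unfolding h(2) cgenideal_def by blast
    qed
    then show ?thesis using h by blast
  qed
  then obtain h where h: "\<And>k. h k \<in> V k" "\<And>k x. x \<in> V k \<Longrightarrow> \<exists>s\<in>carrier R. \<theta> k x = s \<otimes> \<theta> k (h k)"
    by metis
  have hM: "h k \<in> carrier M" and hz: "m > k \<Longrightarrow> \<theta> m (h k) = \<zero>" for k m
    using h(1)[of k] by (auto simp: V_def)
  \<comment> \<open>Where the ideal of \<open>k\<close>-th coordinates is zero there is no basis
    element to add: by \<open>h(2)\<close> the \<open>k\<close>-th coordinate then vanishes on all
    of \<open>V k\<close>.\<close>
  define K where "K = {k. \<theta> k (h k) \<noteq> \<zero>}"
  define B where "B = h ` K"
  have BM: "B \<subseteq> carrier M" using hM by (auto simp: B_def)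
  have inj: "inj_on h K"
  proof (rule inj_onI)
    fix k l assume "k \<in> K" "l \<in> K" "h k = h l"
    then show "k = l" using hz[of k l] hz[of l k]
      by (cases k l rule: linorder_cases) (auto simp: K_def)
  qed
  have sub: "Module.submodule (span B) R M"
  proof -
    interpret S: LinearCombinations.submodule R "span B" M by (rule span_is_submodule[OF BM])
    have "\<ominus>\<^bsub>M\<^esub> x \<in> span B" if "x \<in> span B" for x
    proof -
      have "(\<ominus> \<one>) \<odot>\<^bsub>M\<^esub> x \<in> span B" by (rule S.smult_closed[OF _ that]) simp
      moreover have "x \<in> carrier M" using that S.subset by blast
      ultimately show ?thesis by (metis smult_minus_1)
    qed
    then show ?thesis
      using S.subset S.zero_closed S.m_closed S.smult_closed
      by (intro submoduleI) auto
  qed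
  interpret S: Module.submodule "span B" R M by (rule sub)
  \<comment> \<open>Induction on the bound \<open>k\<close> for the coordinates: subtracting the
    right multiple of \<open>h k\<close> kills coordinate \<open>k\<close> and leaves the higher
    ones zero.\<close>
  have in_span: "x \<in> span B" if "x \<in> carrier M" "\<And>m. m \<ge> k \<Longrightarrow> \<theta> m x = \<zero>" for k x
    using that
  proof (induction k arbitrary: x)
    case 0
    then have "x = \<zero>\<^bsub>M\<^esub>" using sep by auto
    then show ?case using S.one_closed by simp
  next
    case (Suc k)
    have "x \<in> V k" using Suc.prems by (simp add: V_def)
    then obtain s where s: "s \<in> carrier R" "\<theta> k x = s \<otimes> \<theta> k (h k)" using h(2) by blast
    show ?case
    proof (cases "k \<in> K")
      case True
      define y where "y = x \<oplus>\<^bsub>M\<^esub> \<ominus>\<^bsub>M\<^esub> (s \<odot>\<^bsub>M\<^esub> h k)"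
      have yM: "y \<in> carrier M" using Suc.prems(1) s(1) hM by (simp add: y_def)
      have y: "\<theta> m y = \<theta> m x \<oplus> \<ominus> (s \<otimes> \<theta> m (h k))" for m
        using Suc.prems(1) s(1) hM by (simp add: y_def add thneg smult)
      have "y \<in> span B"
      proof (rule Suc.IH[OF yM])
        fix m assume m: "m \<ge> k"
        show "\<theta> m y = \<zero>"
        proof (cases "m = k")
          case True
          then show ?thesis using y[of k] s cl[OF hM, of k k] by (simp add: R.r_neg)
        next
          case False
          then have "m > k" using m by simp
          then show ?thesis using y[of m] Suc.prems(2)[of m] hz[of k m] s(1) by simp
        qed
      qed
      moreover have "s \<odot>\<^bsub>M\<^esub> h k \<in> span B"
        using in_own_span[OF BM] True s(1) by (intro S.smult_closed) (auto simp: B_def)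
      ultimately have "y \<oplus>\<^bsub>M\<^esub> s \<odot>\<^bsub>M\<^esub> h k \<in> span B" using S.m_closed by simp
      moreover have "y \<oplus>\<^bsub>M\<^esub> s \<odot>\<^bsub>M\<^esub> h k = x"
        using Suc.prems(1) s(1) hM by (simp add: y_def M.a_assoc M.l_neg)
      ultimately show ?thesis by simp
    next
      case False
      then have "\<theta> k x = \<zero>" using s by (simp add: K_def)
      then have "\<theta> m x = \<zero>" if "m \<ge> k" for m using Suc.prems(2)[of m] that by (cases "m = k") auto
      then show ?thesis using Suc.IH Suc.prems(1) by blast
    qed
  qed
  have gen: "gen_set B"
  proof
    show "span B \<subseteq> carrier M" using S.subset by simp
    show "carrier M \<subseteq> span B"
    proof
      fix x assume x: "x \<in> carrier M"
      obtain k where k: "\<forall>m\<in>{m. \<theta> m x \<noteq> \<zero>}. m < k"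
        using fin[OF x] unfolding finite_nat_set_iff_bounded ..
      show "x \<in> span B"
      proof (rule in_span[OF x])
        fix m assume "m \<ge> k"
        then show "\<theta> m x = \<zero>" using k by force
      qed
    qed
  qed
  have "lin_indpt B"
  proof
    assume "lin_dep B"
    then obtain A a v
      where A: "finite A" "A \<subseteq> B" "a \<in> A \<rightarrow> carrier R" "lincomb a A = \<zero>\<^bsub>M\<^esub>" "v \<in> A" "a v \<noteq> \<zero>"
      unfolding lin_dep_def by blast
    have aR: "a w \<in> carrier R" if "w \<in> A" for w using A(3) that by blast
    have AM: "w \<in> carrier M" if "w \<in> A" for w using A(2) BM that by blast
    define T where "T = {k \<in> K. h k \<in> A \<and> a (h k) \<noteq> \<zero>}"
    have "h ` T \<subseteq> A" by (auto simp: T_def)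
    have "inj_on h T" by (rule inj_on_subset[OF inj]) (auto simp: T_def)
    with finite_subset[OF \<open>h ` T \<subseteq> A\<close> A(1)] have finT: "finite T" by (rule finite_imageD)
    have "v \<in> h ` K" using A(2,5) unfolding B_def by (rule subsetD)
    then obtain l where "l \<in> K" "v = h l" by (rule imageE)
    then have "l \<in> T" using A(5,6) by (simp add: T_def)
    then have "T \<noteq> {}" by blast
    \<comment> \<open>The largest index of a relation is decisive: every other \<open>h l\<close>
      occurring in it has \<open>l < k\<close>, hence \<open>k\<close>-th coordinate zero, or
      coefficient zero.\<close>
    define k where "k = Max T"
    have kT: "k \<in> T" unfolding k_def using Max_in finT \<open>T \<noteq> {}\<close> by blast
    have "\<theta> k (lincomb a A) = (\<Oplus>w\<in>A. \<theta> k (a w \<odot>\<^bsub>M\<^esub> w))" unfolding lincomb_def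
      by (rule finsum_hom) (use add cl A(1) aR AM R.abelian_group_axioms M.abelian_group_axioms in auto)
    also have "\<dots> = (\<Oplus>w\<in>A. if h k = w then a w \<otimes> \<theta> k w else \<zero>)"
    proof (rule R.add.finprod_cong')
      fix w assume w: "w \<in> A"
      then have "w \<in> h ` K" using A(2) unfolding B_def by blast
      then obtain l where l: "l \<in> K" "w = h l" by (rule imageE)
      have eq: "\<theta> k (a w \<odot>\<^bsub>M\<^esub> w) = a w \<otimes> \<theta> k w" using smult aR AM w by blast
      show "\<theta> k (a w \<odot>\<^bsub>M\<^esub> w) = (if h k = w then a w \<otimes> \<theta> k w else \<zero>)"
      proof (cases "h k = w")
        case False
        then have "l \<noteq> k" using l by auto
        have "a w \<otimes> \<theta> k w = \<zero>"
        proof (cases "l < k")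
          case True
          then show ?thesis using hz[of l k] l aR[OF w] by simp
        next
          case F: False
          then have "l \<notin> T" using Max_ge[OF finT, of l] \<open>l \<noteq> k\<close> k_def by fastforce
          then have "a w = \<zero>" using l w by (simp add: T_def)
          then show ?thesis using cl[OF AM[OF w]] by simp
        qed
        then show ?thesis using False eq by simp
      qed (simp add: eq)
    qed (use aR cl AM in auto)
    also have "\<dots> = a (h k) \<otimes> \<theta> k (h k)"
      by (rule R.add.finprod_singleton) (use kT A(1) aR cl AM in \<open>auto simp: T_def\<close>)
    finally have "a (h k) \<otimes> \<theta> k (h k) = \<zero>" using A(4) th0 by simp
    moreover have "a (h k) \<noteq> \<zero>" "\<theta> k (h k) \<noteq> \<zero>" "a (h k) \<in> carrier R"
      using kT aR by (auto simp: T_def K_def)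
    ultimately show False using P.integral[of "a (h k)" "\<theta> k (h k)"] cl[OF hM] by blast
  qed
  with gen BM show ?thesis by (intro free_module.intro module_axioms free_module_axioms.intro) blast
qed

section \<open>Branches of the binary tree\<close>

text \<open>The nodes of level \<open>n\<close> of the binary tree are the numbers in \<open>{2 ^ n..<2 ^ Suc n}\<close>, the parent
  of \<open>u\<close> being \<open>u div 2\<close>; \<open>node s n\<close> is the node of level \<open>n\<close> on the branch with digits \<open>s\<close>.\<close>

primrec node :: "nat set \<Rightarrow> nat \<Rightarrow> nat" where
  "node s 0 = 1"
| "node s (Suc n) = 2 * node s n + (if n \<in> s then 1 else 0)"

lemma node_ge: "2 ^ n \<le> node s n"
  by (induction n) auto

lemma node_less: "node s n < 2 ^ Suc n"
  by (induction n) auto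

lemma node_level:
  assumes "node s n = node t m" shows "n = m"
proof (rule ccontr)
  assume "n \<noteq> m"
  then consider "Suc n \<le> m" | "Suc m \<le> n" by linarith
  then show False
  proof cases
    case 1
    then have "(2::nat) ^ Suc n \<le> 2 ^ m" by (intro power_increasing) auto
    then show False using assms node_less[of s n] node_ge[of m t] by linarith
  next
    case 2
    then have "(2::nat) ^ Suc m \<le> 2 ^ n" by (intro power_increasing) auto
    then show False using assms node_less[of t m] node_ge[of n s] by linarith
  qed
qed

lemma node_div: "node s (Suc n) div 2 = node s n"
  by simp

lemma node_eq_mono:
  assumes "node s n = node t n" "m \<le> n" shows "node s m = node t m"
  using assms(2,1)
proof (induction n rule: dec_induct)
  case (step n)
  then show ?case using node_div[of s n] node_div[of t n] by metis
qed simp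

lemma node_separates:
  assumes "s \<noteq> t" obtains n where "node s n \<noteq> node t n"
proof -
  obtain n where "(n \<in> s) \<noteq> (n \<in> t)" using assms by blast
  then have "node s (Suc n) mod 2 \<noteq> node t (Suc n) mod 2" by auto
  then show ?thesis using that by metis
qed

declare node.simps(2) [simp del]

text \<open>Positions of digits: a node \<open>u\<close> of level \<open>Suc n\<close> is given the position \<open>node_pos u\<close> between
  \<open>level_pos n\<close> and \<open>level_pos (Suc n)\<close>. All of them are squares, so that the gaps between them
  grow.\<close>

definition level_pos :: "nat \<Rightarrow> nat" where "level_pos n = (2 ^ (n + 2) - 1)\<^sup>2"
definition node_pos :: "nat \<Rightarrow> nat" where "node_pos u = (2 * u)\<^sup>2"

lemma square_gap:
  fixes a b :: nat assumes "a < b" shows "a\<^sup>2 + 2 * a < b\<^sup>2"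
proof -
  have "(Suc a)\<^sup>2 \<le> b\<^sup>2" using assms by (intro power_mono) auto
  moreover have "(Suc a)\<^sup>2 = a\<^sup>2 + 2 * a + 1" by (simp add: power2_eq_square)
  ultimately show ?thesis by linarith
qed

lemma level_pos_root: "2 ^ n \<le> (2::nat) ^ (n + 2) - 1" "(2::nat) ^ (n + 2) - 1 < 2 ^ Suc (n + 1)"
  using one_le_power[of "2::nat" n] by (simp_all add: power_add)

text \<open>Node positions have even roots \<open>2 * u\<close>, and the root of
  \<open>level_pos n\<close> is the odd number \<open>2 ^ (n + 2) - 1\<close> just between the roots
  belonging to levels \<open>n\<close> and \<open>Suc n\<close>. The slack \<open>2 ^ n\<close> is
  the distance of neighbouring squares with roots of at least that size.\<close>

lemma level_pos_less_node_pos: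
  assumes "2 ^ Suc n \<le> u" shows "level_pos n + 2 ^ n < node_pos u"
proof -
  have "(2::nat) ^ (n + 2) - 1 < 2 ^ (n + 2)" by simp
  also have "\<dots> \<le> 2 * u" using assms by simp
  finally have "(2::nat) ^ (n + 2) - 1 < 2 * u" .
  from square_gap[OF this] show ?thesis unfolding level_pos_def node_pos_def
    using level_pos_root(1)[of n] by linarith
qed

lemma node_pos_less_level_pos:
  assumes "2 ^ n \<le> u" "u < 2 ^ Suc n" shows "node_pos u + 2 ^ n < level_pos n"
proof -
  have "2 * u < (2::nat) ^ (n + 2) - 1" using assms(2) by simp
  from square_gap[OF this] show ?thesis unfolding level_pos_def node_pos_def using assms(1)
    by linarith
qed

lemma node_pos_gap:
  assumes "2 ^ n \<le> u" "u < v" shows "node_pos u + 2 ^ n < node_pos v"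
  using square_gap[of "2 * u" "2 * v"] assms unfolding node_pos_def by linarith

lemma level_pos_Suc: "level_pos n + 2 ^ n < level_pos (Suc n)"
  using level_pos_less_node_pos[of n "2 ^ Suc n"] node_pos_less_level_pos[of "Suc n" "2 ^ Suc n"]
  by simp

lemma level_pos_mono: "m \<le> n \<Longrightarrow> level_pos m \<le> level_pos n"
  by (rule lift_Suc_mono_le) (use level_pos_Suc in \<open>auto intro: less_imp_le add_lessD1\<close>)


section \<open>Divisibility by powers of a central element\<close>

text \<open>Centrality makes every \<open>p ^ n A\<close> a two-sided ideal although
  \<open>A\<close> need not be commutative; the last two conditions say that division by
  \<open>p\<close> is unambiguous and that the \<open>p\<close>-adic topology is Hausdorff.\<close>

locale central_element = ring A for A (structure) +
  fixes p
  assumes p_closed [simp]: "p \<in> carrier A"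
    and p_comm: "a \<in> carrier A \<Longrightarrow> p \<otimes> a = a \<otimes> p"
    and p_cancel: "a \<in> carrier A \<Longrightarrow> p \<otimes> a = \<zero> \<Longrightarrow> a = \<zero>"
    and p_separated: "a \<in> carrier A \<Longrightarrow> (\<And>n::nat. \<exists>b\<in>carrier A. a = p [^] n \<otimes> b) \<Longrightarrow> a = \<zero>"
begin

definition pmult :: "nat \<Rightarrow> 'a set" where "pmult n = {p [^] n \<otimes> a | a. a \<in> carrier A}"

lemma pow_comm: "a \<in> carrier A \<Longrightarrow> p [^] (n::nat) \<otimes> a = a \<otimes> p [^] n"
proof (induction n)
  case (Suc n)
  have "p [^] Suc n \<otimes> a = p [^] n \<otimes> (p \<otimes> a)" using Suc.prems by (simp add: m_assoc)
  also have "\<dots> = (p [^] n \<otimes> a) \<otimes> p" using Suc.prems by (simp add: p_comm m_assoc)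
  also have "\<dots> = a \<otimes> p [^] Suc n" using Suc by (simp add: m_assoc)
  finally show ?case .
qed simp

lemma pow_cancel: "a \<in> carrier A \<Longrightarrow> p [^] (n::nat) \<otimes> a = \<zero> \<Longrightarrow> a = \<zero>"
proof (induction n)
  case (Suc n)
  have "p \<otimes> (p [^] n \<otimes> a) = p [^] Suc n \<otimes> a" using Suc.prems p_comm[of "p [^] n"]
    by (simp add: m_assoc[symmetric])
  then show ?case using Suc p_cancel[of "p [^] n \<otimes> a"] by simp
qed simp

lemma pmultI: "a \<in> carrier A \<Longrightarrow> p [^] n \<otimes> a \<in> pmult n"
  by (auto simp: pmult_def)

lemma pmultE: assumes "x \<in> pmult n" obtains a where "a \<in> carrier A" "x = p [^] n \<otimes> a"
  using assms by (auto simp: pmult_def)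

lemma pmult_zero: "\<zero> \<in> pmult n"
  using pmultI[of \<zero> n] by simp

lemma pmult_add: assumes "x \<in> pmult n" "y \<in> pmult n" shows "x \<oplus> y \<in> pmult n"
proof -
  obtain a b where "a \<in> carrier A" "x = p [^] n \<otimes> a" "b \<in> carrier A" "y = p [^] n \<otimes> b"
    using assms by (auto elim!: pmultE)
  then show ?thesis using pmultI[of "a \<oplus> b" n] by (simp add: r_distr)
qed

lemma pmult_neg: assumes "x \<in> pmult n" shows "\<ominus> x \<in> pmult n"
proof -
  obtain a where "a \<in> carrier A" "x = p [^] n \<otimes> a" using assms by (auto elim!: pmultE)
  then show ?thesis using pmultI[of "\<ominus> a" n] by (simp add: r_minus)
qed

lemma pmult_minus: "x \<in> pmult n \<Longrightarrow> y \<in> pmult n \<Longrightarrow> x \<ominus> y \<in> pmult n"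
  unfolding a_minus_def by (intro pmult_add pmult_neg)

lemma pmult_lmult: assumes "a \<in> carrier A" "x \<in> pmult n" shows "a \<otimes> x \<in> pmult n"
proof -
  obtain b where b: "b \<in> carrier A" "x = p [^] n \<otimes> b" using assms(2) by (auto elim!: pmultE)
  have "a \<otimes> x = (a \<otimes> p [^] n) \<otimes> b" using assms(1) b by (simp add: m_assoc)
  also have "a \<otimes> p [^] n = p [^] n \<otimes> a" using assms(1) by (simp add: pow_comm)
  also have "p [^] n \<otimes> a \<otimes> b = p [^] n \<otimes> (a \<otimes> b)" using assms(1) b by (simp add: m_assoc)
  finally have "a \<otimes> x = p [^] n \<otimes> (a \<otimes> b)" .
  then show ?thesis using pmultI[of "a \<otimes> b" n] assms(1) b by simp
qed

lemma pmult_mono: assumes "m \<le> n" "x \<in> pmult n" shows "x \<in> pmult m"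
proof -
  obtain b where b: "b \<in> carrier A" "x = p [^] n \<otimes> b" using assms(2) by (auto elim!: pmultE)
  have "x = p [^] m \<otimes> (p [^] (n - m) \<otimes> b)" using assms(1) b
    by (simp add: m_assoc[symmetric] nat_pow_mult)
  then show ?thesis using pmultI[of "p [^] (n - m) \<otimes> b" m] b by simp
qed

lemma pmult_pow: assumes "x \<in> pmult n" shows "p [^] (k::nat) \<otimes> x \<in> pmult (k + n)"
proof -
  obtain b where b: "b \<in> carrier A" "x = p [^] n \<otimes> b" using assms by (auto elim!: pmultE)
  have "p [^] k \<otimes> x = p [^] (k + n) \<otimes> b" using b by (simp add: m_assoc[symmetric] nat_pow_mult)
  then show ?thesis using pmultI b by simp
qed

lemma pmult_cancel: assumes "a \<in> carrier A" "p [^] (k::nat) \<otimes> a \<in> pmult (k + n)" shows "a \<in> pmult n"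
proof -
  obtain b where b: "b \<in> carrier A" "p [^] k \<otimes> a = p [^] (k + n) \<otimes> b" using assms
    by (auto elim!: pmultE)
  have "p [^] k \<otimes> (a \<ominus> p [^] n \<otimes> b) = p [^] k \<otimes> a \<ominus> p [^] (k + n) \<otimes> b"
    using assms(1) b(1) by (simp add: a_minus_def r_distr r_minus m_assoc[symmetric] nat_pow_mult)
  also have "\<dots> = \<zero>" using b assms(1) by (simp add: a_minus_def r_neg)
  finally have "a \<ominus> p [^] n \<otimes> b = \<zero>" using pow_cancel[of "a \<ominus> p [^] n \<otimes> b" k] assms(1) b(1) by simp
  then have "a = p [^] n \<otimes> b" using assms(1) b(1) by simp
  then show ?thesis using pmultI b(1) by simp
qed

lemma pmult_separated: assumes "a \<in> carrier A" "\<And>n. a \<in> pmult n" shows "a = \<zero>"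
  by (rule p_separated[OF assms(1)]) (use assms(2) in \<open>auto simp: pmult_def\<close>)

lemma eventually_notin_pmult:
  assumes "a \<in> carrier A" "a \<noteq> \<zero>" shows "\<forall>\<^sub>F n in sequentially. a \<notin> pmult n"
proof -
  obtain n where "a \<notin> pmult n" using pmult_separated assms by blast
  then show ?thesis unfolding eventually_sequentially using pmult_mono by blast
qed

lemma pmult_diff_trans:
  assumes "x \<ominus> y \<in> pmult n" "y \<ominus> z \<in> pmult n" "x \<in> carrier A" "y \<in> carrier A" "z \<in> carrier A"
  shows "x \<ominus> z \<in> pmult n"
proof -
  have "x \<ominus> z = (x \<ominus> y) \<oplus> (y \<ominus> z)" using assms(3-5) by algebra
  then show ?thesis using pmult_add assms by simp
qed

text \<open>Coordinates will satisfy their laws only modulo \<open>p ^ n\<close>; this transports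
  divisibility across such congruences.\<close>

lemma pmult_cong_iff:
  assumes "x \<ominus> y \<in> pmult n" "x \<in> carrier A" "y \<in> carrier A" shows "x \<in> pmult n \<longleftrightarrow> y \<in> pmult n"
proof
  assume "y \<in> pmult n"
  have "x = (x \<ominus> y) \<oplus> y" using assms(2,3) by algebra
  then show "x \<in> pmult n" using pmult_add[OF assms(1) \<open>y \<in> pmult n\<close>] by simp
next
  assume "x \<in> pmult n"
  have "y = x \<ominus> (x \<ominus> y)" using assms(2,3) by algebra
  then show "y \<in> pmult n" using pmult_minus[OF \<open>x \<in> pmult n\<close> assms(1)] by simp
qed

end

section \<open>Modules generated by the nodes and by branch elements\<close>

text \<open>The module \<open>G\<close> is generated by elements \<open>E j\<close> for the nodes \<open>j\<close> and \<open>Y \<eta> n\<close> for the branches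
  \<open>sel \<eta>\<close>, where \<open>Y \<eta> n\<close> is to be thought of as the \<open>p\<close>-adically convergent series
  \<open>p ^ - level_pos n * (\<Sum>i\<ge>n. p ^ level_pos i * E (node i) + p ^ node_pos (node (i + 1)) * bvec (b \<eta>))\<close>.
  The functions \<open>cf j n\<close> read off the \<open>j\<close>-th coordinate modulo \<open>p ^ n\<close>.\<close>

locale branch_module = A: central_element A p + G: left_module A G act
  for A :: "('a, 'x) ring_scheme" and p and G :: "('g, 'y) ring_scheme" (structure) and act +
  fixes L :: "'l set" and sel :: "'l \<Rightarrow> nat set" and b :: "'l \<Rightarrow> 'a \<times> nat \<times> nat"
    and E :: "nat \<Rightarrow> 'g" and Y :: "'l \<Rightarrow> nat \<Rightarrow> 'g" and cf :: "nat \<Rightarrow> nat \<Rightarrow> 'g \<Rightarrow> 'a"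
    and bvec :: "'a \<times> nat \<times> nat \<Rightarrow> 'g"
  defines "bvec \<equiv> \<lambda>(x, t, s). act x (E t) \<oplus> E s"
  assumes nontrivial: "\<one>\<^bsub>A\<^esub> \<noteq> \<zero>\<^bsub>A\<^esub>"
    and sel_inj: "inj_on sel L"
    and b_closed: "\<eta> \<in> L \<Longrightarrow> fst (b \<eta>) \<in> carrier A"
    and E_closed: "E j \<in> carrier G"
    and Y_closed: "\<eta> \<in> L \<Longrightarrow> Y \<eta> n \<in> carrier G"
    and Y_step: "\<eta> \<in> L \<Longrightarrow> Y \<eta> n = E (node (sel \<eta>) n) \<oplus>
        (act (p [^]\<^bsub>A\<^esub> (node_pos (node (sel \<eta>) (Suc n)) - level_pos n)) (bvec (b \<eta>)) \<oplus>
         act (p [^]\<^bsub>A\<^esub> (level_pos (Suc n) - level_pos n)) (Y \<eta> (Suc n)))"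
    and generated: "x \<in> carrier G \<Longrightarrow> (\<And>a j. a \<in> carrier A \<Longrightarrow> act a (E j) \<in> U) \<Longrightarrow>
        (\<And>a \<eta> n. a \<in> carrier A \<Longrightarrow> \<eta> \<in> L \<Longrightarrow> act a (Y \<eta> n) \<in> U) \<Longrightarrow>
        (\<And>x y. x \<in> U \<Longrightarrow> y \<in> U \<Longrightarrow> x \<oplus> y \<in> U) \<Longrightarrow> x \<in> U"
    and cf_closed: "x \<in> carrier G \<Longrightarrow> cf j n x \<in> carrier A"
    and cf_add: "x \<in> carrier G \<Longrightarrow> y \<in> carrier G \<Longrightarrow>
        cf j n (x \<oplus> y) \<ominus>\<^bsub>A\<^esub> (cf j n x \<oplus>\<^bsub>A\<^esub> cf j n y) \<in> A.pmult n"
    and cf_act: "a \<in> carrier A \<Longrightarrow> x \<in> carrier G \<Longrightarrow>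
        cf j n (act a x) \<ominus>\<^bsub>A\<^esub> a \<otimes>\<^bsub>A\<^esub> cf j n x \<in> A.pmult n"
    and cf_E: "cf j n (E i) \<ominus>\<^bsub>A\<^esub> (if i = j then \<one>\<^bsub>A\<^esub> else \<zero>\<^bsub>A\<^esub>) \<in> A.pmult n"
    and cf_Suc: "x \<in> carrier G \<Longrightarrow> cf j (Suc n) x \<ominus>\<^bsub>A\<^esub> cf j n x \<in> A.pmult n"
    and cf_separates: "x \<in> carrier G \<Longrightarrow> (\<And>j n. cf j n x \<in> A.pmult n) \<Longrightarrow> x = \<zero>"
begin

section \<open>Calculus of the action, of submodules and of multiples of powers of
  \<open>p\<close>\<close>

abbreviation pw :: "nat \<Rightarrow> 'a" where "pw n \<equiv> p [^]\<^bsub>A\<^esub> n"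
abbreviation sc :: "nat \<Rightarrow> 'g \<Rightarrow> 'g" where "sc n x \<equiv> act (p [^]\<^bsub>A\<^esub> n) x"
abbreviation nd :: "'l \<Rightarrow> nat \<Rightarrow> nat" where "nd \<eta> n \<equiv> node (sel \<eta>) n"

lemma pw_closed [simp]: "pw n \<in> carrier A"
  by simp

lemmas act_cl [simp] = G.act_closed
declare E_closed [simp] Y_closed [simp]

lemma act_zero_right [simp]: assumes "a \<in> carrier A" shows "act a \<zero> = \<zero>"
proof -
  have "act a \<zero> \<oplus> act a \<zero> = act a \<zero>" using G.act_add_right[of a "\<zero>" "\<zero>"] assms by simp
  then show ?thesis using G.M.add.r_cancel_one'[of "act a \<zero>" "act a \<zero>"] assms by simp
qed

lemma act_zero_left [simp]: assumes "x \<in> carrier G" shows "act \<zero>\<^bsub>A\<^esub> x = \<zero>"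
proof -
  have "act \<zero>\<^bsub>A\<^esub> x \<oplus> act \<zero>\<^bsub>A\<^esub> x = act \<zero>\<^bsub>A\<^esub> x" using G.act_add_left[of "\<zero>\<^bsub>A\<^esub>" "\<zero>\<^bsub>A\<^esub>" x] assms by simp
  then show ?thesis using G.M.add.r_cancel_one'[of "act \<zero>\<^bsub>A\<^esub> x" "act \<zero>\<^bsub>A\<^esub> x"] assms by simp
qed

lemma act_neg_right: assumes "a \<in> carrier A" "x \<in> carrier G" shows "act a (\<ominus> x) = \<ominus> act a x"
proof -
  have "act a (\<ominus> x) \<oplus> act a x = \<zero>"
    using G.act_add_right[of a "\<ominus> x" x] assms by (simp add: G.M.l_neg)
  then show ?thesis using G.M.minus_equality[of "act a (\<ominus> x)" "act a x"] assms by simp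
qed

lemma act_neg_left: assumes "a \<in> carrier A" "x \<in> carrier G" shows "act (\<ominus>\<^bsub>A\<^esub> a) x = \<ominus> act a x"
proof -
  have "act (\<ominus>\<^bsub>A\<^esub> a) x \<oplus> act a x = \<zero>"
    using G.act_add_left[of "\<ominus>\<^bsub>A\<^esub> a" a x] assms by (simp add: A.l_neg)
  then show ?thesis using G.M.minus_equality[of "act (\<ominus>\<^bsub>A\<^esub> a) x" "act a x"] assms by simp
qed

lemma act_diff: "a \<in> carrier A \<Longrightarrow> x \<in> carrier G \<Longrightarrow> y \<in> carrier G \<Longrightarrow>
    act a (x \<ominus> y) = act a x \<ominus> act a y"
  by (simp add: a_minus_def G.act_add_right act_neg_right)

lemma sc_sc: "x \<in> carrier G \<Longrightarrow> sc m (sc n x) = sc (m + n) x"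
  by (simp add: G.act_mult[symmetric] A.nat_pow_mult)

lemma sc_act: "a \<in> carrier A \<Longrightarrow> x \<in> carrier G \<Longrightarrow> sc n (act a x) = act a (sc n x)"
  by (simp add: G.act_mult[symmetric] A.pow_comm)

lemma act_finsum:
  assumes "a \<in> carrier A" "finite S" "\<And>i. i \<in> S \<Longrightarrow> g i \<in> carrier G"
  shows "act a (\<Oplus>i\<in>S. g i) = (\<Oplus>i\<in>S. act a (g i))"
proof (rule finsum_hom[OF G.M.abelian_group_axioms G.M.abelian_group_axioms])
  show "act a x \<in> carrier G" if "x \<in> carrier G" for x using assms(1) that by simp
  show "act a (x \<oplus> y) = act a x \<oplus> act a y" if "x \<in> carrier G" "y \<in> carrier G" for x y
    using assms(1) that by (rule G.act_add_right)
qed (fact assms(2,3))+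

lemma bvec_closed [simp]: "fst v \<in> carrier A \<Longrightarrow> bvec v \<in> carrier G"
  by (cases v) (simp add: bvec_def)

text \<open>A common frame for the multiples of \<open>p ^ n\<close> in \<open>G\<close>, for the
  vanishing of one coordinate modulo \<open>p ^ n\<close>, and for spans of generators. Negatives
  come from the scalar -1.\<close>

definition submod :: "'g set \<Rightarrow> bool" where
  "submod Z \<longleftrightarrow> Z \<subseteq> carrier G \<and> Z \<noteq> {} \<and> (\<forall>x\<in>Z. \<forall>y\<in>Z. x \<oplus> y \<in> Z) \<and> (\<forall>a\<in>carrier A. \<forall>x\<in>Z. act a x \<in> Z)"

lemma submodD:
  assumes "submod Z"
  shows submod_closed: "x \<in> Z \<Longrightarrow> x \<in> carrier G"
    and submod_add: "x \<in> Z \<Longrightarrow> y \<in> Z \<Longrightarrow> x \<oplus> y \<in> Z"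
    and submod_act: "a \<in> carrier A \<Longrightarrow> x \<in> Z \<Longrightarrow> act a x \<in> Z"
  using assms unfolding submod_def by auto

lemma submod_zero: assumes "submod Z" shows "\<zero> \<in> Z"
proof -
  obtain x where x: "x \<in> Z" using assms unfolding submod_def by blast
  then have "act \<zero>\<^bsub>A\<^esub> x \<in> Z" using submod_act[OF assms] by simp
  then show ?thesis using submod_closed[OF assms x] by simp
qed

lemma submod_neg: assumes "submod Z" "x \<in> Z" shows "\<ominus> x \<in> Z"
proof -
  have "act (\<ominus>\<^bsub>A\<^esub> \<one>\<^bsub>A\<^esub>) x \<in> Z" using submod_act[OF assms(1) _ assms(2)] by simp
  then show ?thesis using submod_closed[OF assms] by (simp add: act_neg_left G.act_one)
qed

lemma submod_diff: "submod Z \<Longrightarrow> x \<in> Z \<Longrightarrow> y \<in> Z \<Longrightarrow> x \<ominus> y \<in> Z"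
  unfolding a_minus_def by (intro submod_add submod_neg)

lemma submod_finsum:
  assumes Z: "submod Z" and "finite S" "\<And>i. i \<in> S \<Longrightarrow> g i \<in> Z"
  shows "(\<Oplus>i\<in>S. g i) \<in> Z"
  using assms(2,3)
proof (induction S)
  case (insert i S)
  have "(\<Oplus>i\<in>insert i S. g i) = g i \<oplus> (\<Oplus>i\<in>S. g i)"
    using insert.hyps insert.prems submod_closed[OF Z] by (intro G.M.finsum_insert) auto
  then show ?case using insert submod_add[OF Z] by simp
qed (simp add: submod_zero[OF Z])

lemma submod_cancel:
  assumes Z: "submod Z" and "x \<in> Z" "x \<oplus> y \<in> Z" "y \<in> carrier G" shows "y \<in> Z"
proof -
  have "x \<in> carrier G" using submod_closed[OF Z assms(2)] .
  then have "y = (x \<oplus> y) \<ominus> x" using assms(4)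
    by (simp add: a_minus_def G.M.a_comm[of x y] G.M.a_assoc G.M.r_neg)
  then show ?thesis using submod_diff[OF Z assms(3,2)] by simp
qed

lemma submod_cancel': "submod Z \<Longrightarrow> x \<in> Z \<Longrightarrow> y \<oplus> x \<in> Z \<Longrightarrow> y \<in> carrier G \<Longrightarrow> y \<in> Z"
  using submod_cancel[of Z x y] submod_closed[of Z x] G.M.a_comm[of y x] by simp

text \<open>Isolates the contribution of one branch or node to a sum, working modulo
  \<open>Z\<close>.\<close>

lemma submod_single_term:
  assumes Z: "submod Z" and S: "finite S" "i \<in> S" "\<And>k. k \<in> S \<Longrightarrow> g k \<in> carrier G"
    and "\<And>k. k \<in> S \<Longrightarrow> k \<noteq> i \<Longrightarrow> g k \<in> Z" "(\<Oplus>k\<in>S. g k) \<in> Z"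
  shows "g i \<in> Z"
proof -
  have S': "insert i (S - {i}) = S" using S(2) by (rule insert_Diff)
  have "(\<Oplus>k\<in>insert i (S - {i}). g k) = g i \<oplus> (\<Oplus>k\<in>S - {i}. g k)"
    using S by (intro G.M.finsum_insert) auto
  then have "g i \<oplus> (\<Oplus>k\<in>S - {i}. g k) \<in> Z" using assms(6) unfolding S' by (rule subst)
  moreover have "(\<Oplus>k\<in>S - {i}. g k) \<in> Z" by (rule submod_finsum[OF Z]) (use assms in auto)
  ultimately show ?thesis using submod_cancel'[OF Z _ _ S(3)[OF S(2)]] by blast
qed

definition scaled :: "nat \<Rightarrow> 'g set" where "scaled n = {sc n x | x. x \<in> carrier G}"

lemma scaledI: "x \<in> carrier G \<Longrightarrow> sc n x \<in> scaled n"
  by (auto simp: scaled_def)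

lemma scaledE: assumes "x \<in> scaled n" obtains y where "y \<in> carrier G" "x = sc n y"
  using assms by (auto simp: scaled_def)

lemma submod_scaled: "submod (scaled n)"
  unfolding submod_def
proof (intro conjI ballI)
  show "scaled n \<subseteq> carrier G" by (auto simp: scaled_def)
  show "scaled n \<noteq> {}" using scaledI[of "\<zero>" n] by blast
  fix x assume x: "x \<in> scaled n"
  then obtain x' where x': "x' \<in> carrier G" "x = sc n x'" by (rule scaledE)
  {
    fix y assume "y \<in> scaled n"
    then obtain y' where y': "y' \<in> carrier G" "y = sc n y'" by (rule scaledE)
    have "x \<oplus> y = sc n (x' \<oplus> y')" using x' y' by (simp add: G.act_add_right)
    then show "x \<oplus> y \<in> scaled n" using scaledI x' y' by simp
  }
  fix a assume a: "a \<in> carrier A"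
  have "act a x = sc n (act a x')" using x' a by (simp add: sc_act)
  then show "act a x \<in> scaled n" using scaledI x' a by simp
qed

lemma scaled_mono: assumes "m \<le> n" "x \<in> scaled n" shows "x \<in> scaled m"
proof -
  obtain y where y: "y \<in> carrier G" "x = sc n y" using assms(2) by (rule scaledE)
  then have "x = sc m (sc (n - m) y)" using assms(1) by (simp add: sc_sc)
  then show ?thesis using scaledI y(1) by simp
qed

lemma sc_in_scaled: "m \<le> n \<Longrightarrow> x \<in> carrier G \<Longrightarrow> sc n x \<in> scaled m"
  using scaled_mono scaledI by blast

lemma cf_scaled: assumes "x \<in> scaled n" shows "cf j n x \<in> A.pmult n"
proof -
  obtain y where y: "y \<in> carrier G" "x = sc n y" using assms by (rule scaledE)
  have "pw n \<otimes>\<^bsub>A\<^esub> cf j n y \<in> A.pmult n" using A.pmultI cf_closed y by simp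
  then show ?thesis using A.pmult_cong_iff[OF cf_act[of "pw n" y j n]] y cf_closed by simp
qed

text \<open>Although \<open>cf j n\<close> is additive only modulo \<open>p ^ n\<close>, its
  vanishing modulo \<open>p ^ n\<close> defines a genuine submodule. Comparisons of coordinates thus
  become membership questions.\<close>

lemma submod_cf: "submod {x \<in> carrier G. cf j n x \<in> A.pmult n}"
  unfolding submod_def
proof (intro conjI ballI)
  have "cf j n \<zero> \<in> A.pmult n" using cf_scaled[of "\<zero>"] submod_zero[OF submod_scaled] by blast
  then show "{x \<in> carrier G. cf j n x \<in> A.pmult n} \<noteq> {}" by blast
  fix x assume "x \<in> {x \<in> carrier G. cf j n x \<in> A.pmult n}"
  then have x: "x \<in> carrier G" "cf j n x \<in> A.pmult n" by auto
  {
    fix y assume "y \<in> {x \<in> carrier G. cf j n x \<in> A.pmult n}"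
    then have y: "y \<in> carrier G" "cf j n y \<in> A.pmult n" by auto
    have "cf j n x \<oplus>\<^bsub>A\<^esub> cf j n y \<in> A.pmult n" using A.pmult_add x y by blast
    then show "x \<oplus> y \<in> {x \<in> carrier G. cf j n x \<in> A.pmult n}"
      using A.pmult_cong_iff[OF cf_add[of x y j n]] x y cf_closed by simp
  }
  fix a assume a: "a \<in> carrier A"
  have "a \<otimes>\<^bsub>A\<^esub> cf j n x \<in> A.pmult n" using A.pmult_lmult a x by blast
  then show "act a x \<in> {x \<in> carrier G. cf j n x \<in> A.pmult n}"
    using A.pmult_cong_iff[OF cf_act[of a x j n]] a x cf_closed by simp
qed auto

lemma cf_mono:
  assumes "x \<in> carrier G" "m \<le> n" shows "cf j n x \<ominus>\<^bsub>A\<^esub> cf j m x \<in> A.pmult m"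
  using assms(2)
proof (induction n rule: dec_induct)
  case base
  have "cf j m x \<ominus>\<^bsub>A\<^esub> cf j m x = \<zero>\<^bsub>A\<^esub>" using cf_closed assms by (simp add: a_minus_def A.r_neg)
  then show ?case using A.pmult_zero by simp
next
  case (step n)
  have "cf j (Suc n) x \<ominus>\<^bsub>A\<^esub> cf j n x \<in> A.pmult m" using cf_Suc[of x j n] A.pmult_mono step assms
    by blast
  then show ?case using A.pmult_diff_trans[OF _ step.IH] cf_closed assms by blast
qed

text \<open>The coordinate of \<open>sc k x\<close> is read at precision \<open>k + n\<close>, so
  that cancelling \<open>p ^ k\<close> leaves precision \<open>n\<close>; coherence then leads from
  \<open>cf j (k + n)\<close> back to \<open>cf j n\<close>.\<close>

lemma sc_cancel: assumes x: "x \<in> carrier G" and 0: "sc k x = \<zero>" shows "x = \<zero>"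
proof (rule cf_separates[OF x])
  fix j n
  have "sc k x \<in> scaled (k + n)" unfolding 0 by (rule submod_zero[OF submod_scaled])
  then have "cf j (k + n) (sc k x) \<in> A.pmult (k + n)" by (rule cf_scaled)
  then have "pw k \<otimes>\<^bsub>A\<^esub> cf j (k + n) x \<in> A.pmult (k + n)"
    using A.pmult_cong_iff[OF cf_act[of "pw k" x j "k + n"]] x cf_closed by simp
  then have "cf j (k + n) x \<in> A.pmult n" using A.pmult_cancel cf_closed x by blast
  then show "cf j n x \<in> A.pmult n"
    using A.pmult_cong_iff[OF cf_mono[OF x, of n "k + n" j]] cf_closed x by simp
qed

lemma sc_inj: assumes "x \<in> carrier G" "y \<in> carrier G" "sc k x = sc k y" shows "x = y"
proof -
  have "sc k (x \<ominus> y) = sc k x \<ominus> sc k y" using assms(1,2) by (intro act_diff) auto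
  also have "\<dots> = \<zero>" unfolding assms(3) a_minus_def using assms(2) by (intro G.M.r_neg) auto
  finally have "sc k (x \<ominus> y) = \<zero>" .
  then show ?thesis using sc_cancel[of "x \<ominus> y" k] assms by simp
qed

lemma scaled_cancel: assumes "x \<in> carrier G" "sc k x \<in> scaled (k + n)" shows "x \<in> scaled n"
proof -
  obtain y where y: "y \<in> carrier G" "sc k x = sc (k + n) y" using assms(2) by (rule scaledE)
  then have "sc k x = sc k (sc n y)" by (simp add: sc_sc)
  then have "x = sc n y" using sc_inj assms(1) y(1) by simp
  then show ?thesis using scaledI y(1) by simp
qed

lemma scaled_separated: assumes "x \<in> carrier G" "\<And>n. x \<in> scaled n" shows "x = \<zero>"
  by (rule cf_separates) (use assms cf_scaled in auto)

lemma eventually_notin_scaled: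
  assumes "x \<in> carrier G" "x \<noteq> \<zero>" shows "\<forall>\<^sub>F n in sequentially. x \<notin> scaled n"
proof -
  obtain n where "x \<notin> scaled n" using scaled_separated assms by blast
  then show ?thesis unfolding eventually_sequentially using scaled_mono by blast
qed

lemma act_E_cf:
  assumes "a \<in> carrier A" shows "cf j n (act a (E j)) \<in> A.pmult n \<longleftrightarrow> a \<in> A.pmult n"
proof -
  have "cf j n (E j) \<ominus>\<^bsub>A\<^esub> \<one>\<^bsub>A\<^esub> \<in> A.pmult n" using cf_E[of j n j] by simp
  then have "a \<otimes>\<^bsub>A\<^esub> (cf j n (E j) \<ominus>\<^bsub>A\<^esub> \<one>\<^bsub>A\<^esub>) \<in> A.pmult n" using A.pmult_lmult assms by blast
  moreover have "a \<otimes>\<^bsub>A\<^esub> (cf j n (E j) \<ominus>\<^bsub>A\<^esub> \<one>\<^bsub>A\<^esub>) = a \<otimes>\<^bsub>A\<^esub> cf j n (E j) \<ominus>\<^bsub>A\<^esub> a"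
    using assms cf_closed[OF E_closed] by (simp add: a_minus_def A.r_distr A.r_minus)
  ultimately have "cf j n (act a (E j)) \<ominus>\<^bsub>A\<^esub> a \<in> A.pmult n"
    using A.pmult_diff_trans[OF cf_act[OF assms E_closed]] assms cf_closed by simp
  then show ?thesis using A.pmult_cong_iff assms cf_closed by simp
qed

lemma cf_E_other: assumes "i \<noteq> j" shows "cf j n (E i) \<in> A.pmult n"
proof -
  have "cf j n (E i) = cf j n (E i) \<ominus>\<^bsub>A\<^esub> \<zero>\<^bsub>A\<^esub>" using cf_closed[OF E_closed]
    by (simp add: a_minus_def)
  then show ?thesis using cf_E[of j n i] assms by simp
qed

lemma cf_bvec: assumes "fst v \<in> carrier A" "j \<notin> {fst (snd v), snd (snd v)}"
  shows "cf j n (bvec v) \<in> A.pmult n"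
proof -
  obtain x t s where v: "v = (x, t, s)" by (cases v)
  have "E t \<in> {x \<in> carrier G. cf j n x \<in> A.pmult n}" "E s \<in> {x \<in> carrier G. cf j n x \<in> A.pmult n}"
    using assms cf_E_other by (auto simp: v)
  then have "act x (E t) \<oplus> E s \<in> {x \<in> carrier G. cf j n x \<in> A.pmult n}"
    using submod_add[OF submod_cf] submod_act[OF submod_cf] assms by (simp add: v)
  then show ?thesis by (simp add: v bvec_def)
qed

end

context branch_module
begin

section \<open>Presentations by finitely many nodes and branches\<close>

sublocale EF: additive_family A G "\<lambda>j a. act a (E j)" UNIV
  by unfold_locales (simp_all add: G.act_add_left)

sublocale YF: additive_family A G "\<lambda>\<eta> a. act a (Y \<eta> n)" L for n
  by unfold_locales (simp_all add: G.act_add_left)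

text \<open>All branch elements are taken at one common level \<open>n\<close>. \<open>G\<close> is
  the increasing union of these submodules, since \<open>Y_step\<close> rewrites
  \<open>Y \<eta> n\<close> through \<open>Y \<eta> (Suc n)\<close>.\<close>

definition level_part :: "nat \<Rightarrow> 'g set" where
  "level_part n = {y \<oplus> z | y z c g. EF.represents c y \<and> YF.represents n g z}"

lemma level_partI: "EF.represents c y \<Longrightarrow> YF.represents n g z \<Longrightarrow> y \<oplus> z \<in> level_part n"
  unfolding level_part_def by blast

lemma level_partE:
  assumes "x \<in> level_part n"
  obtains y z c g where "EF.represents c y" "YF.represents n g z" "x = y \<oplus> z"
  using assms unfolding level_part_def by blast

lemma EF_zero: "EF.represents (\<lambda>_. \<zero>\<^bsub>A\<^esub>) \<zero>"
  unfolding EF.represents_def by (intro exI[of _ "{}"]) simp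

lemma YF_zero: "YF.represents n (\<lambda>_. \<zero>\<^bsub>A\<^esub>) \<zero>"
  unfolding YF.represents_def by (intro exI[of _ "{}"]) simp

lemma level_part_E: assumes "a \<in> carrier A" shows "act a (E j) \<in> level_part n"
  using level_partI[OF EF.represents_single[of j a] YF_zero] assms by simp

lemma level_part_Y: assumes "a \<in> carrier A" "\<eta> \<in> L" shows "act a (Y \<eta> n) \<in> level_part n"
  using level_partI[OF EF_zero YF.represents_single[of \<eta> a]] assms by simp

lemma submod_level_part: "submod (level_part n)"
  unfolding submod_def
proof (intro conjI ballI)
  show "level_part n \<subseteq> carrier G"
    using EF.represents_closed YF.represents_closed by (auto elim!: level_partE)
  show "level_part n \<noteq> {}" using level_part_E[of "\<zero>\<^bsub>A\<^esub>" 0 n] by auto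
  fix x assume "x \<in> level_part n"
  then obtain y z c g where x: "EF.represents c y" "YF.represents n g z" "x = y \<oplus> z"
    by (rule level_partE)
  have cl: "y \<in> carrier G" "z \<in> carrier G"
    using EF.represents_closed[OF x(1)] YF.represents_closed[OF x(2)] by auto
  {
    fix x' assume "x' \<in> level_part n"
    then obtain y' z' c' g' where x': "EF.represents c' y'" "YF.represents n g' z'" "x' = y' \<oplus> z'"
      by (rule level_partE)
    have cl': "y' \<in> carrier G" "z' \<in> carrier G"
      using EF.represents_closed[OF x'(1)] YF.represents_closed[OF x'(2)] by auto
    have "x \<oplus> x' = (y \<oplus> y') \<oplus> (z \<oplus> z')" using cl cl' x(3) x'(3) by (simp add: G.M.a_ac)
    then show "x \<oplus> x' \<in> level_part n"
      using level_partI[OF EF.represents_add[OF x(1) x'(1)] YF.represents_add[OF x(2) x'(2)]]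
        by simp
  }
  fix a assume a: "a \<in> carrier A"
  have "EF.represents (\<lambda>j. a \<otimes>\<^bsub>A\<^esub> c j) (act a y)"
    by (rule EF.represents_map[OF x(1)]) (use a in \<open>simp_all add: G.act_add_right G.act_mult\<close>)
  moreover have "YF.represents n (\<lambda>j. a \<otimes>\<^bsub>A\<^esub> g j) (act a z)"
    by (rule YF.represents_map[OF x(2)]) (use a in \<open>simp_all add: G.act_add_right G.act_mult\<close>)
  ultimately show "act a x \<in> level_part n" using level_partI x(3) cl a
    by (simp add: G.act_add_right)
qed

lemma level_part_bvec: assumes "fst v \<in> carrier A" shows "bvec v \<in> level_part n"
proof -
  obtain x t s where v: "v = (x, t, s)" by (cases v)
  have "E s \<in> level_part n" using level_part_E[of "\<one>\<^bsub>A\<^esub>" s n] by (simp add: G.act_one)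
  then show ?thesis unfolding v bvec_def prod.case
    by (intro submod_add[OF submod_level_part] level_part_E) (use assms v in auto)
qed

lemma level_part_Suc: "level_part n \<subseteq> level_part (Suc n)"
proof
  note S = submod_level_part[of "Suc n"]
  fix x assume "x \<in> level_part n"
  then obtain y z c g where x: "EF.represents c y" "YF.represents n g z" "x = y \<oplus> z"
    by (rule level_partE)
  have "y \<in> level_part (Suc n)" using level_partI[OF x(1) YF_zero] EF.represents_closed[OF x(1)]
    by simp
  moreover
  obtain T where T: "finite T" "T \<subseteq> L" "\<forall>j. g j \<in> carrier A" "z = (\<Oplus>\<eta>\<in>T. act (g \<eta>) (Y \<eta> n))"
    using x(2) unfolding YF.represents_def by blast
  have "z \<in> level_part (Suc n)" unfolding T(4)
  proof (rule submod_finsum[OF S T(1)])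
    fix \<eta> assume "\<eta> \<in> T"
    then have \<eta>: "\<eta> \<in> L" using T(2) by blast
    have "E (nd \<eta> n) \<in> level_part (Suc n)" using level_part_E[of "\<one>\<^bsub>A\<^esub>" "nd \<eta> n" "Suc n"]
      by (simp add: G.act_one)
    moreover have "sc (node_pos (nd \<eta> (Suc n)) - level_pos n) (bvec (b \<eta>)) \<in> level_part (Suc n)"
      using submod_act[OF S] level_part_bvec b_closed[OF \<eta>] by simp
    moreover have "sc (level_pos (Suc n) - level_pos n) (Y \<eta> (Suc n)) \<in> level_part (Suc n)"
      using level_part_Y \<eta> by simp
    ultimately have "Y \<eta> n \<in> level_part (Suc n)"
      unfolding Y_step[OF \<eta>, of n] by (intro submod_add[OF S])
    then show "act (g \<eta>) (Y \<eta> n) \<in> level_part (Suc n)" using submod_act[OF S] T(3) by blast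
  qed
  ultimately show "x \<in> level_part (Suc n)" unfolding x(3) by (rule submod_add[OF S])
qed

lemma in_level_part: assumes "x \<in> carrier G" obtains n where "x \<in> level_part n"
proof -
  have mono: "level_part m \<subseteq> level_part n" if "m \<le> n" for m n
    using that level_part_Suc by (rule lift_Suc_mono_le[rotated])
  have "x \<in> (\<Union>n. level_part n)"
  proof (rule generated[OF assms])
    fix x y assume "x \<in> (\<Union>n. level_part n)" "y \<in> (\<Union>n. level_part n)"
    then obtain m n where mn: "x \<in> level_part m" "y \<in> level_part n" by blast
    then have "x \<in> level_part (max m n)" "y \<in> level_part (max m n)"
      using mono[of m "max m n"] mono[of n "max m n"] by auto
    then have "x \<oplus> y \<in> level_part (max m n)" by (rule submod_add[OF submod_level_part])
    then show "x \<oplus> y \<in> (\<Union>n. level_part n)" by blast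
  next
    show "act a (E j) \<in> (\<Union>n. level_part n)" if "a \<in> carrier A" for a j
      using level_part_E[OF that] by (rule UN_I[OF UNIV_I])
    show "act a (Y \<eta> n) \<in> (\<Union>n. level_part n)" if "a \<in> carrier A" "\<eta> \<in> L" for a \<eta> n
      using level_part_Y[OF that] by (rule UN_I[OF UNIV_I])
  qed
  then show ?thesis using that by blast
qed

lemma eventually_nd_distinct:
  assumes "\<eta> \<in> L" "\<eta>' \<in> L" "\<eta> \<noteq> \<eta>'" shows "\<forall>\<^sub>F l in sequentially. nd \<eta> l \<noteq> nd \<eta>' l"
proof -
  have "sel \<eta> \<noteq> sel \<eta>'" using sel_inj assms by (auto dest: inj_onD)
  then obtain n where n: "nd \<eta> n \<noteq> nd \<eta>' n" by (rule node_separates)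
  then have "\<forall>l\<ge>n. nd \<eta> l \<noteq> nd \<eta>' l" using node_eq_mono by blast
  then show ?thesis unfolding eventually_sequentially by blast
qed

text \<open>The branches that occur in an element are indexed by their nodes of a level \<open>l\<close> at which they are
  separated; coefficients at other indices are zero.\<close>

lemma presentation:
  assumes x: "x \<in> carrier G" and \<eta>: "\<eta> \<in> L"
    and Q: "\<And>n \<zeta> a. \<zeta> \<in> L \<Longrightarrow> a \<in> carrier A \<Longrightarrow> \<forall>\<^sub>F l in sequentially. Q n \<zeta> a l"
  obtains n l K f a \<zeta> where "n \<le> l" "\<And>j. f j \<in> carrier A" "\<And>u. a u \<in> carrier A" "\<And>u. \<zeta> u \<in> L"
    "\<And>u. a u \<noteq> \<zero>\<^bsub>A\<^esub> \<Longrightarrow> nd (\<zeta> u) l = u" "\<zeta> (nd \<eta> l) = \<eta>" "\<And>u. Q n (\<zeta> u) (a u) l"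
    "x = (\<Oplus>j\<in>{..<K::nat}. act (f j) (E j)) \<oplus> (\<Oplus>u\<in>{..<2 ^ Suc l}. act (a u) (Y (\<zeta> u) n))"
proof -
  obtain n where "x \<in> level_part n" using in_level_part x by blast
  then obtain y z f g where yz: "EF.represents f y" "YF.represents n g z" "x = y \<oplus> z"
    by (rule level_partE)
  obtain S where S: "finite S" "\<And>j. f j \<in> carrier A" "\<And>j. j \<notin> S \<Longrightarrow> f j = \<zero>\<^bsub>A\<^esub>" "y
      = (\<Oplus>j\<in>S. act (f j) (E j))"
    using yz(1) unfolding EF.represents_def by blast
  obtain T where T: "finite T" "T \<subseteq> L" "\<And>j. g j \<in> carrier A" "\<And>j. j \<notin> T \<Longrightarrow> g j = \<zero>\<^bsub>A\<^esub>"
    "z = (\<Oplus>\<zeta>\<in>T. act (g \<zeta>) (Y \<zeta> n))"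
    using yz(2) unfolding YF.represents_def by blast
  obtain K where K: "S \<subseteq> {..<K}" using finite_nat_iff_bounded S(1) by blast
  have y: "y = (\<Oplus>j\<in>{..<K}. act (f j) (E j))" unfolding S(4)
    by (rule EF.sum_superset) (use S K in auto)
  \<comment> \<open>The index \<open>nd \<eta> l\<close> has to belong to \<open>\<eta>\<close>, so
    \<open>\<eta>\<close> is added even if it does not occur in \<open>x\<close>; its coefficient is
    zero in that case.\<close>
  define I where "I = insert \<eta> T"
  have I: "finite I" "I \<subseteq> L" using T \<eta> by (auto simp: I_def)
  have z: "z = (\<Oplus>\<zeta>\<in>I. act (g \<zeta>) (Y \<zeta> n))"
    unfolding T(5) by (rule YF.sum_superset) (use T I in \<open>auto simp: I_def\<close>)
  have "\<forall>\<^sub>F l in sequentially. \<forall>\<zeta>\<in>I. \<forall>\<zeta>'\<in>I. \<zeta> \<noteq> \<zeta>' \<longrightarrow> nd \<zeta> l \<noteq> nd \<zeta>' l"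
  proof (intro eventually_ball_finite[OF I(1)] ballI)
    fix \<zeta> \<zeta>' assume "\<zeta> \<in> I" "\<zeta>' \<in> I"
    then show "\<forall>\<^sub>F l in sequentially. \<zeta> \<noteq> \<zeta>' \<longrightarrow> nd \<zeta> l \<noteq> nd \<zeta>' l"
      using eventually_nd_distinct[of \<zeta> \<zeta>'] I(2) by (cases "\<zeta> = \<zeta>'") (auto elim: eventually_mono)
  qed
  moreover have "\<forall>\<^sub>F l in sequentially. \<forall>\<zeta>\<in>I. Q n \<zeta> (g \<zeta>) l"
    using I T(3) Q by (intro eventually_ball_finite) auto
  \<comment> \<open>Indices that are not the node of a branch in \<open>I\<close> get the default
    branch \<open>\<eta>\<close> with coefficient zero, and \<open>Q\<close> has to hold there as
    well.\<close>
  moreover have "\<forall>\<^sub>F l in sequentially. Q n \<eta> \<zero>\<^bsub>A\<^esub> l" using Q \<eta> by simp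
  moreover have "\<forall>\<^sub>F l in sequentially. n \<le> l" by (rule eventually_ge_at_top)
  ultimately have "\<forall>\<^sub>F l in sequentially. (\<forall>\<zeta>\<in>I. \<forall>\<zeta>'\<in>I. \<zeta> \<noteq> \<zeta>' \<longrightarrow> nd \<zeta> l \<noteq> nd \<zeta>' l)
      \<and> (\<forall>\<zeta>\<in>I. Q n \<zeta> (g \<zeta>) l)
     \<and> Q n \<eta> \<zero>\<^bsub>A\<^esub> l \<and> n \<le> l" by (intro eventually_conj)
  then obtain l where l: "\<forall>\<zeta>\<in>I. \<forall>\<zeta>'\<in>I. \<zeta> \<noteq> \<zeta>' \<longrightarrow> nd \<zeta> l \<noteq> nd \<zeta>' l" "\<forall>\<zeta>\<in>I. Q n \<zeta> (g \<zeta>) l"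
     "Q n \<eta> \<zero>\<^bsub>A\<^esub> l" "n \<le> l" unfolding eventually_sequentially by blast
  let ?h = "\<lambda>\<zeta>. nd \<zeta> l"
  have inj: "inj_on ?h I" using l(1) by (auto simp: inj_on_def)
  define \<zeta> where "\<zeta> u = (if u \<in> ?h ` I then inv_into I ?h u else \<eta>)" for u
  define a where "a u = (if u \<in> ?h ` I then g (inv_into I ?h u) else \<zero>\<^bsub>A\<^esub>)" for u
  have h: "\<zeta> (?h \<xi>) = \<xi>" "a (?h \<xi>) = g \<xi>" if "\<xi> \<in> I" for \<xi>
    using that inv_into_f_f[OF inj that] by (auto simp: \<zeta>_def a_def)
  have \<zeta>I: "\<zeta> u \<in> I" for u using inv_into_into[of u ?h I] by (auto simp: \<zeta>_def I_def)
  have aA: "a u \<in> carrier A" for u using T(3) by (simp add: a_def)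
  have \<zeta>L: "\<zeta> u \<in> L" for u using \<zeta>I I(2) by blast
  have "z = (\<Oplus>\<xi>\<in>I. act (a (?h \<xi>)) (Y (\<zeta> (?h \<xi>)) n))"
    unfolding z by (rule G.M.add.finprod_cong') (use h I(2) T(3) in auto)
  also have "\<dots> = (\<Oplus>u\<in>?h ` I. act (a u) (Y (\<zeta> u) n))"
    by (rule G.M.add.finprod_reindex[symmetric, OF _ inj]) (use aA \<zeta>L in auto)
  also have "\<dots> = (\<Oplus>u\<in>{..<2 ^ Suc l}. act (a u) (Y (\<zeta> u) n))"
  proof (rule G.M.add.finprod_mono_neutral_cong_left)
    show "?h ` I \<subseteq> {..<2 ^ Suc l}" using node_less by auto
  qed (use aA \<zeta>L in \<open>auto simp: a_def\<close>)
  finally have z': "z = (\<Oplus>u\<in>{..<2 ^ Suc l}. act (a u) (Y (\<zeta> u) n))" .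
  show thesis
  proof (rule that[of n l f a \<zeta> K])
    show "nd (\<zeta> u) l = u" if "a u \<noteq> \<zero>\<^bsub>A\<^esub>" for u
    proof -
      have "u \<in> ?h ` I" using that by (auto simp: a_def split: if_splits)
      then obtain \<xi> where "\<xi> \<in> I" "u = ?h \<xi>" by blast
      then show ?thesis using h(1) by simp
    qed
    show "Q n (\<zeta> u) (a u) l" for u
    proof (cases "u \<in> ?h ` I")
      case True
      then show ?thesis using l(2) h by auto
    next
      case False
      then show ?thesis using l(3) by (simp add: \<zeta>_def a_def)
    qed
    show "\<zeta> (nd \<eta> l) = \<eta>" by (rule h) (simp add: I_def)
    show "x = (\<Oplus>j\<in>{..<K}. act (f j) (E j)) \<oplus> (\<Oplus>u\<in>{..<2 ^ Suc l}. act (a u) (Y (\<zeta> u) n))"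
      unfolding yz(3) y z' ..
  qed (use l(4) S(2) aA \<zeta>L in auto)
qed

section \<open>Differences of branch elements\<close>

lemma add_diff_cancel:
  assumes "a \<in> carrier G" "x \<in> carrier G" "y \<in> carrier G" "x' \<in> carrier G" "y' \<in> carrier G"
  shows "(a \<oplus> (x \<oplus> y)) \<ominus> (a \<oplus> (x' \<oplus> y')) = (x \<ominus> x') \<oplus> (y \<ominus> y')"
proof -
  have swap: "(a \<oplus> (x \<oplus> y)) \<oplus> (a' \<oplus> (u \<oplus> v))
      = (a \<oplus> a') \<oplus> ((x \<oplus> u) \<oplus> (y \<oplus> v))"
    if "a' \<in> carrier G" "u \<in> carrier G" "v \<in> carrier G" for a' u v
    using assms that by (simp add: G.M.a_ac)
  show ?thesis using assms swap[of "\<ominus> a" "\<ominus> x'" "\<ominus> y'"]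
    by (simp add: a_minus_def G.M.minus_add G.M.r_neg)
qed

lemma finsum_diff:
  assumes "finite S" "\<And>i. i \<in> S \<Longrightarrow> f i \<in> carrier G" "\<And>i. i \<in> S \<Longrightarrow> g i \<in> carrier G"
  shows "(\<Oplus>i\<in>S. f i) \<ominus> (\<Oplus>i\<in>S. g i) = (\<Oplus>i\<in>S. f i \<ominus> g i)"
proof -
  have "\<ominus> (\<Oplus>i\<in>S. g i) = (\<Oplus>i\<in>S. \<ominus> g i)"
    by (rule finsum_hom[OF G.M.abelian_group_axioms G.M.abelian_group_axioms])
       (use assms in \<open>auto simp: G.M.minus_add\<close>)
  moreover have "(\<Oplus>i\<in>S. f i \<oplus> \<ominus> g i) = (\<Oplus>i\<in>S. f i) \<oplus> (\<Oplus>i\<in>S. \<ominus> g i)"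
    by (rule G.M.finsum_addf) (use assms in auto)
  ultimately show ?thesis by (simp add: a_minus_def)
qed

text \<open>After multiplication by \<open>p ^ level_pos n\<close> the exponents are the absolute
  positions in the series, so that the recursions for successive levels can be chained.\<close>

lemma Y_step_scaled:
  assumes "\<eta> \<in> L"
  shows "sc (level_pos n) (Y \<eta> n) = sc (level_pos n) (E (nd \<eta> n)) \<oplus>
    (sc (node_pos (nd \<eta> (Suc n))) (bvec (b \<eta>)) \<oplus> sc (level_pos (Suc n)) (Y \<eta> (Suc n)))"
proof -
  have 1: "level_pos n + (node_pos (nd \<eta> (Suc n)) - level_pos n) = node_pos (nd \<eta> (Suc n))"
    using level_pos_less_node_pos[OF node_ge[of "Suc n" "sel \<eta>"]] by linarith
  have 2: "level_pos n + (level_pos (Suc n) - level_pos n) = level_pos (Suc n)"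
    using level_pos_mono[of n "Suc n"] by simp
  show ?thesis
    by (subst Y_step[OF assms, of n])
      (simp only: G.act_add_right sc_sc 1 2 pw_closed E_closed bvec_closed b_closed assms Y_closed G.M.a_closed act_cl)
qed

lemma Y_diff_step:
  assumes "\<eta> \<in> L" "\<eta>' \<in> L" "b \<eta> = b \<eta>'" "nd \<eta> n = nd \<eta>' n"
  shows "sc (level_pos n) (Y \<eta> n \<ominus> Y \<eta>' n) =
    (sc (node_pos (nd \<eta> (Suc n))) (bvec (b \<eta>)) \<ominus> sc (node_pos (nd \<eta>' (Suc n))) (bvec (b \<eta>))) \<oplus>
     sc (level_pos (Suc n)) (Y \<eta> (Suc n) \<ominus> Y \<eta>' (Suc n))"
proof -
  have bc: "bvec (b \<eta>) \<in> carrier G" using b_closed assms(1) by simp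
  have "sc (level_pos n) (Y \<eta> n \<ominus> Y \<eta>' n) = sc (level_pos n) (Y \<eta> n) \<ominus> sc (level_pos n) (Y \<eta>' n)"
    using assms by (intro act_diff) auto
  also have "\<dots> = (sc (node_pos (nd \<eta> (Suc n))) (bvec (b \<eta>))
      \<ominus> sc (node_pos (nd \<eta>' (Suc n))) (bvec (b \<eta>))) \<oplus>
     (sc (level_pos (Suc n)) (Y \<eta> (Suc n)) \<ominus> sc (level_pos (Suc n)) (Y \<eta>' (Suc n)))"
    unfolding Y_step_scaled[OF assms(1), of n] Y_step_scaled[OF assms(2), of n] assms(3,4)[symmetric]
    by (rule add_diff_cancel) (use bc assms(1,2) in simp_all)
  also have "sc (level_pos (Suc n)) (Y \<eta> (Suc n)) \<ominus> sc (level_pos (Suc n)) (Y \<eta>' (Suc n))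
    = sc (level_pos (Suc n)) (Y \<eta> (Suc n) \<ominus> Y \<eta>' (Suc n))"
    using assms by (intro act_diff[symmetric]) auto
  finally show ?thesis .
qed

text \<open>As long as the branches share their nodes, both the tree terms and the digits cancel.
  What survives first are the digits at the nodes of level \<open>Suc r\<close>; the tree terms can
  differ only from position \<open>level_pos (Suc r)\<close> on, which is larger.\<close>

lemma Y_diff:
  assumes "\<eta> \<in> L" "\<eta>' \<in> L" "b \<eta> = b \<eta>'" "nd \<eta> r = nd \<eta>' r" "n \<le> r"
  shows "sc (level_pos n) (Y \<eta> n \<ominus> Y \<eta>' n) =
    (sc (node_pos (nd \<eta> (Suc r))) (bvec (b \<eta>)) \<ominus> sc (node_pos (nd \<eta>' (Suc r))) (bvec (b \<eta>))) \<oplus>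
     sc (level_pos (Suc r)) (Y \<eta> (Suc r) \<ominus> Y \<eta>' (Suc r))"
  using assms(5)
proof (induction n rule: inc_induct)
  case base
  then show ?case using Y_diff_step assms by blast
next
  case (step n)
  have e: "nd \<eta> n = nd \<eta>' n" "nd \<eta> (Suc n) = nd \<eta>' (Suc n)"
    using node_eq_mono[OF assms(4), of n] node_eq_mono[OF assms(4), of "Suc n"] step.hyps by auto
  have bc: "bvec (b \<eta>) \<in> carrier G" using b_closed assms(1) by simp
  have "sc (level_pos n) (Y \<eta> n \<ominus> Y \<eta>' n) = \<zero> \<oplus> sc (level_pos (Suc n)) (Y \<eta> (Suc n) \<ominus> Y \<eta>' (Suc n))"
    unfolding Y_diff_step[OF assms(1-3) e(1)] e(2)[symmetric] using bc
      by (simp add: a_minus_def G.M.r_neg)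
  then show ?case using step.IH assms(1,2) bc by simp
qed

end

section \<open>Endomorphisms\<close>

context branch_module
begin

lemma additive_diff:
  assumes \<phi>: "\<And>x. x \<in> carrier G \<Longrightarrow> \<phi> x \<in> carrier G"
      "\<And>x y. x \<in> carrier G \<Longrightarrow> y \<in> carrier G \<Longrightarrow> \<phi> (x \<oplus> y) = \<phi> x \<oplus> \<phi> y"
    and "x \<in> carrier G" "y \<in> carrier G"
  shows "\<phi> (x \<ominus> y) = \<phi> x \<ominus> \<phi> y"
proof -
  have "x \<ominus> y \<oplus> y = x" using assms(3,4) by (simp add: a_minus_def G.M.a_assoc G.M.l_neg)
  then have "\<phi> x = \<phi> (x \<ominus> y) \<oplus> \<phi> y" using \<phi>(2)[of "x \<ominus> y" y] assms(3,4) by simp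
  then show ?thesis using \<phi>(1)[of "x \<ominus> y"] \<phi>(1)[of y] assms(3,4)
    by (simp add: a_minus_def G.M.a_assoc G.M.r_neg)
qed

text \<open>The elements \<open>w u\<close> are separated by the positions of the digits at which the branches part:
  modulo a higher power of \<open>p\<close>, the relation can be read off at the smallest position.\<close>

lemma digit_separation:
  assumes w: "\<And>u. u \<in> S \<Longrightarrow> w u \<in> carrier G" and S: "finite S"
    and dist: "\<And>u v. u \<in> S \<Longrightarrow> v \<in> S \<Longrightarrow> w u \<noteq> \<zero> \<Longrightarrow> w v \<noteq> \<zero> \<Longrightarrow> u \<noteq> v \<Longrightarrow> {\<nu> u, \<nu>' u} \<inter> {\<nu> v, \<nu>' v} = {}"
    and level: "\<And>u. u \<in> S \<Longrightarrow> 2 ^ m \<le> \<nu> u \<and> \<nu> u < 2 ^ Suc m \<and> 2 ^ m \<le> \<nu>' u \<and> \<nu>' u < 2 ^ Suc m"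
    and sum: "(\<Oplus>u\<in>S. sc (node_pos (\<nu> u)) (w u) \<ominus> sc (node_pos (\<nu>' u)) (w u)) \<in> scaled (level_pos m)"
    and large: "\<And>u. u \<in> S \<Longrightarrow> w u \<noteq> \<zero> \<Longrightarrow> w u \<notin> scaled l" "l \<le> 2 ^ m"
    and u0: "u0 \<in> S" "\<nu> u0 \<noteq> \<nu>' u0"
  shows "w u0 = \<zero>"
proof (rule ccontr)
  assume "w u0 \<noteq> \<zero>"
  define I where "I = {u \<in> S. w u \<noteq> \<zero> \<and> \<nu> u \<noteq> \<nu>' u}"
  have I: "finite I" "u0 \<in> I" using S u0 \<open>w u0 \<noteq> \<zero>\<close> by (auto simp: I_def)
  \<comment> \<open>Terms outside \<open>I\<close> vanish. The node \<open>pos\<close> belongs to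
    only one term \<open>u1\<close>, because the digit nodes of different nonzero terms are
    disjoint.\<close>
  define pos where "pos = Min (\<nu> ` I \<union> \<nu>' ` I)"
  have "pos \<in> \<nu> ` I \<union> \<nu>' ` I" unfolding pos_def using I by (intro Min_in) auto
  then obtain u1 where u1: "u1 \<in> I" "pos = \<nu> u1 \<or> pos = \<nu>' u1" by blast
  have pos_le: "pos \<le> \<nu> u" "pos \<le> \<nu>' u" if "u \<in> I" for u
    unfolding pos_def using I(1) that by (auto intro!: Min_le)
  have u1S: "u1 \<in> S" "w u1 \<noteq> \<zero>" "\<nu> u1 \<noteq> \<nu>' u1" using u1(1) by (auto simp: I_def)
  have w1: "w u1 \<in> carrier G" by (rule w[OF u1S(1)])
  have pos_level: "2 ^ m \<le> pos" "pos < 2 ^ Suc m" using u1(2) level[OF u1S(1)] by auto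
  \<comment> \<open>Keeps \<open>l\<close> places beyond the smallest digit: the other digits and
    \<open>level_pos m\<close> lie further away than \<open>2 ^ m\<close>, hence vanish at this
    precision, whereas \<open>w u1\<close> is not divisible by \<open>p ^ l\<close>.\<close>
  define N where "N = node_pos pos + l"
  note Z = submod_scaled[of N]
  have far: "sc (node_pos v) x \<in> scaled N" if "pos < v" "x \<in> carrier G" for v x
    using node_pos_gap[OF pos_level(1) that(1)] large(2) that(2) unfolding N_def
      by (intro sc_in_scaled) auto
  have "N \<le> level_pos m" using node_pos_less_level_pos[OF pos_level] large(2) by (simp add: N_def)
  then have sumZ: "(\<Oplus>u\<in>S. sc (node_pos (\<nu> u)) (w u) \<ominus> sc (node_pos (\<nu>' u)) (w u)) \<in> scaled N"
    using scaled_mono sum by blast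
  have "sc (node_pos (\<nu> u1)) (w u1) \<ominus> sc (node_pos (\<nu>' u1)) (w u1) \<in> scaled N"
  proof (rule submod_single_term[OF Z S u1S(1) _ _ sumZ])
    fix u assume u: "u \<in> S"
    then show "sc (node_pos (\<nu> u)) (w u) \<ominus> sc (node_pos (\<nu>' u)) (w u) \<in> carrier G" using w by simp
    assume ne: "u \<noteq> u1"
    show "sc (node_pos (\<nu> u)) (w u) \<ominus> sc (node_pos (\<nu>' u)) (w u) \<in> scaled N"
    proof (cases "u \<in> I")
      case True
      have "w u \<noteq> \<zero>" using True by (simp add: I_def)
      from dist[OF u u1S(1) this u1S(2) ne] have "pos \<noteq> \<nu> u" "pos \<noteq> \<nu>' u" using u1(2) by auto
      then have "pos < \<nu> u" "pos < \<nu>' u" using pos_le[OF True] by auto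
      then show ?thesis using far w[OF u] by (intro submod_diff[OF Z]) auto
    next
      case False
      then consider "w u = \<zero>" | "\<nu> u = \<nu>' u" using u by (auto simp: I_def)
      then have "sc (node_pos (\<nu> u)) (w u) \<ominus> sc (node_pos (\<nu>' u)) (w u) = \<zero>"
        by cases (use w[OF u] in \<open>simp_all add: a_minus_def G.M.r_neg\<close>)
      then show ?thesis using submod_zero[OF Z] by simp
    qed
  qed
  then have diff: "sc (node_pos (\<nu> u1)) (w u1) \<oplus> \<ominus> sc (node_pos (\<nu>' u1)) (w u1) \<in> scaled N"
    by (simp add: a_minus_def)
  have "sc (node_pos pos) (w u1) \<in> scaled N"
  proof (cases "pos = \<nu> u1")
    case True
    then have "pos < \<nu>' u1" using pos_le[OF u1(1)] u1S(3) by auto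
    then have "\<ominus> sc (node_pos (\<nu>' u1)) (w u1) \<in> scaled N" using far w1
      by (intro submod_neg[OF Z]) auto
    then show ?thesis using submod_cancel'[OF Z _ diff] w1 True by simp
  next
    case False
    then have p': "pos = \<nu>' u1" using u1(2) by simp
    have "pos < \<nu> u1" using pos_le[OF u1(1)] False by simp
    then have "\<ominus> sc (node_pos (\<nu>' u1)) (w u1) \<in> scaled N" using far w1
      by (intro submod_cancel[OF Z _ diff]) auto
    then have "\<ominus> (\<ominus> sc (node_pos (\<nu>' u1)) (w u1)) \<in> scaled N" by (rule submod_neg[OF Z])
    then show ?thesis using w1 p' by simp
  qed
  then have "w u1 \<in> scaled l" using scaled_cancel w1 unfolding N_def by blast
  then show False using large(1)[OF u1S(1,2)] by simp
qed

text \<open>The heart of the argument: let \<open>\<phi> (Y \<eta> 0)\<close> and \<open>\<phi> (Y \<eta>' 0)\<close> be given by the same data, where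
  \<open>\<eta>\<close> and \<open>\<eta>'\<close> part at level \<open>Suc r\<close>. The difference of \<open>Y \<eta> 0\<close> and \<open>Y \<eta>' 0\<close> is, modulo a high power of
  \<open>p\<close>, a multiple of \<open>bvec (b \<eta>)\<close> by the difference of two digits. Comparing coefficients at nodes shows
  that the branches \<open>\<zeta> u\<close> and \<open>\<zeta>' u\<close> cannot part before level \<open>Suc r\<close>, and then comparing digits shows
  that only the branch \<open>\<eta>\<close> itself can account for the image of \<open>bvec (b \<eta>)\<close>.\<close>

lemma endomorphism_on_bvec:
  fixes \<zeta> \<zeta>' :: "nat \<Rightarrow> 'l" and a :: "nat \<Rightarrow> 'a"
  assumes \<phi>: "\<And>x. x \<in> carrier G \<Longrightarrow> \<phi> x \<in> carrier G"
      "\<And>x y. x \<in> carrier G \<Longrightarrow> y \<in> carrier G \<Longrightarrow> \<phi> (x \<oplus> y) = \<phi> x \<oplus> \<phi> y"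
      "\<And>x n. x \<in> carrier G \<Longrightarrow> \<phi> (sc n x) = sc n (\<phi> x)"
    and \<eta>: "\<eta> \<in> L" "\<eta>' \<in> L" "\<eta> \<noteq> \<eta>'" "b \<eta> = b \<eta>'" "nd \<eta> l = nd \<eta>' l"
    and l: "n \<le> l" and F: "F \<in> carrier G"
    and a: "\<And>u. a u \<in> carrier A"
    and \<zeta>: "\<And>u. \<zeta> u \<in> L" "\<And>u. a u \<noteq> \<zero>\<^bsub>A\<^esub> \<Longrightarrow> nd (\<zeta> u) l = u" "\<zeta> (nd \<eta> l) = \<eta>"
    and \<zeta>': "\<And>u. \<zeta>' u \<in> L" "\<And>u. a u \<noteq> \<zero>\<^bsub>A\<^esub> \<Longrightarrow> nd (\<zeta>' u) l = u" "\<zeta>' (nd \<eta> l) = \<eta>'"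
    and b\<zeta>: "\<And>u. a u \<noteq> \<zero>\<^bsub>A\<^esub> \<Longrightarrow> b (\<zeta> u) = b (\<zeta>' u)"
    and \<phi>Y: "\<phi> (Y \<eta> 0) = F \<oplus> (\<Oplus>u\<in>{..<2 ^ Suc l}. act (a u) (Y (\<zeta> u) n))"
      "\<phi> (Y \<eta>' 0) = F \<oplus> (\<Oplus>u\<in>{..<2 ^ Suc l}. act (a u) (Y (\<zeta>' u) n))"
    and z'_def: "z' = sc (level_pos n - level_pos 0) (\<phi> (bvec (b \<eta>)))"
    and w_def: "w = (\<lambda>u. act (a u) (bvec (b (\<zeta> u))) \<ominus> (if u = nd \<eta> l then z' else \<zero>))"
    and large: "\<And>u. a u \<noteq> \<zero>\<^bsub>A\<^esub> \<Longrightarrow> a u \<notin> A.pmult l"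
      "\<And>u. a u \<noteq> \<zero>\<^bsub>A\<^esub> \<Longrightarrow> fst (snd (b (\<zeta> u))) < 2 ^ l \<and> snd (snd (b (\<zeta> u))) < 2 ^ l"
      "\<And>u. w u \<noteq> \<zero> \<Longrightarrow> w u \<notin> scaled l"
  shows "act (a (nd \<eta> l)) (bvec (b \<eta>)) = z'"
proof -
  define M where "M = {..<(2::nat) ^ Suc l}"
  have finM: "finite M" by (simp add: M_def)
  define v where "v = bvec (b \<eta>)"
  have v: "v \<in> carrier G" using b_closed[OF \<eta>(1)] by (simp add: v_def)
  have z': "z' \<in> carrier G" using \<phi>(1) v by (simp add: z'_def v_def)
  have bv: "bvec (b (\<zeta> u)) \<in> carrier G" for u using b_closed[OF \<zeta>(1)] by simp
  have wG: "w u \<in> carrier G" for u unfolding w_def using a bv z' by simp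
  obtain r where r: "l \<le> r" "nd \<eta> r = nd \<eta>' r" "nd \<eta> (Suc r) \<noteq> nd \<eta>' (Suc r)"
  proof -
    have "sel \<eta> \<noteq> sel \<eta>'" using sel_inj \<eta>(1-3) by (auto dest: inj_onD)
    then obtain k where k: "nd \<eta> k \<noteq> nd \<eta>' k" by (rule node_separates)
    define m where "m = (LEAST m. nd \<eta> m \<noteq> nd \<eta>' m)"
    have m: "nd \<eta> m \<noteq> nd \<eta>' m" unfolding m_def using k by (rule LeastI)
    have "\<not> m \<le> l" using m node_eq_mono[OF \<eta>(5)] by blast
    then obtain r where r: "m = Suc r" "l \<le> r" by (cases m) auto
    have "nd \<eta> r = nd \<eta>' r" using not_less_Least[of r "\<lambda>m. nd \<eta> m \<noteq> nd \<eta>' m"] r(1) unfolding m_def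
      by auto
    then show ?thesis using that r m by blast
  qed
  define q where "q = node_pos (nd \<eta> (Suc r))"
  define q' where "q' = node_pos (nd \<eta>' (Suc r))"
  have q_ge: "level_pos r + 2 ^ r < q" "level_pos r + 2 ^ r < q'"
    unfolding q_def q'_def by (rule level_pos_less_node_pos[OF node_ge])+
  define \<Delta> where "\<Delta> u = sc (level_pos n) (Y (\<zeta> u) n \<ominus> Y (\<zeta>' u) n)" for u
  have \<Delta>: "\<Delta> u \<in> carrier G" for u unfolding \<Delta>_def using \<zeta>(1) \<zeta>'(1) by simp
  \<comment> \<open>\<open>D\<close> is \<open>p ^ level_pos n\<close> times the image of
    \<open>Y \<eta> 0 \<ominus> Y \<eta>' 0\<close>, expressed by the given presentations of the two
    images; next it is computed a second time from the digits of the difference itself.\<close>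
  define D where "D = (\<Oplus>u\<in>M. act (a u) (\<Delta> u))"
  obtain y where y: "y \<in> carrier G" "D = (sc q z' \<ominus> sc q' z') \<oplus> sc (level_pos (Suc r)) y"
  proof -
    define \<delta> where "\<delta> = Y \<eta> 0 \<ominus> Y \<eta>' 0"
    define \<rho> where "\<rho> = Y \<eta> (Suc r) \<ominus> Y \<eta>' (Suc r)"
    have cl: "\<delta> \<in> carrier G" "\<rho> \<in> carrier G" unfolding \<delta>_def \<rho>_def using \<eta> by simp_all
    \<comment> \<open>Denominators: \<open>Y_diff\<close> at level 0 asks for the factor
      \<open>p ^ level_pos 0\<close>, the presentation with \<open>Y _ n\<close> for
      \<open>p ^ level_pos n\<close>. The quotient \<open>p ^ ?k\<close> is the one absorbed into
      \<open>z'\<close>.\<close>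
    let ?k = "level_pos n - level_pos 0"
    have k: "?k + level_pos 0 = level_pos n" using level_pos_mono[of 0 n] by simp
    have cl\<zeta>: "(\<Oplus>u\<in>M. act (a u) (Y (\<zeta> u) n)) \<in> carrier G" "(\<Oplus>u\<in>M. act (a u) (Y (\<zeta>' u) n))
        \<in> carrier G"
      using a \<zeta>(1) \<zeta>'(1) by (auto intro!: G.M.finsum_closed)
    have "\<phi> \<delta> = \<phi> (Y \<eta> 0) \<ominus> \<phi> (Y \<eta>' 0)" unfolding \<delta>_def using \<eta> by (intro additive_diff \<phi>(1,2)) auto
    also have "\<dots> = (\<Oplus>u\<in>M. act (a u) (Y (\<zeta> u) n)) \<ominus> (\<Oplus>u\<in>M. act (a u) (Y (\<zeta>' u) n))"
      using add_diff_cancel[OF F cl\<zeta>(1) G.M.zero_closed cl\<zeta>(2) G.M.zero_closed] cl\<zeta>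
      unfolding \<phi>Y M_def[symmetric] by (simp add: a_minus_def)
    also have "\<dots> = (\<Oplus>u\<in>M. act (a u) (Y (\<zeta> u) n) \<ominus> act (a u) (Y (\<zeta>' u) n))"
      by (rule finsum_diff) (use finM a \<zeta>(1) \<zeta>'(1) in auto)
    finally have "sc (level_pos n) (\<phi> \<delta>) = sc (level_pos n) (\<Oplus>u\<in>M. act (a u) (Y (\<zeta> u) n)
        \<ominus> act (a u) (Y (\<zeta>' u) n))"
      by simp
    also have "\<dots> = (\<Oplus>u\<in>M. sc (level_pos n) (act (a u) (Y (\<zeta> u) n) \<ominus> act (a u) (Y (\<zeta>' u) n)))"
      by (rule act_finsum) (use finM a \<zeta>(1) \<zeta>'(1) in auto)
    also have "\<dots> = D" unfolding D_def
    proof (rule G.M.add.finprod_cong')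
      fix u
      show "sc (level_pos n) (act (a u) (Y (\<zeta> u) n) \<ominus> act (a u) (Y (\<zeta>' u) n)) = act (a u) (\<Delta> u)"
        unfolding \<Delta>_def using a \<zeta>(1) \<zeta>'(1) by (simp add: act_diff[symmetric] sc_act)
    qed (use a \<Delta> in auto)
    finally have D: "D = sc ?k (sc (level_pos 0) (\<phi> \<delta>))" using \<phi>(1) cl by (simp add: sc_sc k)
    have "sc (level_pos 0) (\<phi> \<delta>) = \<phi> ((sc q v \<ominus> sc q' v) \<oplus> sc (level_pos (Suc r)) \<rho>)"
      unfolding \<phi>(3)[OF cl(1), symmetric] unfolding \<delta>_def \<rho>_def q_def q'_def v_def
      using Y_diff[OF \<eta>(1,2,4) r(2), of 0] by simp
    also have "\<dots> = (sc q (\<phi> v) \<ominus> sc q' (\<phi> v)) \<oplus> sc (level_pos (Suc r)) (\<phi> \<rho>)"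
      using v cl \<phi> additive_diff[of \<phi> "sc q v" "sc q' v"] by simp
    finally have "D = sc ?k ((sc q (\<phi> v) \<ominus> sc q' (\<phi> v)) \<oplus> sc (level_pos (Suc r)) (\<phi> \<rho>))" using D
      by simp
    also have "\<dots> = (sc q z' \<ominus> sc q' z') \<oplus> sc (level_pos (Suc r)) (sc ?k (\<phi> \<rho>))"
    proof -
      have comm: "sc ?k (sc k x) = sc k (sc ?k x)" if "x \<in> carrier G" for k x
        using that by (simp add: sc_sc add.commute)
      have "\<phi> v \<in> carrier G" "\<phi> \<rho> \<in> carrier G" using v cl \<phi>(1) by auto
      then show ?thesis
        unfolding z'_def v_def[symmetric] by (simp add: G.act_add_right act_diff comm)
    qed
    finally show thesis by (rule that[rotated]) (use \<phi>(1) cl in simp)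
  qed

  \<comment> \<open>If \<open>\<zeta> u\<close> and \<open>\<zeta>' u\<close> parted at a level
    \<open>Suc i\<close> up to \<open>r\<close>, the node reached by \<open>\<zeta> u\<close> would
    receive the tree term \<open>a u\<close> times \<open>p ^ level_pos (Suc i)\<close>, and nothing
    else in the sum has a coordinate there at the chosen precision.\<close>
  have agree: "nd (\<zeta> u) i = nd (\<zeta>' u) i" if "i \<le> r" "l \<le> i" "a u \<noteq> \<zero>\<^bsub>A\<^esub>" for i u
    using that(2,1,3)
  proof (induction i arbitrary: u rule: dec_induct)
    case base
    then show ?case using \<zeta>(2) \<zeta>'(2) by simp
  next
    case (step i)
    show ?case
    proof (rule ccontr)
      assume ne: "nd (\<zeta> u) (Suc i) \<noteq> nd (\<zeta>' u) (Suc i)"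
      define j where "j = nd (\<zeta> u) (Suc i)"
      \<comment> \<open>\<open>l\<close> places beyond the tree term at \<open>j\<close> suffice to
        see \<open>a u\<close>, which is not divisible by \<open>p ^ l\<close>. As
        \<open>Suc i\<close> is at most \<open>r\<close>, the digits of \<open>\<eta>\<close> and
        \<open>\<eta>'\<close> still lie beyond \<open>N\<close>.\<close>
      define N where "N = level_pos (Suc i) + l"
      define Z where "Z = {x \<in> carrier G. cf j N x \<in> A.pmult N}"
      have Z: "submod Z" unfolding Z_def by (rule submod_cf)
      have scZ: "x \<in> Z" if "x \<in> scaled N" for x
        using cf_scaled[OF that] submod_closed[OF submod_scaled that] by (simp add: Z_def)
      have scZ': "sc k x \<in> Z" if "N \<le> k" "x \<in> carrier G" for k x
        using scZ sc_in_scaled that by blast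
      have l_pow: "l < 2 ^ Suc i" using step.hyps(1) less_exp[of "Suc i"] by linarith
      have "N \<le> level_pos r + 2 ^ r"
        using level_pos_mono[OF step.prems(1)] step.prems(1) step.hyps(1) less_exp[of r]
          unfolding N_def by linarith
      moreover have "level_pos r + 2 ^ r \<le> level_pos (Suc r)" using level_pos_Suc[of r] by simp
      ultimately have N: "N \<le> q" "N \<le> q'" "N \<le> level_pos (Suc r)" using q_ge by linarith+
      have "D \<in> Z" unfolding y(2) using N y(1) z' scZ'
        by (intro submod_add[OF Z] submod_diff[OF Z]) auto
      \<comment> \<open>The induction hypothesis is used for every index \<open>k\<close>, not only
        for \<open>u\<close>: all pairs with nonzero coefficient still agree at level
        \<open>i\<close>.\<close>
      have decomp: "\<Delta> k = (sc (node_pos (nd (\<zeta> k) (Suc i))) (bvec (b (\<zeta> k)))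
          \<ominus> sc (node_pos (nd (\<zeta>' k) (Suc i))) (bvec (b (\<zeta> k)))) \<oplus>
         sc (level_pos (Suc i)) (Y (\<zeta> k) (Suc i) \<ominus> Y (\<zeta>' k) (Suc i))" if "a k \<noteq> \<zero>\<^bsub>A\<^esub>" for k
        unfolding \<Delta>_def using step.IH[OF _ that] step.prems(1) b\<zeta>[OF that] \<zeta>(1) \<zeta>'(1) step.hyps(1) l
        by (intro Y_diff) auto
      \<comment> \<open>The nodes in the vectors of all branches with nonzero coefficient lie below
        \<open>2 ^ l\<close>, so these vectors have no coordinate at \<open>j\<close>.\<close>
      have jl: "2 ^ l \<le> j"
      proof -
        have "(2::nat) ^ l \<le> 2 ^ Suc i" using step.hyps(1) by (intro power_increasing) auto
        then show ?thesis using node_ge[of "Suc i" "sel (\<zeta> u)"] unfolding j_def by linarith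
      qed
      have bZ: "bvec (b (\<zeta> k)) \<in> Z" if "a k \<noteq> \<zero>\<^bsub>A\<^esub>" for k
        using cf_bvec[of "b (\<zeta> k)" j N] bv b_closed[OF \<zeta>(1)] large(2)[OF that] jl
          by (auto simp: Z_def)
      have YZ: "\<exists>x\<in>Z. sc (level_pos (Suc i)) (Y \<xi> (Suc i))
          = sc (level_pos (Suc i)) (E (nd \<xi> (Suc i))) \<oplus> x"
        if "\<xi> \<in> L" "b \<xi> = b (\<zeta> k)" "a k \<noteq> \<zero>\<^bsub>A\<^esub>" for \<xi> k
      proof -
        have N': "N \<le> level_pos (Suc (Suc i))" using level_pos_Suc[of "Suc i"] l_pow
          by (simp add: N_def)
        have "sc (node_pos (nd \<xi> (Suc (Suc i)))) (bvec (b \<xi>))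
            \<oplus> sc (level_pos (Suc (Suc i))) (Y \<xi> (Suc (Suc i))) \<in> Z"
        proof (rule submod_add[OF Z])
          show "sc (node_pos (nd \<xi> (Suc (Suc i)))) (bvec (b \<xi>)) \<in> Z"
            unfolding that(2) by (rule submod_act[OF Z _ bZ[OF that(3)]]) simp
          show "sc (level_pos (Suc (Suc i))) (Y \<xi> (Suc (Suc i))) \<in> Z"
            using scZ' that(1) N' by simp
        qed
        then show ?thesis using Y_step_scaled[OF that(1), of "Suc i"] by blast
      qed
      have EZ: "E j' \<in> Z" if "j' \<noteq> j" for j' using cf_E_other[OF that] by (simp add: Z_def)
      have YZ': "sc (level_pos (Suc i)) (Y \<xi> (Suc i)) \<in> Z"
        if \<xi>: "\<xi> \<in> L" "b \<xi> = b (\<zeta> k)" "a k \<noteq> \<zero>\<^bsub>A\<^esub>" "nd \<xi> (Suc i) \<noteq> j" for \<xi> k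
      proof -
        obtain x where "x \<in> Z" "sc (level_pos (Suc i)) (Y \<xi> (Suc i))
            = sc (level_pos (Suc i)) (E (nd \<xi> (Suc i))) \<oplus> x"
          using YZ[OF \<xi>(1-3)] by blast
        then show ?thesis using submod_add[OF Z] submod_act[OF Z] EZ[OF \<xi>(4)] by simp
      qed
      \<comment> \<open>A branch with another index has another node at level \<open>l\<close>
        already and cannot pass through \<open>j\<close>.\<close>
      have other: "nd (\<zeta> k) (Suc i) \<noteq> j \<and> nd (\<zeta>' k) (Suc i) \<noteq> j" if "a k \<noteq> \<zero>\<^bsub>A\<^esub>" "k \<noteq> u" for k
      proof -
        have "nd (\<zeta> k) l \<noteq> nd (\<zeta> u) l" "nd (\<zeta>' k) l \<noteq> nd (\<zeta> u) l"
          using \<zeta>(2) \<zeta>'(2) that step.prems(2) by auto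
        moreover have "nd \<xi> (Suc i) \<noteq> j" if "nd \<xi> l \<noteq> nd (\<zeta> u) l" for \<xi>
        proof
          assume "nd \<xi> (Suc i) = j"
          then have "nd \<xi> l = nd (\<zeta> u) l" unfolding j_def
            by (rule node_eq_mono) (use step.hyps(1) in simp)
          then show False using that by simp
        qed
        ultimately show ?thesis by blast
      qed
      have uM: "u \<in> M" using \<zeta>(2)[OF step.prems(2)] node_less[of "sel (\<zeta> u)" l] by (simp add: M_def)
      have "act (a u) (\<Delta> u) \<in> Z"
      proof (rule submod_single_term[OF Z finM uM])
        show "act (a k) (\<Delta> k) \<in> carrier G" for k using a \<Delta> by simp
        show "(\<Oplus>k\<in>M. act (a k) (\<Delta> k)) \<in> Z" using \<open>D \<in> Z\<close> by (simp add: D_def)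
        fix k assume k: "k \<noteq> u"
        show "act (a k) (\<Delta> k) \<in> Z"
        proof (cases "a k = \<zero>\<^bsub>A\<^esub>")
          case True
          then show ?thesis using \<Delta> submod_zero[OF Z] by simp
        next
          case False
          have "sc (level_pos (Suc i)) (Y (\<zeta> k) (Suc i) \<ominus> Y (\<zeta>' k) (Suc i)) =
            sc (level_pos (Suc i)) (Y (\<zeta> k) (Suc i)) \<ominus> sc (level_pos (Suc i)) (Y (\<zeta>' k) (Suc i))"
            using \<zeta>(1) \<zeta>'(1) by (intro act_diff) auto
          moreover have "\<dots> \<in> Z"
            using YZ'[OF \<zeta>(1) _ False] YZ'[OF \<zeta>'(1) _ False] b\<zeta>[OF False] other[OF False k]
            by (intro submod_diff[OF Z]) auto
          ultimately have "sc (level_pos (Suc i)) (Y (\<zeta> k) (Suc i) \<ominus> Y (\<zeta>' k) (Suc i)) \<in> Z" by simp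
          moreover have "sc (node_pos (nd (\<zeta> k) (Suc i))) (bvec (b (\<zeta> k)))
              \<ominus> sc (node_pos (nd (\<zeta>' k) (Suc i))) (bvec (b (\<zeta> k))) \<in> Z"
            using bZ[OF False] by (intro submod_diff[OF Z] submod_act[OF Z]) auto
          ultimately have "\<Delta> k \<in> Z" unfolding decomp[OF False] by (intro submod_add[OF Z])
          then show ?thesis using submod_act[OF Z] a by blast
        qed
      qed
      obtain x where x: "x \<in> Z" "sc (level_pos (Suc i)) (Y (\<zeta> u) (Suc i))
          = sc (level_pos (Suc i)) (E j) \<oplus> x"
        using YZ[OF \<zeta>(1) refl step.prems(2)] unfolding j_def by blast
      have y': "sc (level_pos (Suc i)) (Y (\<zeta>' u) (Suc i)) \<in> Z"
        using YZ'[OF \<zeta>'(1) _ step.prems(2)] b\<zeta>[OF step.prems(2)] ne unfolding j_def by simp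
      define B where "B = sc (node_pos (nd (\<zeta> u) (Suc i))) (bvec (b (\<zeta> u)))
          \<ominus> sc (node_pos (nd (\<zeta>' u) (Suc i))) (bvec (b (\<zeta> u)))"
      have BZ: "B \<in> Z" unfolding B_def using bZ[OF step.prems(2)]
        by (intro submod_diff[OF Z] submod_act[OF Z]) auto
      let ?e = "sc (level_pos (Suc i)) (E j)" and ?y = "sc (level_pos (Suc i)) (Y (\<zeta>' u) (Suc i))"
      have cl: "B \<in> carrier G" "x \<in> carrier G" "?y \<in> carrier G" "?e \<in> carrier G"
        using submod_closed[OF Z] BZ x(1) y' by auto
      have "\<Delta> u = B \<oplus> ((?e \<oplus> x) \<ominus> ?y)"
        unfolding decomp[OF step.prems(2)] B_def x(2)[symmetric] using \<zeta>(1) \<zeta>'(1)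
          by (simp add: act_diff)
      also have "\<dots> = ?e \<oplus> (B \<oplus> (x \<ominus> ?y))"
        using cl by (simp add: a_minus_def G.M.a_ac)
      finally have "act (a u) (\<Delta> u) = act (a u) ?e \<oplus> act (a u) (B \<oplus> (x \<ominus> ?y))"
        using cl a by (simp add: G.act_add_right)
      moreover have "act (a u) (B \<oplus> (x \<ominus> ?y)) \<in> Z"
        by (rule submod_act[OF Z a submod_add[OF Z BZ submod_diff[OF Z x(1) y']]])
      ultimately have "act (a u) ?e \<in> Z"
        using submod_cancel'[OF Z, of "act (a u) (B \<oplus> (x \<ominus> ?y))"
          "act (a u) ?e"] \<open>act (a u) (\<Delta> u) \<in> Z\<close> a by simp
      then have "act (pw (level_pos (Suc i)) \<otimes>\<^bsub>A\<^esub> a u) (E j) \<in> Z" using a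
        by (simp add: A.pow_comm G.act_mult)
      then have "pw (level_pos (Suc i)) \<otimes>\<^bsub>A\<^esub> a u \<in> A.pmult N" using act_E_cf a by (simp add: Z_def)
      then have "a u \<in> A.pmult l" unfolding N_def using A.pmult_cancel a by blast
      then show False using large(1) step.prems(2) by blast
    qed
  qed

  define \<nu> where "\<nu> u = nd (\<zeta> u) (Suc r)" for u
  define \<nu>' where "\<nu>' u = nd (\<zeta>' u) (Suc r)" for u
  have u0M: "nd \<eta> l \<in> M" using node_less by (simp add: M_def)
  have same: "nd (\<zeta> u) l = u \<and> nd (\<zeta>' u) l = u" if "w u \<noteq> \<zero>" for u
  proof (cases "a u = \<zero>\<^bsub>A\<^esub>")
    case True
    then have "u = nd \<eta> l" using that bv z' unfolding w_def
      by (auto simp: a_minus_def split: if_splits)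
    then show ?thesis using \<zeta>(3) \<zeta>'(3) \<eta>(5) by simp
  qed (use \<zeta>(2) \<zeta>'(2) in simp)
  have "w (nd \<eta> l) = \<zero>"
  proof (rule digit_separation[where S = M and w = w and \<nu> = \<nu> and \<nu>' = \<nu>' and m = "Suc r"
    and l = l])
    show "w u \<in> carrier G" for u by (rule wG)
    show "finite M" by (rule finM)
    show "{\<nu> u, \<nu>' u} \<inter> {\<nu> k, \<nu>' k} = {}" if "w u \<noteq> \<zero>" "w k \<noteq> \<zero>" "u \<noteq> k" for u k
    proof -
      have *: "nd \<xi> (Suc r) \<noteq> nd \<xi>' (Suc r)" if "nd \<xi> l = u" "nd \<xi>' l = k" for \<xi> \<xi>'
      proof
        assume "nd \<xi> (Suc r) = nd \<xi>' (Suc r)"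
        then have "nd \<xi> l = nd \<xi>' l" by (rule node_eq_mono) (use r(1) in simp)
        then show False using \<open>u \<noteq> k\<close> that(1,2) by simp
      qed
      show ?thesis unfolding \<nu>_def \<nu>'_def
        using *[of "\<zeta> u" "\<zeta> k"] *[of "\<zeta> u" "\<zeta>' k"] *[of "\<zeta>' u" "\<zeta> k"] *[of "\<zeta>' u" "\<zeta>' k"]
          same[OF that(1)] same[OF that(2)] by blast
    qed
    show "2 ^ Suc r \<le> \<nu> u \<and> \<nu> u < 2 ^ Suc (Suc r) \<and> 2 ^ Suc r \<le> \<nu>' u \<and> \<nu>' u < 2 ^ Suc (Suc r)" for u
      unfolding \<nu>_def \<nu>'_def using node_ge node_less by blast
    show "l \<le> 2 ^ Suc r" using r(1) less_exp[of "Suc r"] by linarith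
    show "nd \<eta> l \<in> M" by (rule u0M)
    show "\<nu> (nd \<eta> l) \<noteq> \<nu>' (nd \<eta> l)" unfolding \<nu>_def \<nu>'_def \<zeta>(3) \<zeta>'(3) by (rule r(3))
    note Z = submod_scaled[of "level_pos (Suc r)"]
    \<comment> \<open>The remainders beyond the digits of level \<open>Suc r\<close>; they are
      multiples of \<open>p ^ level_pos (Suc r)\<close> and drop out.\<close>
    define R where "R u = sc (level_pos (Suc r)) (Y (\<zeta> u) (Suc r) \<ominus> Y (\<zeta>' u) (Suc r))" for u
    have R: "R u \<in> carrier G" for u unfolding R_def using \<zeta>(1) \<zeta>'(1) by simp
    \<comment> \<open>Charging \<open>z'\<close> to the index of \<open>\<eta>\<close> yields a
      single sum with coefficients \<open>w u\<close>: at this index the two branches are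
      \<open>\<eta>\<close> and \<open>\<eta>'\<close>, so its digits are precisely those that
      accompany \<open>z'\<close>.\<close>
    define z0 where "z0 u = (if u = nd \<eta> l then z' else \<zero>)" for u
    have z0: "z0 u \<in> carrier G" for u using z' by (simp add: z0_def)
    have summand: "sc (node_pos (\<nu> u)) (w u) \<ominus> sc (node_pos (\<nu>' u)) (w u) =
      (act (a u) (\<Delta> u) \<ominus> act (a u) (R u)) \<ominus> (sc q (z0 u) \<ominus> sc q' (z0 u))" for u
    proof -
      let ?v = "bvec (b (\<zeta> u))" and ?n = "node_pos (\<nu> u)" and ?n' = "node_pos (\<nu>' u)"
      have "act (a u) (\<Delta> u) = act (a u) (sc ?n ?v \<ominus> sc ?n' ?v) \<oplus> act (a u) (R u)"
      proof (cases "a u = \<zero>\<^bsub>A\<^esub>")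
        case True
        then show ?thesis using \<Delta> R bv by simp
      next
        case False
        have "\<Delta> u = (sc ?n ?v \<ominus> sc ?n' ?v) \<oplus> R u"
          unfolding \<Delta>_def \<nu>_def \<nu>'_def R_def
          by (rule Y_diff) (use \<zeta>(1) \<zeta>'(1) b\<zeta>[OF False] agree[OF le_refl r(1) False] l r(1) in auto)
        then show ?thesis using a bv R by (simp add: G.act_add_right)
      qed
      then have 1: "act (a u) (\<Delta> u) \<ominus> act (a u) (R u) = act (a u) (sc ?n ?v \<ominus> sc ?n' ?v)"
        using a bv R by (simp add: a_minus_def G.M.a_assoc G.M.r_neg)
      have 2: "sc q (z0 u) = sc ?n (z0 u)" "sc q' (z0 u) = sc ?n' (z0 u)"
        by (simp_all add: z0_def q_def q'_def \<nu>_def \<nu>'_def \<zeta>(3) \<zeta>'(3))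
      have w: "w u = act (a u) ?v \<ominus> z0 u" by (simp add: w_def z0_def)
      have swap: "(s \<ominus> t) \<ominus> (s' \<ominus> t') = (s \<ominus> s') \<ominus> (t \<ominus> t')"
        if "s \<in> carrier G" "t \<in> carrier G" "s' \<in> carrier G" "t' \<in> carrier G" for s t s' t'
        using that by (simp add: a_minus_def G.M.minus_add G.M.a_ac)
      have "sc ?n (w u) \<ominus> sc ?n' (w u) =
        (act (a u) (sc ?n ?v) \<ominus> sc ?n (z0 u)) \<ominus> (act (a u) (sc ?n' ?v) \<ominus> sc ?n' (z0 u))"
        unfolding w using a bv z0 by (simp add: act_diff sc_act)
      also have "\<dots> = (act (a u) (sc ?n ?v) \<ominus> act (a u) (sc ?n' ?v)) \<ominus> (sc ?n (z0 u)
          \<ominus> sc ?n' (z0 u))"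
        by (rule swap) (use a bv z0 in auto)
      finally show ?thesis unfolding 1 2 using a bv by (simp add: act_diff)
    qed
    have DR: "D \<ominus> (\<Oplus>u\<in>M. act (a u) (R u)) = (\<Oplus>u\<in>M. act (a u) (\<Delta> u) \<ominus> act (a u) (R u))"
      unfolding D_def by (rule finsum_diff) (use finM a \<Delta> R in auto)
    have "(\<Oplus>u\<in>M. sc (node_pos (\<nu> u)) (w u) \<ominus> sc (node_pos (\<nu>' u)) (w u)) =
      (D \<ominus> (\<Oplus>u\<in>M. act (a u) (R u))) \<ominus> (\<Oplus>u\<in>M. sc q (z0 u) \<ominus> sc q' (z0 u))"
      unfolding summand DR by (rule finsum_diff[symmetric]) (use finM a \<Delta> R z0 in auto)
    also have "(\<Oplus>u\<in>M. sc q (z0 u) \<ominus> sc q' (z0 u)) = sc q z' \<ominus> sc q' z'"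
    proof -
      have "(\<Oplus>u\<in>M. sc q (z0 u) \<ominus> sc q' (z0 u)) = (\<Oplus>u\<in>M. if nd \<eta> l = u then sc q z'
          \<ominus> sc q' z' else \<zero>)"
        by (rule G.M.add.finprod_cong') (use z' in \<open>auto simp: z0_def a_minus_def\<close>)
      also have "\<dots> = sc q z' \<ominus> sc q' z'"
        by (rule G.M.add.finprod_singleton) (use u0M finM z' in auto)
      finally show ?thesis .
    qed
    finally have eq: "(\<Oplus>u\<in>M. sc (node_pos (\<nu> u)) (w u) \<ominus> sc (node_pos (\<nu>' u)) (w u)) =
      (D \<ominus> (\<Oplus>u\<in>M. act (a u) (R u))) \<ominus> (sc q z' \<ominus> sc q' z')" .
    define T where "T = (\<Oplus>u\<in>M. act (a u) (R u))"
    define c where "c = sc q z' \<ominus> sc q' z'"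
    have TZ: "T \<in> scaled (level_pos (Suc r))" unfolding T_def
    proof (rule submod_finsum[OF Z finM])
      fix u show "act (a u) (R u) \<in> scaled (level_pos (Suc r))"
        unfolding R_def using a \<zeta>(1) \<zeta>'(1) by (intro submod_act[OF Z] scaledI) auto
    qed
    have cl: "T \<in> carrier G" "c \<in> carrier G" using submod_closed[OF Z TZ] z' by (auto simp: c_def)
    have cancel: "(c \<oplus> s \<ominus> T) \<ominus> c = s \<ominus> T" if "s \<in> carrier G" for s
    proof -
      have "(c \<oplus> s \<oplus> t) \<oplus> \<ominus> c = s \<oplus> t \<oplus> (c \<oplus> \<ominus> c)" if "t \<in> carrier G" for t
        using cl \<open>s \<in> carrier G\<close> that by (simp add: G.M.a_ac)
      from this[of "\<ominus> T"] show ?thesis using cl that by (simp add: a_minus_def G.M.r_neg)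
    qed
    show "(\<Oplus>u\<in>M. sc (node_pos (\<nu> u)) (w u) \<ominus> sc (node_pos (\<nu>' u)) (w u))
        \<in> scaled (level_pos (Suc r))"
      unfolding eq y(2) T_def[symmetric] c_def[symmetric] using cancel y(1) TZ scaledI
      by (simp add: submod_diff[OF Z])
    show "w u \<notin> scaled l" if "w u \<noteq> \<zero>" for u using large(3)[OF that] .
  qed
  then have "act (a (nd \<eta> l)) v \<ominus> z' = \<zero>" unfolding w_def \<zeta>(3) v_def by simp
  then show ?thesis using a v z' unfolding v_def by simp
qed

end

text \<open>Lists are counted length by length: each length contributes at most \<open>|B|\<close>,
  and there are countably many lengths.\<close>

lemma lists_ordLeq_infinite:
  assumes B: "infinite B" and Y: "|Y| \<le>o |B|"
  shows "|lists Y| \<le>o |B|"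
proof -
  have len: "|{xs \<in> lists Y. length xs = n}| \<le>o |B|" for n
  proof (induction n)
    case 0
    have "{xs \<in> lists Y. length xs = 0} = {[]}" by auto
    then show ?case using B by (simp add: ordLess_imp_ordLeq finite_ordLess_infinite2)
  next
    case (Suc n)
    have "|{xs \<in> lists Y. length xs = Suc n}| \<le>o |Y \<times> {xs \<in> lists Y. length xs = n}|"
    proof (rule surj_imp_ordLeq)
      show "{xs \<in> lists Y. length xs = Suc n} \<subseteq> (\<lambda>(y, ys). y # ys) ` (Y \<times> {xs \<in> lists Y. length xs
          = n})"
      proof
        fix xs assume "xs \<in> {xs \<in> lists Y. length xs = Suc n}"
        then obtain y ys where "xs = y # ys" "y \<in> Y" "ys \<in> lists Y" "length ys = n"
          by (cases xs) auto
        then show "xs \<in> (\<lambda>(y, ys). y # ys) ` (Y \<times> {xs \<in> lists Y. length xs = n})" by force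
      qed
    qed
    also have "|Y \<times> {xs \<in> lists Y. length xs = n}| \<le>o |B|"
      by (rule card_of_Times_ordLeq_infinite[OF B Y Suc])
    finally show ?case .
  qed
  have "lists Y = (\<Union>n. {xs \<in> lists Y. length xs = n})" by auto
  moreover have "|\<Union>n. {xs \<in> lists Y. length xs = n}| \<le>o |B|"
    by (rule card_of_UNION_ordLeq_infinite[OF B]) (use B len infinite_iff_card_of_nat in auto)
  ultimately show ?thesis by metis
qed

context branch_module
begin

text \<open>More than \<open>|A|\<close> branches \<open>\<eta>\<close> carry the vector \<open>bvec (x, t, s)\<close>, but there are only \<open>|A|\<close> possible
  data describing \<open>\<phi> (Y \<eta> 0)\<close>, so two of these branches share their data.\<close>

lemma scalar_on_bvec:
  assumes \<phi>: "\<And>x. x \<in> carrier G \<Longrightarrow> \<phi> x \<in> carrier G"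
      "\<And>x y. x \<in> carrier G \<Longrightarrow> y \<in> carrier G \<Longrightarrow> \<phi> (x \<oplus> y) = \<phi> x \<oplus> \<phi> y"
      "\<And>x n. x \<in> carrier G \<Longrightarrow> \<phi> (sc n x) = sc n (\<phi> x)"
    and inf: "infinite (carrier A)"
    and x: "x \<in> carrier A" and ts: "t \<noteq> s"
    and fibre: "|carrier A| <o |{\<eta> \<in> L. b \<eta> = (x, t, s)}|"
  shows "\<exists>c\<in>carrier A. \<phi> (bvec (x, t, s)) = act c (bvec (x, t, s))"
proof -
  define v where "v = bvec (x, t, s)"
  have v: "v \<in> carrier G" using x by (simp add: v_def)
  define Fib where "Fib = {\<eta> \<in> L. b \<eta> = (x, t, s)}"
  define k where "k n = level_pos n - level_pos 0" for n
  define wt where "wt n \<eta> \<zeta> a = act a (bvec (b \<zeta>)) \<ominus> (if \<zeta> = \<eta> then sc (k n) (\<phi> v) else \<zero>)" for n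
    and \<eta> \<zeta> :: 'l and a
  \<comment> \<open>The last clause is not a special case of the one on \<open>wt\<close>: indices
    other than the node of \<open>\<eta>\<close> may carry \<open>\<eta>\<close> as default branch,
    and there nothing is to be subtracted.\<close>
  define Q where "Q \<eta> n \<zeta> a l \<longleftrightarrow> (a \<noteq> \<zero>\<^bsub>A\<^esub> \<longrightarrow> a \<notin> A.pmult l) \<and> fst (snd (b \<zeta>)) < 2 ^ l
      \<and> snd (snd (b \<zeta>)) < 2 ^ l \<and>
     (wt n \<eta> \<zeta> a \<noteq> \<zero> \<longrightarrow> wt n \<eta> \<zeta> a \<notin> scaled l) \<and> (act a (bvec (b \<zeta>)) \<noteq> \<zero> \<longrightarrow> act a (bvec (b \<zeta>)) \<notin> scaled l)"
    for \<eta> \<zeta> :: 'l and n l and a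
  have large: "\<forall>\<^sub>F l in sequentially. (m::nat) < 2 ^ l" for m
    unfolding eventually_sequentially
      by (meson less_exp less_le_trans one_le_numeral power_increasing)
  have evS: "\<forall>\<^sub>F l in sequentially. y \<noteq> \<zero> \<longrightarrow> y \<notin> scaled l" if "y \<in> carrier G" for y
    using eventually_notin_scaled[OF that] by (cases "y = \<zero>") (auto elim: eventually_mono)
  have evA: "\<forall>\<^sub>F l in sequentially. a \<noteq> \<zero>\<^bsub>A\<^esub> \<longrightarrow> a \<notin> A.pmult l" if "a \<in> carrier A" for a
    using A.eventually_notin_pmult[OF that] by (cases "a = \<zero>\<^bsub>A\<^esub>") (auto elim: eventually_mono)
  have ev: "\<forall>\<^sub>F l in sequentially. Q \<eta> n \<zeta> a l" if "\<zeta> \<in> L" "a \<in> carrier A" for \<eta> n \<zeta> a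
  proof -
    have "wt n \<eta> \<zeta> a \<in> carrier G" "act a (bvec (b \<zeta>)) \<in> carrier G"
      unfolding wt_def using that b_closed[OF that(1)] \<phi>(1)[OF v] by simp_all
    then show ?thesis unfolding Q_def by (intro eventually_conj evA[OF that(2)] large evS)
  qed
  define P where "P \<eta> n l K f a \<zeta> \<longleftrightarrow> n \<le> l \<and> (\<forall>j. f j \<in> carrier A) \<and> (\<forall>u. a u \<in> carrier A) \<and> (\<forall>u. \<zeta> u
      \<in> L) \<and>
    (\<forall>u. a u \<noteq> \<zero>\<^bsub>A\<^esub> \<longrightarrow> nd (\<zeta> u) l = u) \<and> \<zeta> (nd \<eta> l) = \<eta> \<and> (\<forall>u. Q \<eta> n (\<zeta> u) (a u) l) \<and>
    \<phi> (Y \<eta> 0) = (\<Oplus>j\<in>{..<K::nat}. act (f j) (E j)) \<oplus> (\<Oplus>u\<in>{..<2 ^ Suc l}. act (a u) (Y (\<zeta> u) n))"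
    for \<eta> n l K f and a :: "nat \<Rightarrow> 'a" and \<zeta>
  have "\<exists>n l K f a \<zeta>. P \<eta> n l K f a \<zeta>" if \<eta>: "\<eta> \<in> L" for \<eta>
  proof -
    have "\<phi> (Y \<eta> 0) \<in> carrier G" using \<phi>(1) \<eta> by simp
    from presentation[where Q = "Q \<eta>", OF this \<eta> ev] show ?thesis unfolding P_def
      by (smt (verit, best))
  qed
  then obtain n l K f a \<zeta> where P: "\<And>\<eta>. \<eta> \<in> L \<Longrightarrow> P \<eta> (n \<eta>) (l \<eta>) (K \<eta>) (f \<eta>) (a \<eta>) (\<zeta> \<eta>)" by metis
  \<comment> \<open>For each branch in the presentation only its vector is kept; vectors and
    coefficients together form a set of size \<open>|carrier A|\<close>, and lists over it are no
    more numerous. The node \<open>nd \<eta> (l \<eta>)\<close> forces two branches with equal data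
    to agree up to this level.\<close>
  define dat where "dat \<eta> = ((n \<eta>, l \<eta>, nd \<eta> (l \<eta>)), map (f \<eta>) [0..<K \<eta>],
     map (\<lambda>u. (a \<eta> u, b (\<zeta> \<eta> u))) [0..<2 ^ Suc (l \<eta>)])" for \<eta>
  let ?T = "carrier A \<times> carrier A \<times> (UNIV :: nat set) \<times> (UNIV :: nat set)"
  have nat: "|UNIV :: nat set| \<le>o |carrier A|" using inf infinite_iff_card_of_nat by blast
  note times = card_of_Times_ordLeq_infinite[OF inf]
  have "|?T| \<le>o |carrier A|" by (intro times nat ordLeq_refl card_of_Card_order)
  then have "|((UNIV :: nat set) \<times> (UNIV :: nat set) \<times> (UNIV :: nat set)) \<times> lists (carrier A) \<times> lists ?T| \<le>o |carrier A|"
    by (intro times nat lists_ordLeq_infinite[OF inf] ordLeq_refl card_of_Card_order)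
  moreover have "dat ` Fib \<subseteq> ((UNIV :: nat set) \<times> (UNIV :: nat set) \<times> (UNIV :: nat set)) \<times> lists (carrier A) \<times> lists ?T"
  proof
    fix d assume "d \<in> dat ` Fib"
    then obtain \<eta> where \<eta>: "\<eta> \<in> L" "d = dat \<eta>" by (auto simp: Fib_def)
    have "\<forall>j. f \<eta> j \<in> carrier A" "\<forall>u. a \<eta> u \<in> carrier A" "\<forall>u. \<zeta> \<eta> u \<in> L" using P[OF \<eta>(1)]
      unfolding P_def by blast+
    then show "d \<in> ((UNIV :: nat set) \<times> (UNIV :: nat set) \<times> (UNIV :: nat set)) \<times> lists (carrier A) \<times> lists ?T"
      unfolding \<eta>(2) dat_def using b_closed
      by (simp add: mem_Times_iff lists_eq_set image_subset_iff)
  qed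
  ultimately have "|dat ` Fib| \<le>o |carrier A|" using card_of_mono1 ordLeq_transitive by blast
  have "\<not> inj_on dat Fib"
  proof
    assume "inj_on dat Fib"
    then have "|Fib| \<le>o |dat ` Fib|" by (intro card_of_ordLeq[THEN iffD1]) blast
    then have "|Fib| \<le>o |carrier A|" using \<open>|dat ` Fib| \<le>o |carrier A|\<close> by (rule ordLeq_transitive)
    then show False using fibre not_ordLeq_ordLess unfolding Fib_def[symmetric] by blast
  qed
  then obtain \<eta> \<eta>' where \<eta>: "\<eta> \<in> Fib" "\<eta>' \<in> Fib" "\<eta> \<noteq> \<eta>'" "dat \<eta> = dat \<eta>'"
    by (auto simp: inj_on_def)
  have L: "\<eta> \<in> L" "\<eta>' \<in> L" "b \<eta> = (x, t, s)" "b \<eta>' = (x, t, s)" using \<eta>(1,2) by (auto simp: Fib_def)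
  define m where "m = l \<eta>"
  have same: "n \<eta>' = n \<eta>" "l \<eta>' = m" "nd \<eta> m = nd \<eta>' m" "map (f \<eta>) [0..<K \<eta>]
      = map (f \<eta>') [0..<K \<eta>']"
     "map (\<lambda>u. (a \<eta> u, b (\<zeta> \<eta> u))) [0..<2 ^ Suc m] = map (\<lambda>u. (a \<eta>' u, b (\<zeta> \<eta>' u))) [0..<2 ^ Suc m]"
    using \<eta>(4) unfolding dat_def m_def by auto
  have KK: "K \<eta>' = K \<eta>" using arg_cong[OF same(4), of length] by simp
  have ff: "f \<eta>' j = f \<eta> j" if "j < K \<eta>" for j using same(4) that unfolding KK by simp
  have ab: "a \<eta>' u = a \<eta> u \<and> b (\<zeta> \<eta>' u) = b (\<zeta> \<eta> u)" if "u < 2 ^ Suc m" for u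
    using same(5) that by simp
  note p = P[OF L(1), unfolded P_def, folded m_def] and p' = P[OF L(2), unfolded P_def same(1,2)]
  \<comment> \<open>Nonzero coefficients sit at nodes of level \<open>m\<close>, so equality of the
    finite lists gives equality of the whole coefficient functions.\<close>
  have sml: "u < 2 ^ Suc m" if "a \<eta> u \<noteq> \<zero>\<^bsub>A\<^esub> \<or> a \<eta>' u \<noteq> \<zero>\<^bsub>A\<^esub>" for u
    using p p' that node_less by metis
  have aa: "a \<eta>' u = a \<eta> u" for u using ab[of u] sml[of u] by metis
  define F where "F = (\<Oplus>j\<in>{..<K \<eta>}. act (f \<eta> j) (E j))"
  have F: "F \<in> carrier G" unfolding F_def using p by (intro G.M.finsum_closed) auto
  have F': "(\<Oplus>j\<in>{..<K \<eta>'}. act (f \<eta>' j) (E j)) = F"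
    unfolding F_def KK by (rule G.M.add.finprod_cong') (use ff p in auto)
  define u0 where "u0 = nd \<eta> m"
  have "act (a \<eta> u0) (bvec (b \<eta>)) = sc (k (n \<eta>)) (\<phi> (bvec (b \<eta>)))"
    unfolding u0_def
  proof (rule endomorphism_on_bvec[where \<phi> = \<phi> and \<eta> = \<eta> and \<eta>' = \<eta>' and l = m and n = "n \<eta>"
    and F = F
        and a = "a \<eta>" and \<zeta> = "\<zeta> \<eta>"
          and \<zeta>' = "\<zeta> \<eta>'", OF \<phi> L(1,2) \<eta>(3) _ same(3) _ F _ _ _ _ _ _ _ _ _ _ _ refl])
    show "b \<eta> = b \<eta>'" using L by simp
    show "\<phi> (Y \<eta>' 0) = F \<oplus> (\<Oplus>u\<in>{..<2 ^ Suc m}. act (a \<eta> u) (Y (\<zeta> \<eta>' u) (n \<eta>)))"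
      using p' unfolding F' aa by blast
    show "\<phi> (Y \<eta> 0) = F \<oplus> (\<Oplus>u\<in>{..<2 ^ Suc m}. act (a \<eta> u) (Y (\<zeta> \<eta> u) (n \<eta>)))"
      using p unfolding F_def by blast
    show "b (\<zeta> \<eta> u) = b (\<zeta> \<eta>' u)" if "a \<eta> u \<noteq> \<zero>\<^bsub>A\<^esub>" for u using ab[of u] sml[of u] that by simp
    show "\<zeta> \<eta>' u \<in> L" for u using p' by blast
    show "\<zeta> \<eta>' (nd \<eta> m) = \<eta>'" using p' same(3) by simp
    show "nd (\<zeta> \<eta>' u) m = u" if "a \<eta> u \<noteq> \<zero>\<^bsub>A\<^esub>" for u using p' aa that by simp
    show "sc (k (n \<eta>)) (\<phi> (bvec (b \<eta>))) = sc (level_pos (n \<eta>) - level_pos 0) (\<phi> (bvec (b \<eta>)))"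
      by (simp add: k_def)
  next
    fix u
    let ?w = "act (a \<eta> u) (bvec (b (\<zeta> \<eta> u))) \<ominus> (if u
        = nd \<eta> m then sc (k (n \<eta>)) (\<phi> (bvec (b \<eta>))) else \<zero>)"
    assume w: "?w \<noteq> \<zero>"
    have Q: "Q \<eta> (n \<eta>) (\<zeta> \<eta> u) (a \<eta> u) m" using p by blast
    show "?w \<notin> scaled m"
    proof (cases "u = nd \<eta> m")
      case True
      then have "?w = wt (n \<eta>) \<eta> (\<zeta> \<eta> u) (a \<eta> u)" using p by (simp add: wt_def v_def L(3))
      then show ?thesis using Q w unfolding Q_def by metis
    next
      case False
      have "bvec (b (\<zeta> \<eta> u)) \<in> carrier G" using p b_closed by simp
      then have "?w = act (a \<eta> u) (bvec (b (\<zeta> \<eta> u)))" using False p by (simp add: a_minus_def)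
      then show ?thesis using Q w unfolding Q_def by metis
    qed
  qed (use p in \<open>auto simp: Q_def\<close>)
  then have eq: "act (a \<eta> u0) v = sc (k (n \<eta>)) (\<phi> v)" unfolding L(3) v_def .
  have aA: "a \<eta> u0 \<in> carrier A" using p by blast
  \<comment> \<open>The factor \<open>p ^ k (n \<eta>)\<close> can be cancelled because the
    coordinate of \<open>v\<close> at \<open>s\<close> is 1; \<open>t \<noteq> s\<close> keeps the
    other summand of \<open>v\<close> away from it.\<close>
  have "a \<eta> u0 \<in> A.pmult (k (n \<eta>))"
  proof -
    define Z where "Z = {y \<in> carrier G. cf s (k (n \<eta>)) y \<in> A.pmult (k (n \<eta>))}"
    have Z: "submod Z" unfolding Z_def by (rule submod_cf)
    have "act (a \<eta> u0) v \<in> scaled (k (n \<eta>))" unfolding eq using \<phi>(1)[OF v] by (rule scaledI)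
    then have "act (a \<eta> u0) v \<in> Z" using cf_scaled v aA by (simp add: Z_def)
    moreover have "act (a \<eta> u0) v = act (a \<eta> u0) (act x (E t)) \<oplus> act (a \<eta> u0) (E s)"
      unfolding v_def bvec_def using x aA by (simp add: G.act_add_right)
    moreover have "E t \<in> Z" using cf_E_other[OF ts] by (simp add: Z_def)
    then have "act (a \<eta> u0) (act x (E t)) \<in> Z" using submod_act[OF Z] x aA by blast
    ultimately have "act (a \<eta> u0) (E s) \<in> Z"
      using submod_cancel[OF Z, of "act (a \<eta> u0) (act x (E t))" "act (a \<eta> u0) (E s)"] aA by simp
    then show ?thesis using act_E_cf[OF aA] by (simp add: Z_def)
  qed
  then obtain c where c: "c \<in> carrier A" "a \<eta> u0 = pw (k (n \<eta>)) \<otimes>\<^bsub>A\<^esub> c" by (rule A.pmultE)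
  have "sc (k (n \<eta>)) (act c v) = sc (k (n \<eta>)) (\<phi> v)" unfolding eq[symmetric] c(2) using c(1) v
    by (simp add: G.act_mult)
  then have "act c v = \<phi> v" using sc_inj c(1) v \<phi>(1)[OF v] by simp
  then show ?thesis using c(1) unfolding v_def by metis
qed

text \<open>The vectors with \<open>x = 0\<close> show that each \<open>E s\<close> is mapped to
  \<open>\<alpha> s\<close> times itself. A vector \<open>(x, t, s)\<close> then determines the
  image of \<open>act x (E t)\<close> up to a multiple of \<open>E s\<close>, and
  \<open>x = 1\<close> shows that \<open>\<alpha>\<close> is constant. All \<open>x\<close> are
  needed, since \<open>\<phi>\<close> is not assumed to commute with the action of
  \<open>A\<close>.\<close>

lemma endomorphism_is_scalar:
  assumes \<phi>: "\<And>x. x \<in> carrier G \<Longrightarrow> \<phi> x \<in> carrier G"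
      "\<And>x y. x \<in> carrier G \<Longrightarrow> y \<in> carrier G \<Longrightarrow> \<phi> (x \<oplus> y) = \<phi> x \<oplus> \<phi> y"
      "\<And>x n. x \<in> carrier G \<Longrightarrow> \<phi> (sc n x) = sc n (\<phi> x)"
    and inf: "infinite (carrier A)"
    and fibre: "\<And>x t s. x \<in> carrier A \<Longrightarrow> |carrier A| <o |{\<eta> \<in> L. b \<eta> = (x, t, s)}|"
  shows "\<exists>a\<in>carrier A. \<forall>x\<in>carrier G. \<phi> x = act a x"
proof -
  define Z where "Z j n = {y \<in> carrier G. cf j n y \<in> A.pmult n}" for j n
  have Z: "submod (Z j n)" for j n unfolding Z_def by (rule submod_cf)
  have EZ: "act a (E i) \<in> Z j n" if "i \<noteq> j" "a \<in> carrier A" for i j n a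
    by (rule submod_act[OF Z that(2)]) (simp add: Z_def cf_E_other[OF that(1)])
  have coeff_zero: "a = \<zero>\<^bsub>A\<^esub>" if "a \<in> carrier A" "\<And>n. act a (E j) \<in> Z j n" for a j
    using A.pmult_separated[OF that(1)] act_E_cf[OF that(1)] that(2) by (simp add: Z_def)
  have "\<exists>a\<in>carrier A. \<phi> (E s) = act a (E s)" for s
  proof -
    have "\<exists>c\<in>carrier A. \<phi> (bvec (\<zero>\<^bsub>A\<^esub>, Suc s, s)) = act c (bvec (\<zero>\<^bsub>A\<^esub>, Suc s, s))"
      by (rule scalar_on_bvec[OF \<phi> inf]) (use fibre in auto)
    then show ?thesis by (simp add: bvec_def)
  qed
  then obtain \<alpha> where \<alpha>: "\<And>s. \<alpha> s \<in> carrier A" "\<And>s. \<phi> (E s) = act (\<alpha> s) (E s)" by metis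
  have mult: "\<exists>c\<in>carrier A. \<phi> (act x (E t)) = act (c \<otimes>\<^bsub>A\<^esub> x) (E t) \<oplus> act (c \<ominus>\<^bsub>A\<^esub> \<alpha> s) (E s)"
    if x: "x \<in> carrier A" and ts: "t \<noteq> s" for x t s
  proof -
    obtain c where c: "c \<in> carrier A" "\<phi> (bvec (x, t, s)) = act c (bvec (x, t, s))"
      using scalar_on_bvec[OF \<phi> inf x ts fibre[OF x]] by blast
    have "\<phi> (act x (E t)) \<oplus> act (\<alpha> s) (E s) = act (c \<otimes>\<^bsub>A\<^esub> x) (E t) \<oplus> act c (E s)"
      using c x \<phi>(2) by (simp add: bvec_def \<alpha> G.act_add_right G.act_mult)
    then have "\<phi> (act x (E t)) = (act (c \<otimes>\<^bsub>A\<^esub> x) (E t) \<oplus> act c (E s)) \<oplus> \<ominus> act (\<alpha> s) (E s)"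
      using c(1) x \<phi>(1) \<alpha>(1)
        by (simp add: G.M.a_assoc G.M.r_neg flip: \<open>\<phi> (act x (E t)) \<oplus> act (\<alpha> s) (E s) = _\<close>)
    also have "\<dots> = act (c \<otimes>\<^bsub>A\<^esub> x) (E t) \<oplus> act (c \<ominus>\<^bsub>A\<^esub> \<alpha> s) (E s)"
      using c(1) x \<alpha>(1) by (simp add: a_minus_def G.act_add_left act_neg_left G.M.a_assoc)
    finally show ?thesis using c(1) by blast
  qed
  have mult': "\<phi> (act x (E t)) = act (\<alpha> s \<otimes>\<^bsub>A\<^esub> x) (E t)" if x: "x \<in> carrier A"
    and ts: "t \<noteq> s" for x t s
  proof -
    obtain c where c: "c \<in> carrier A" "\<phi> (act x (E t)) = act (c \<otimes>\<^bsub>A\<^esub> x) (E t)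
        \<oplus> act (c \<ominus>\<^bsub>A\<^esub> \<alpha> s) (E s)"
      using mult[OF x ts] by blast
    \<comment> \<open>A third node: the expression obtained with \<open>s'\<close> has no coordinate
      at \<open>s\<close>, so the coefficient \<open>c \<ominus> \<alpha> s\<close> in the first
      expression must vanish.\<close>
    obtain s' where s': "s' \<noteq> t" "s' \<noteq> s" using infinite_UNIV_nat ex_new_if_finite[of "{t, s}"]
      by auto
    obtain c'
      where c': "c' \<in> carrier A" "\<phi> (act x (E t)) = act (c' \<otimes>\<^bsub>A\<^esub> x) (E t)
          \<oplus> act (c' \<ominus>\<^bsub>A\<^esub> \<alpha> s') (E s')"
      using mult[OF x s'(1)[symmetric]] by blast
    have "c \<ominus>\<^bsub>A\<^esub> \<alpha> s = \<zero>\<^bsub>A\<^esub>"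
    proof (rule coeff_zero)
      fix n
      have "\<phi> (act x (E t)) \<in> Z s n" unfolding c'(2)
        by (intro submod_add[OF Z] EZ) (use c'(1) x \<alpha>(1) ts s' in auto)
      then show "act (c \<ominus>\<^bsub>A\<^esub> \<alpha> s) (E s) \<in> Z s n" unfolding c(2)
        by (rule submod_cancel[OF Z EZ[OF ts], rotated]) (use c(1) x \<alpha>(1) in auto)
    qed (use c(1) \<alpha>(1) in simp)
    moreover from this have "c = \<alpha> s" using c(1) \<alpha>(1) by simp
    ultimately show ?thesis using c x by simp
  qed
  have \<alpha>_const: "\<alpha> t = \<alpha> s" if "t \<noteq> s" for s t
  proof -
    have "act (\<alpha> t) (E t) = act (\<alpha> s) (E t)"
      using mult'[of "\<one>\<^bsub>A\<^esub>" t s] that \<alpha> by (simp add: G.act_one)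
    then have "act (\<alpha> t \<ominus>\<^bsub>A\<^esub> \<alpha> s) (E t) = \<zero>"
      using \<alpha>(1) by (simp add: a_minus_def G.act_add_left act_neg_left G.M.r_neg)
    then have "\<alpha> t \<ominus>\<^bsub>A\<^esub> \<alpha> s = \<zero>\<^bsub>A\<^esub>" using coeff_zero[of "\<alpha> t \<ominus>\<^bsub>A\<^esub> \<alpha> s" t] submod_zero[OF Z] \<alpha>(1)
      by simp
    then show ?thesis using \<alpha>(1) by simp
  qed
  define a where "a = \<alpha> 0"
  have a: "a \<in> carrier A" by (simp add: a_def \<alpha>)
  have "\<alpha> s = a" for s using \<alpha>_const unfolding a_def by (cases "s = 0") auto
  then have onE: "\<phi> (act x (E t)) = act a (act x (E t))" if "x \<in> carrier A" for x t
    using mult'[OF that, of t "Suc t"] that a by (simp add: G.act_mult)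
  define \<psi> where "\<psi> x = \<phi> x \<ominus> act a x" for x
  have \<psi>_closed: "\<psi> x \<in> carrier G" if "x \<in> carrier G" for x using that \<phi>(1) a by (simp add: \<psi>_def)
  have \<psi>_add: "\<psi> (x \<oplus> y) = \<psi> x \<oplus> \<psi> y" if "x \<in> carrier G" "y \<in> carrier G" for x y
    using that \<phi>(1,2) a by (simp add: \<psi>_def a_minus_def G.act_add_right G.M.minus_add G.M.a_ac)
  have \<psi>_sc: "\<psi> (sc n x) = sc n (\<psi> x)" if "x \<in> carrier G" for n x
    using that \<phi>(1,3) a by (simp add: \<psi>_def act_diff sc_act)
  have \<psi>_E: "\<psi> (act x (E t)) = \<zero>" if "x \<in> carrier A" for x t
    using onE[OF that] that a by (simp add: \<psi>_def a_minus_def G.M.r_neg)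
  have \<psi>_bvec: "\<psi> (act c (bvec v)) = \<zero>" if "c \<in> carrier A" "fst v \<in> carrier A" for c v
  proof -
    obtain x t s where v: "v = (x, t, s)" by (cases v)
    have "act c (bvec v) = act (c \<otimes>\<^bsub>A\<^esub> x) (E t) \<oplus> act c (E s)"
      using that by (simp add: v bvec_def G.act_add_right G.act_mult)
    then show ?thesis using \<psi>_add \<psi>_E that v by simp
  qed
  \<comment> \<open>As \<open>\<psi>\<close> kills the nodes and the vectors, \<open>Y_step\<close>
    leaves only a multiple by at least one factor \<open>p\<close> of the next value. Repeating this
    makes the value divisible by every power of \<open>p\<close>.\<close>
  have \<psi>_Y: "\<psi> (act c (Y \<eta> n)) \<in> scaled N" if c: "c \<in> carrier A" and \<eta>: "\<eta> \<in> L" for c \<eta> n N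
  proof (induction N arbitrary: n)
    case 0
    have "\<psi> (act c (Y \<eta> n)) = sc 0 (\<psi> (act c (Y \<eta> n)))" using \<psi>_closed c \<eta> by (simp add: G.act_one)
    then show ?case using scaledI \<psi>_closed c \<eta> by (metis G.act_closed Y_closed)
  next
    case (Suc N)
    let ?g = "level_pos (Suc n) - level_pos n" and ?e = "node_pos (nd \<eta> (Suc n)) - level_pos n"
    have bv: "bvec (b \<eta>) \<in> carrier G" using b_closed[OF \<eta>] by simp
    have "act c (Y \<eta> n) = act c (E (nd \<eta> n)) \<oplus> (act (c \<otimes>\<^bsub>A\<^esub> pw ?e) (bvec (b \<eta>))
        \<oplus> sc ?g (act c (Y \<eta> (Suc n))))"
      by (subst Y_step[OF \<eta>, of n]) (use c \<eta> bv in \<open>simp add: G.act_add_right G.act_mult sc_act\<close>)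
    then have "\<psi> (act c (Y \<eta> n)) = sc ?g (\<psi> (act c (Y \<eta> (Suc n))))"
      using c \<eta> bv b_closed[OF \<eta>] by (simp add: \<psi>_add \<psi>_E \<psi>_bvec \<psi>_sc \<psi>_closed)
    moreover obtain y where y: "y \<in> carrier G" "\<psi> (act c (Y \<eta> (Suc n))) = sc N y"
      using Suc.IH[of "Suc n"] by (rule scaledE)
    ultimately have "\<psi> (act c (Y \<eta> n)) = sc (?g + N) y" by (simp add: sc_sc)
    moreover have "Suc N \<le> ?g + N" using level_pos_Suc[of n] by linarith
    ultimately show ?case using sc_in_scaled y(1) by simp
  qed
  have "\<psi> x = \<zero>" if x: "x \<in> carrier G" for x
  proof -
    have "x \<in> {x \<in> carrier G. \<psi> x = \<zero>}"
    proof (rule generated[OF x])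
      show "act c (Y \<eta> n) \<in> {x \<in> carrier G. \<psi> x = \<zero>}" if "c \<in> carrier A" "\<eta> \<in> L" for c \<eta> n
        using scaled_separated[OF \<psi>_closed \<psi>_Y[OF that]] that by simp
    qed (auto simp: \<psi>_E \<psi>_add)
    then show ?thesis by simp
  qed
  then have "\<phi> x = act a x" if "x \<in> carrier G" for x using that \<phi>(1) a by (simp add: \<psi>_def)
  then show ?thesis using a by blast
qed

end

section \<open>Countable submodules\<close>

context branch_module
begin

text \<open>A family congruent to the family \<open>E\<close> modulo \<open>p\<close> is independent: divide a relation by the
  highest power of \<open>p\<close> dividing all its coefficients and reduce modulo \<open>p\<close>.\<close>

lemma indep_if_cong_E:
  assumes u: "\<And>j. \<exists>y\<in>scaled 1. u j = E j \<oplus> y"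
  shows "indep_family A G (\<lambda>j a. act a (u j)) (UNIV :: nat set)"
proof -
  have uG: "u j \<in> carrier G" for j using u[of j] submod_closed[OF submod_scaled] by auto
  have zero: "c i = \<zero>\<^bsub>A\<^esub>"
    if S: "finite S" and c: "c \<in> S \<rightarrow> carrier A" and 0: "(\<Oplus>j\<in>S. act (c j) (u j)) = \<zero>" and i: "i \<in> S"
    for S and c :: "nat \<Rightarrow> 'a" and i
  proof -
    have cA: "c j \<in> carrier A" if "j \<in> S" for j using c that by blast
    have "\<forall>j\<in>S. c j \<in> A.pmult N" for N
    proof (induction N)
      case 0
      have "c j = pw 0 \<otimes>\<^bsub>A\<^esub> c j" if "j \<in> S" for j using cA[OF that] by simp
      then show ?case using A.pmultI[OF cA, of _ 0] by metis
    next
      case (Suc N)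
      then have "\<forall>j\<in>S. \<exists>d. d \<in> carrier A \<and> c j = pw N \<otimes>\<^bsub>A\<^esub> d" unfolding A.pmult_def by blast
      then obtain d where d: "\<And>j. j \<in> S \<Longrightarrow> d j \<in> carrier A" "\<And>j. j \<in> S \<Longrightarrow> c j = pw N \<otimes>\<^bsub>A\<^esub> d j"
        by metis
      have "sc N (\<Oplus>j\<in>S. act (d j) (u j)) = (\<Oplus>j\<in>S. sc N (act (d j) (u j)))"
        by (rule act_finsum) (use S d uG in auto)
      also have "\<dots> = (\<Oplus>j\<in>S. act (c j) (u j))"
        by (rule G.M.add.finprod_cong') (use d uG cA in \<open>auto simp: G.act_mult\<close>)
      also have "\<dots> = \<zero>" by (rule 0)
      finally have sc0: "sc N (\<Oplus>j\<in>S. act (d j) (u j)) = \<zero>" .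
      have "(\<Oplus>j\<in>S. act (d j) (u j)) \<in> carrier G"
        by (rule G.M.finsum_closed) (use d(1) uG in auto)
      from sc_cancel[OF this sc0] have d0: "(\<Oplus>j\<in>S. act (d j) (u j)) = \<zero>" .
      have "d i \<in> A.pmult 1" if i: "i \<in> S" for i
      proof -
        define Z where "Z = {y \<in> carrier G. cf i 1 y \<in> A.pmult 1}"
        have Z: "submod Z" unfolding Z_def by (rule submod_cf)
        have scZ: "y \<in> Z" if "y \<in> scaled 1" for y
          using cf_scaled[OF that] submod_closed[OF submod_scaled that] by (simp add: Z_def)
        have "act (d i) (u i) \<in> Z"
        proof (rule submod_single_term[OF Z S i])
          show "act (d k) (u k) \<in> carrier G" if "k \<in> S" for k using d(1)[OF that] uG by simp
          show "(\<Oplus>k\<in>S. act (d k) (u k)) \<in> Z" unfolding d0 by (rule submod_zero[OF Z])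
          fix k assume k: "k \<in> S" "k \<noteq> i"
          obtain y where y: "y \<in> scaled 1" "u k = E k \<oplus> y" using u by blast
          have "E k \<in> Z" using cf_E_other[OF k(2)] by (simp add: Z_def)
          then have "u k \<in> Z" unfolding y(2) using scZ[OF y(1)] by (rule submod_add[OF Z])
          then show "act (d k) (u k) \<in> Z" by (rule submod_act[OF Z d(1)[OF k(1)]])
        qed
        moreover obtain y where y: "y \<in> scaled 1" "u i = E i \<oplus> y" using u by blast
        have yG: "y \<in> carrier G" using submod_closed[OF submod_scaled y(1)] .
        have "act (d i) (u i) = act (d i) (E i) \<oplus> act (d i) y" unfolding y(2) using d(1)[OF i] yG
          by (simp add: G.act_add_right)
        moreover have "act (d i) y \<in> Z" by (rule submod_act[OF Z d(1)[OF i] scZ[OF y(1)]])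
        ultimately have "act (d i) (E i) \<in> Z"
          using submod_cancel'[OF Z, of "act (d i) y" "act (d i) (E i)"] d(1)[OF i] by simp
        then show ?thesis using act_E_cf[OF d(1)[OF i], of i 1] by (simp add: Z_def)
      qed
      then have "pw N \<otimes>\<^bsub>A\<^esub> d j \<in> A.pmult (N + 1)" if "j \<in> S" for j using A.pmult_pow that by blast
      then show ?case using d(2) by simp
    qed
    then show ?thesis using A.pmult_separated[OF cA[OF i]] i by blast
  qed
  show ?thesis
  proof unfold_locales
    fix S :: "nat set" and c :: "nat \<Rightarrow> 'a" and i
    assume "finite S" "c \<in> S \<rightarrow> carrier A" "(\<Oplus>j\<in>S. act (c j) (u j)) = \<zero>" "i \<in> S"
    then show "c i = \<zero>\<^bsub>A\<^esub>" by (rule zero)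
  qed (use uG in \<open>simp_all add: G.act_add_left\<close>)
qed

lemma Y_cong_E: assumes "\<eta> \<in> L" shows "\<exists>y\<in>scaled 1. Y \<eta> n = E (nd \<eta> n) \<oplus> y"
proof -
  have "1 \<le> node_pos (nd \<eta> (Suc n)) - level_pos n"
    using level_pos_less_node_pos[OF node_ge[of "Suc n" "sel \<eta>"]] by linarith
  moreover have "1 \<le> level_pos (Suc n) - level_pos n" using level_pos_Suc[of n] by linarith
  ultimately have "sc (node_pos (nd \<eta> (Suc n)) - level_pos n) (bvec (b \<eta>)) \<oplus>
      sc (level_pos (Suc n) - level_pos n) (Y \<eta> (Suc n)) \<in> scaled 1"
    using assms b_closed[OF assms] by (intro submod_add[OF submod_scaled] sc_in_scaled) auto
  then show ?thesis using Y_step[OF assms, of n] by blast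
qed

text \<open>Almost disjointness: countably many branches become disjoint after removing an initial segment
  from each of them. Replacing \<open>E j\<close> by \<open>Y \<eta> n\<close> for the nodes \<open>j = node \<eta> n\<close> on the tails then
  gives a basis.\<close>

lemma countable_basis:
  assumes X0: "countable X0" "X0 \<subseteq> L"
  obtains u :: "nat \<Rightarrow> 'g" where "\<And>j. \<exists>y\<in>scaled 1. u j = E j \<oplus> y"
    "\<And>W. submod W \<Longrightarrow> (\<And>j. u j \<in> W) \<Longrightarrow> (\<forall>j. E j \<in> W) \<and> (\<forall>\<eta>\<in>X0. \<forall>n. Y \<eta> n \<in> W)"
proof -
  let ?i = "to_nat_on X0"
  have inj: "inj_on ?i X0" using X0(1) by (rule inj_on_to_nat_on)
  \<comment> \<open>Each branch is compared only with the finitely many of smaller index, which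
    makes a starting level possible; of two branches, the one of larger index takes care of
    disjointness. The bounds on the nodes in \<open>b \<eta>\<close> put them below all nodes of the
    tail, as the later induction on nodes requires.\<close>
  have ev: "\<forall>\<^sub>F n in sequentially. fst (snd (b \<eta>)) < 2 ^ n \<and> snd (snd (b \<eta>)) < 2 ^ n \<and>
      (\<forall>\<zeta>\<in>{\<zeta> \<in> X0. ?i \<zeta> < ?i \<eta>}. nd \<eta> n \<noteq> nd \<zeta> n)" if \<eta>: "\<eta> \<in> X0" for \<eta>
  proof -
    have large: "\<forall>\<^sub>F l in sequentially. (m::nat) < 2 ^ l" for m
      unfolding eventually_sequentially
        by (meson less_exp less_le_trans one_le_numeral power_increasing)
    have "?i ` {\<zeta> \<in> X0. ?i \<zeta> < ?i \<eta>} \<subseteq> {..<?i \<eta>}" by auto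
    then have fin: "finite {\<zeta> \<in> X0. ?i \<zeta> < ?i \<eta>}"
      using finite_subset finite_lessThan finite_imageD[of ?i] inj_on_subset[OF inj]
        by (metis (no_types, lifting) mem_Collect_eq subsetI)
    have "\<forall>\<^sub>F n in sequentially. \<forall>\<zeta>\<in>{\<zeta> \<in> X0. ?i \<zeta> < ?i \<eta>}. nd \<eta> n \<noteq> nd \<zeta> n"
    proof (rule eventually_ball_finite[OF fin], rule ballI)
      fix \<zeta> assume "\<zeta> \<in> {\<zeta> \<in> X0. ?i \<zeta> < ?i \<eta>}"
      then have "\<zeta> \<in> L" "\<eta> \<in> L" "\<eta> \<noteq> \<zeta>" using X0(2) \<eta> by auto
      then show "\<forall>\<^sub>F n in sequentially. nd \<eta> n \<noteq> nd \<zeta> n" using eventually_nd_distinct by blast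
    qed
    then show ?thesis by (intro eventually_conj large)
  qed
  have "\<forall>\<eta>\<in>X0. \<exists>N. \<forall>n\<ge>N. fst (snd (b \<eta>)) < 2 ^ n \<and> snd (snd (b \<eta>)) < 2 ^ n \<and>
      (\<forall>\<zeta>\<in>{\<zeta> \<in> X0. ?i \<zeta> < ?i \<eta>}. nd \<eta> n \<noteq> nd \<zeta> n)"
    using ev unfolding eventually_sequentially by blast
  from bchoice[OF this] obtain st
    where st: "\<forall>\<eta>\<in>X0. \<forall>n\<ge>st \<eta>. fst (snd (b \<eta>)) < 2 ^ n \<and> snd (snd (b \<eta>)) < 2 ^ n \<and>
      (\<forall>\<zeta>\<in>{\<zeta> \<in> X0. ?i \<zeta> < ?i \<eta>}. nd \<eta> n \<noteq> nd \<zeta> n)" by (rule exE)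
  have disjoint: "\<eta> = \<zeta> \<and> n = m" if "\<eta> \<in> X0" "\<zeta> \<in> X0" "st \<eta> \<le> n" "st \<zeta> \<le> m" "nd \<eta> n = nd \<zeta> m"
    for \<eta> \<zeta> n m
  proof -
    have nm: "n = m" using that(5) by (rule node_level)
    have "\<not> ?i \<zeta> < ?i \<eta>" using st that nm by fastforce
    moreover have "\<not> ?i \<eta> < ?i \<zeta>" using st that nm by fastforce
    ultimately have "?i \<eta> = ?i \<zeta>" by simp
    then show ?thesis using nm inj_onD[OF inj] that(1,2) by blast
  qed
  define tail where "tail j \<eta> n \<longleftrightarrow> \<eta> \<in> X0 \<and> st \<eta> \<le> n \<and> j = nd \<eta> n" for j \<eta> n
  define u where "u j = (if \<exists>\<eta> n. tail j \<eta> n then (let (\<eta>, n)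
      = (SOME (\<eta>, n). tail j \<eta> n) in Y \<eta> n) else E j)" for j
  have u_tail: "u j = Y \<eta> n" if "tail j \<eta> n" for j \<eta> n
  proof -
    have "(SOME (\<eta>, n). tail j \<eta> n) = (\<eta>, n)"
    proof (rule some_equality)
      fix q assume q: "case q of (\<eta>, n) \<Rightarrow> tail j \<eta> n"
      obtain \<zeta> m where \<zeta>: "q = (\<zeta>, m)" by (cases q)
      then have "\<zeta> \<in> X0" "st \<zeta> \<le> m" "j = nd \<zeta> m" using q by (simp_all add: tail_def)
      moreover have "\<eta> \<in> X0" "st \<eta> \<le> n" "j = nd \<eta> n" using that by (simp_all add: tail_def)
      ultimately show "q = (\<eta>, n)" using disjoint[of \<zeta> \<eta> m n] \<zeta> by simp
    qed (use that in simp)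
    then show ?thesis using that unfolding u_def by auto
  qed
  have u_E: "u j = E j" if "\<not> (\<exists>\<eta> n. tail j \<eta> n)" for j
    unfolding u_def using that by (rule if_not_P)
  show thesis
  proof (rule that[of u])
    show "\<exists>y\<in>scaled 1. u j = E j \<oplus> y" for j
    proof (cases "\<exists>\<eta> n. tail j \<eta> n")
      case True
      then obtain \<eta> n where t: "tail j \<eta> n" by blast
      then have "\<eta> \<in> L" "j = nd \<eta> n" using X0(2) by (auto simp: tail_def)
      then show ?thesis using Y_cong_E[of \<eta> n] u_tail[OF t] by simp
    next
      case False
      then show ?thesis using u_E[OF False] submod_zero[OF submod_scaled, of 1]
        by (intro bexI[of _ "\<zero>"]) simp_all
    qed
  next
    fix W assume W: "submod W" and uW: "\<And>j. u j \<in> W"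
    have YW: "Y \<eta> n \<in> W" if "\<eta> \<in> X0" "st \<eta> \<le> n" for \<eta> n
      using uW[of "nd \<eta> n"] u_tail[of "nd \<eta> n" \<eta> n] that by (simp add: tail_def)
    have bW: "bvec (b \<eta>) \<in> W" if "\<eta> \<in> X0" "E (fst (snd (b \<eta>))) \<in> W" "E (snd (snd (b \<eta>))) \<in> W" for \<eta>
    proof -
      obtain x t s where v: "b \<eta> = (x, t, s)" by (cases "b \<eta>")
      have "x \<in> carrier A" using b_closed[of \<eta>] that(1) X0(2) v by auto
      then show ?thesis unfolding v bvec_def prod.case using that(2,3) v
        by (intro submod_add[OF W] submod_act[OF W]) auto
    qed
    \<comment> \<open>On a tail, \<open>Y_step\<close> expresses \<open>E j\<close> by two elements
      of the new family and by \<open>bvec (b \<eta>)\<close>, which involves only nodes smaller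
      than \<open>j\<close>.\<close>
    have EW: "E j \<in> W" for j
    proof (induction j rule: less_induct)
      case (less j)
      show ?case
      proof (cases "\<exists>\<eta> n. tail j \<eta> n")
        case True
        then obtain \<eta> n where t: "\<eta> \<in> X0" "st \<eta> \<le> n" "j = nd \<eta> n" by (auto simp: tail_def)
        have \<eta>: "\<eta> \<in> L" using t(1) X0(2) by blast
        have "fst (snd (b \<eta>)) < j" "snd (snd (b \<eta>)) < j"
          using st t(1,2) node_ge[of n "sel \<eta>"] unfolding t(3) by (meson less_le_trans)+
        then have "bvec (b \<eta>) \<in> W" using bW[OF t(1)] less by blast
        then have rest: "sc (node_pos (nd \<eta> (Suc n)) - level_pos n) (bvec (b \<eta>)) \<oplus>
          sc (level_pos (Suc n) - level_pos n) (Y \<eta> (Suc n)) \<in> W"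
          using YW[OF t(1), of "Suc n"] t(2) by (intro submod_add[OF W] submod_act[OF W]) auto
        have "E (nd \<eta> n) \<oplus> (sc (node_pos (nd \<eta> (Suc n)) - level_pos n) (bvec (b \<eta>)) \<oplus>
          sc (level_pos (Suc n) - level_pos n) (Y \<eta> (Suc n))) \<in> W"
          using YW[OF t(1,2)] unfolding Y_step[OF \<eta>, of n] .
        then show ?thesis unfolding t(3) by (rule submod_cancel'[OF W rest]) simp
      next
        case False
        then show ?thesis using uW[of j] u_E[OF False] by simp
      qed
    qed
    have "Y \<eta> n \<in> W" if "\<eta> \<in> X0" for \<eta> n
    proof (cases "st \<eta> \<le> n")
      case False
      then have "n \<le> st \<eta>" by simp
      then show ?thesis
      proof (induction n rule: inc_induct)
        case (step n)
        have \<eta>: "\<eta> \<in> L" using that X0(2) by blast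
        have "bvec (b \<eta>) \<in> W" using bW[OF that] EW by blast
        then show ?case unfolding Y_step[OF \<eta>, of n] using step.IH EW
          by (intro submod_add[OF W] submod_act[OF W]) auto
      qed (rule YW[OF that le_refl])
    qed (rule YW[OF that])
    then show "(\<forall>j. E j \<in> W) \<and> (\<forall>\<eta>\<in>X0. \<forall>n. Y \<eta> n \<in> W)" using EW by blast
  qed
qed

text \<open>The conclusion speaks of every submodule \<open>W\<close>, so that it applies directly
  to the span of the modified basis.\<close>

lemma finite_branch_support:
  assumes "x \<in> carrier G"
  obtains T where "finite T" "T \<subseteq> L"
    "\<And>W. submod W \<Longrightarrow> (\<And>j. E j \<in> W) \<Longrightarrow> (\<And>\<eta> n. \<eta> \<in> T \<Longrightarrow> Y \<eta> n \<in> W) \<Longrightarrow> x \<in> W"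
proof -
  obtain n where "x \<in> level_part n" using in_level_part assms by blast
  then obtain y z c g where x: "EF.represents c y" "YF.represents n g z" "x = y \<oplus> z"
    by (rule level_partE)
  obtain S where S: "finite S" "\<forall>j. c j \<in> carrier A" "y = (\<Oplus>j\<in>S. act (c j) (E j))"
    using x(1) unfolding EF.represents_def by blast
  obtain T where T: "finite T" "T \<subseteq> L" "\<forall>j. g j \<in> carrier A" "z = (\<Oplus>\<eta>\<in>T. act (g \<eta>) (Y \<eta> n))"
    using x(2) unfolding YF.represents_def by blast
  show thesis
  proof (rule that[OF T(1,2)])
    fix W assume W: "submod W" "\<And>j. E j \<in> W" "\<And>\<eta> n. \<eta> \<in> T \<Longrightarrow> Y \<eta> n \<in> W"
    have "y \<in> W" unfolding S(3)
      by (rule submod_finsum[OF W(1) S(1)]) (use submod_act[OF W(1)] S(2) W(2) in blast)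
    moreover have "z \<in> W" unfolding T(4)
      by (rule submod_finsum[OF W(1) T(1)]) (use submod_act[OF W(1)] T(3) W(3) in blast)
    ultimately show "x \<in> W" unfolding x(3) by (rule submod_add[OF W(1)])
  qed
qed

text \<open>\<open>H\<close> is enlarged to an \<open>A\<close>-submodule \<open>V\<close> with a
  countable \<open>A\<close>-basis: each element of \<open>H\<close> involves finitely many
  branches, all nodes are kept, and \<open>countable_basis\<close> is applied to the branches
  collected. \<open>V\<close> itself may be uncountable.\<close>

lemma countable_coordinates:
  assumes H: "countable H" "H \<subseteq> carrier G"
  obtains co :: "nat \<Rightarrow> 'g \<Rightarrow> 'a" and V where "submod V" "H \<subseteq> V" "\<And>j x. x \<in> V \<Longrightarrow> co j x \<in> carrier A"
    "\<And>j x y. x \<in> V \<Longrightarrow> y \<in> V \<Longrightarrow> co j (x \<oplus> y) = co j x \<oplus>\<^bsub>A\<^esub> co j y"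
    "\<And>j a x. a \<in> carrier A \<Longrightarrow> x \<in> V \<Longrightarrow> co j (act a x) = a \<otimes>\<^bsub>A\<^esub> co j x"
    "\<And>x. x \<in> V \<Longrightarrow> finite {j. co j x \<noteq> \<zero>\<^bsub>A\<^esub>}"
    "\<And>x. x \<in> V \<Longrightarrow> (\<And>j. co j x = \<zero>\<^bsub>A\<^esub>) \<Longrightarrow> x = \<zero>"
proof -
  have "\<forall>x\<in>H. \<exists>T. finite T \<and> T \<subseteq> L \<and>
    (\<forall>W. submod W \<longrightarrow> (\<forall>j. E j \<in> W) \<longrightarrow> (\<forall>\<eta> n. \<eta> \<in> T \<longrightarrow> Y \<eta> n \<in> W) \<longrightarrow> x \<in> W)"
    using finite_branch_support H(2) by (smt (verit, best) subsetD)
  then obtain T where T: "\<forall>x\<in>H. finite (T x) \<and> T x \<subseteq> L \<and>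
    (\<forall>W. submod W \<longrightarrow> (\<forall>j. E j \<in> W) \<longrightarrow> (\<forall>\<eta> n. \<eta> \<in> T x \<longrightarrow> Y \<eta> n \<in> W) \<longrightarrow> x \<in> W)" by metis
  define X0 where "X0 = (\<Union>x\<in>H. T x)"
  have X0: "countable X0" "X0 \<subseteq> L" unfolding X0_def using H(1) T by (auto intro: countable_finite)
  obtain u where u: "\<And>j. \<exists>y\<in>scaled 1. u j = E j \<oplus> y"
    "\<And>W. submod W \<Longrightarrow> (\<And>j. u j \<in> W) \<Longrightarrow> (\<forall>j. E j \<in> W) \<and> (\<forall>\<eta>\<in>X0. \<forall>n. Y \<eta> n \<in> W)"
    using countable_basis[OF X0] by blast
  interpret F: indep_family A G "\<lambda>j a. act a (u j)" "UNIV :: nat set"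
    by (rule indep_if_cong_E[OF u(1)])
  have uG: "u j \<in> carrier G" for j using u(1)[of j] submod_closed[OF submod_scaled] by auto
  define V where "V = {x. \<exists>c. F.represents c x}"
  have act_rep: "F.represents (\<lambda>j. a \<otimes>\<^bsub>A\<^esub> c j) (act a x)" if "a \<in> carrier A" "F.represents c x"
    for a c x
    by (rule F.represents_map[OF that(2)]) (use that(1) uG in \<open>simp_all add: G.act_add_right G.act_mult\<close>)
  have V: "submod V" unfolding submod_def
  proof (intro conjI ballI)
    show "V \<subseteq> carrier G" unfolding V_def using F.represents_closed by blast
    have uV: "u j \<in> V" for j
      using F.represents_single[of j "\<one>\<^bsub>A\<^esub>"] G.act_one[OF uG] unfolding V_def by auto
    then show "V \<noteq> {}" by blast
    fix x assume "x \<in> V"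
    then obtain c where c: "F.represents c x" unfolding V_def by blast
    show "act a x \<in> V" if "a \<in> carrier A" for a using act_rep[OF that c] unfolding V_def by blast
    fix y assume "y \<in> V"
    then obtain d where d: "F.represents d y" unfolding V_def by blast
    show "x \<oplus> y \<in> V" using F.represents_add[OF c d] unfolding V_def by blast
  qed
  have uV: "u j \<in> V" for j
    using F.represents_single[of j "\<one>\<^bsub>A\<^esub>"] G.act_one[OF uG] unfolding V_def by auto
  have EY: "(\<forall>j. E j \<in> V) \<and> (\<forall>\<eta>\<in>X0. \<forall>n. Y \<eta> n \<in> V)" by (rule u(2)[OF V uV])
  have HV: "H \<subseteq> V"
  proof
    fix x assume x: "x \<in> H"
    then have "T x \<subseteq> X0" by (auto simp: X0_def)
    then show "x \<in> V" using T x V EY by blast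
  qed
  show thesis
  proof (rule that[of V F.coord, OF V HV])
    fix j x assume "x \<in> V"
    then obtain c where c: "F.represents c x" unfolding V_def by blast
    show "F.coord j x \<in> carrier A" unfolding F.coord_eq[OF c] using c unfolding F.represents_def
      by blast
  next
    fix j x y assume "x \<in> V" "y \<in> V"
    then obtain c d where c: "F.represents c x" and d: "F.represents d y" unfolding V_def by blast
    show "F.coord j (x \<oplus> y) = F.coord j x \<oplus>\<^bsub>A\<^esub> F.coord j y"
      unfolding F.coord_eq[OF c] F.coord_eq[OF d] F.coord_eq[OF F.represents_add[OF c d]] ..
  next
    fix j a x assume a: "a \<in> carrier A" and "x \<in> V"
    then obtain c where c: "F.represents c x" unfolding V_def by blast
    show "F.coord j (act a x) = a \<otimes>\<^bsub>A\<^esub> F.coord j x"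
      unfolding F.coord_eq[OF c] F.coord_eq[OF act_rep[OF a c]] ..
  next
    fix x assume "x \<in> V"
    then obtain c where c: "F.represents c x" unfolding V_def by blast
    then obtain S where S: "finite S" "\<And>j. j \<notin> S \<Longrightarrow> c j = \<zero>\<^bsub>A\<^esub>" unfolding F.represents_def by blast
    have "finite {j. c j \<noteq> \<zero>\<^bsub>A\<^esub>}" by (rule finite_subset[OF _ S(1)]) (use S(2) in auto)
    then show "finite {j. F.coord j x \<noteq> \<zero>\<^bsub>A\<^esub>}" unfolding F.coord_eq[OF c] .
  next
    fix x assume "x \<in> V" and 0: "\<And>j. F.coord j x = \<zero>\<^bsub>A\<^esub>"
    then obtain c where c: "F.represents c x" unfolding V_def by blast
    have c0: "c j = \<zero>\<^bsub>A\<^esub>" for j using 0[of j] unfolding F.coord_eq[OF c] .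
    obtain S where S: "finite S" "x = (\<Oplus>j\<in>S. act (c j) (u j))" using c unfolding F.represents_def
      by blast
    show "x = \<zero>" unfolding S(2) by (rule G.M.add.finprod_one_eqI) (use c0 uG in simp)
  qed
qed

end

text \<open>Composing the \<open>A\<close>-coordinates on \<open>V\<close> with the
  \<open>R\<close>-coordinates on \<open>A\<close> gives finitely supported
  \<open>R\<close>-coordinates indexed by pairs. \<open>A\<close> may have uncountable rank, but the
  elements of the countable set \<open>H\<close> have nonzero coordinates at only countably many
  pairs. Enumerating these pairs by natural numbers makes \<open>free_module_if_coordinates\<close>
  applicable.\<close>

lemma aleph1_free_branch_module:
  fixes R :: "('r, 'x) ring_scheme" and A :: "('r, 'a, 'y) module_scheme"
    and G :: "('r, 'g, 'z) module_scheme"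
  assumes B: "branch_module A p G act L sel b E Y cf" and PID: "principal_domain R"
    and A: "assoc_algebra R A" and free: "free_module R A" and G: "module R G"
    and smult: "\<And>r x. r \<in> carrier R \<Longrightarrow> x \<in> carrier G \<Longrightarrow> r \<odot>\<^bsub>G\<^esub> x = act (r \<odot>\<^bsub>A\<^esub> \<one>\<^bsub>A\<^esub>) x"
  shows "aleph1_free_module R G"
proof -
  interpret B: branch_module A p G act L sel b E Y cf "\<lambda>(x, t, s). act x (E t) \<oplus>\<^bsub>G\<^esub> E s"
    by (rule B)
  interpret A: assoc_algebra R A by (rule A)
  interpret Gm: module R G by (rule G)
  interpret FA: free_module R A by (rule free)
  obtain ca :: "'a \<Rightarrow> 'a \<Rightarrow> 'r" where ca:
    "\<And>\<beta> a. a \<in> carrier A \<Longrightarrow> ca \<beta> a \<in> carrier R"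
    "\<And>\<beta> a a'. a \<in> carrier A \<Longrightarrow> a' \<in> carrier A \<Longrightarrow> ca \<beta> (a \<oplus>\<^bsub>A\<^esub> a') = ca \<beta> a \<oplus>\<^bsub>R\<^esub> ca \<beta> a'"
    "\<And>\<beta> r a. r \<in> carrier R \<Longrightarrow> a \<in> carrier A \<Longrightarrow> ca \<beta> (r \<odot>\<^bsub>A\<^esub> a) = r \<otimes>\<^bsub>R\<^esub> ca \<beta> a"
    "\<And>a. a \<in> carrier A \<Longrightarrow> finite {\<beta>. ca \<beta> a \<noteq> \<zero>\<^bsub>R\<^esub>}"
    "\<And>a. a \<in> carrier A \<Longrightarrow> (\<And>\<beta>. ca \<beta> a = \<zero>\<^bsub>R\<^esub>) \<Longrightarrow> a = \<zero>\<^bsub>A\<^esub>"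
    by (rule FA.coordinates) blast
  show ?thesis
  proof (intro aleph1_free_module.intro aleph1_free_module_axioms.intro G)
    fix H assume H: "Module.submodule H R G" and cH: "countable H"
    interpret H: Module.submodule H R G by (rule H)
    have HG: "H \<subseteq> carrier G" using H.subset by simp
    have mod: "module R (G\<lparr>carrier := H\<rparr>)" by (rule H.submodule_is_module[OF G])
    obtain co V where V: "B.submod V" "H \<subseteq> V" "\<And>j x. x \<in> V \<Longrightarrow> co j x \<in> carrier A"
      "\<And>j x y. x \<in> V \<Longrightarrow> y \<in> V \<Longrightarrow> co j (x \<oplus>\<^bsub>G\<^esub> y) = co j x \<oplus>\<^bsub>A\<^esub> co j y"
      "\<And>j a x. a \<in> carrier A \<Longrightarrow> x \<in> V \<Longrightarrow> co j (act a x) = a \<otimes>\<^bsub>A\<^esub> co j x"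
      "\<And>x. x \<in> V \<Longrightarrow> finite {j::nat. co j x \<noteq> \<zero>\<^bsub>A\<^esub>}"
      "\<And>x. x \<in> V \<Longrightarrow> (\<And>j. co j x = \<zero>\<^bsub>A\<^esub>) \<Longrightarrow> x = \<zero>\<^bsub>G\<^esub>"
      by (rule B.countable_coordinates[OF cH HG]) blast
    have co: "co j x \<in> carrier A" if "x \<in> H" for j x using V(2,3) that by blast
    have ca0: "ca \<beta> \<zero>\<^bsub>A\<^esub> = \<zero>\<^bsub>R\<^esub>" for \<beta>
      using ca(3)[of "\<zero>\<^bsub>R\<^esub>" "\<zero>\<^bsub>A\<^esub>" \<beta>] ca(1)[of "\<zero>\<^bsub>A\<^esub>" \<beta>] by simp
    define supp where "supp x = {(j, \<beta>). ca \<beta> (co j x) \<noteq> \<zero>\<^bsub>R\<^esub>}" for x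
    have fin: "finite (supp x)" if x: "x \<in> H" for x
    proof -
      have "supp x \<subseteq> (SIGMA j:{j. co j x \<noteq> \<zero>\<^bsub>A\<^esub>}. {\<beta>. ca \<beta> (co j x) \<noteq> \<zero>\<^bsub>R\<^esub>})"
        using ca0 by (auto simp: supp_def)
      moreover have "finite \<dots>" using V(6)[of x] V(2) x ca(4) co by (intro finite_SigmaI) auto
      ultimately show ?thesis by (rule finite_subset)
    qed
    define C where "C = (\<Union>x\<in>H. supp x)"
    have C: "countable C" unfolding C_def using cH fin by (auto intro: countable_finite)
    define \<theta> where "\<theta> k x = (if k \<in> to_nat_on C ` C then ca (snd (from_nat_into C k)) (co (fst (from_nat_into C k)) x) else \<zero>\<^bsub>R\<^esub>)" for k x
    have \<theta>: "\<theta> (to_nat_on C q) x = ca (snd q) (co (fst q) x)" if "q \<in> C" for q x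
      using that C by (simp add: \<theta>_def)
    show "free_module R (G\<lparr>carrier := H\<rparr>)"
    proof (rule module.free_module_if_coordinates[OF mod PID, of \<theta>])
      show "\<theta> k x \<in> carrier R" if "x \<in> carrier (G\<lparr>carrier := H\<rparr>)" for k x
        using that ca(1) co by (simp add: \<theta>_def)
      show "\<theta> k (x \<oplus>\<^bsub>G\<lparr>carrier := H\<rparr>\<^esub> y) = \<theta> k x \<oplus>\<^bsub>R\<^esub> \<theta> k y"
        if "x \<in> carrier (G\<lparr>carrier := H\<rparr>)" "y \<in> carrier (G\<lparr>carrier := H\<rparr>)" for k x y
        using that V(2,4) ca(2) co by (simp add: \<theta>_def subset_iff)
      show "\<theta> k (r \<odot>\<^bsub>G\<lparr>carrier := H\<rparr>\<^esub> x) = r \<otimes>\<^bsub>R\<^esub> \<theta> k x"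
        if "r \<in> carrier R" "x \<in> carrier (G\<lparr>carrier := H\<rparr>)" for k r x
      proof -
        have x: "x \<in> H" "x \<in> V" "x \<in> carrier G" using that V(2) HG by auto
        have r1: "r \<odot>\<^bsub>A\<^esub> \<one>\<^bsub>A\<^esub> \<in> carrier A" using that(1) by simp
        have "co j (r \<odot>\<^bsub>G\<^esub> x) = r \<odot>\<^bsub>A\<^esub> co j x" for j
          using smult[OF that(1) x(3)] V(5)[OF r1 x(2), of j] A.smult_mult_left[OF that(1) _ co[OF x(1), of j], of "\<one>\<^bsub>A\<^esub>"] co[OF x(1), of j]
          by simp
        then show ?thesis using ca(3)[OF that(1)] co[OF x(1)] that(1) by (simp add: \<theta>_def)
      qed
      show "finite {k. \<theta> k x \<noteq> \<zero>\<^bsub>R\<^esub>}" if "x \<in> carrier (G\<lparr>carrier := H\<rparr>)" for x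
      proof (rule finite_subset)
        show "{k. \<theta> k x \<noteq> \<zero>\<^bsub>R\<^esub>} \<subseteq> to_nat_on C ` supp x"
        proof
          fix k assume k: "k \<in> {k. \<theta> k x \<noteq> \<zero>\<^bsub>R\<^esub>}"
          then have "k \<in> to_nat_on C ` C" unfolding \<theta>_def by (auto split: if_splits)
          then obtain q where q: "q \<in> C" "k = to_nat_on C q" by blast
          then have "q \<in> supp x" using k \<theta>[OF q(1)] by (cases q) (simp add: supp_def)
          then show "k \<in> to_nat_on C ` supp x" using q(2) by blast
        qed
        show "finite (to_nat_on C ` supp x)" using fin that by simp
      qed
      show "x = \<zero>\<^bsub>G\<lparr>carrier := H\<rparr>\<^esub>" if "x \<in> carrier (G\<lparr>carrier := H\<rparr>)"
        and 0: "\<And>k. \<theta> k x = \<zero>\<^bsub>R\<^esub>" for x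
      proof -
        have x: "x \<in> H" using that(1) by simp
        have "co j x = \<zero>\<^bsub>A\<^esub>" for j
        proof (rule ca(5)[OF co[OF x]])
          fix \<beta>
          show "ca \<beta> (co j x) = \<zero>\<^bsub>R\<^esub>"
          proof (rule ccontr)
            assume "ca \<beta> (co j x) \<noteq> \<zero>\<^bsub>R\<^esub>"
            then have "(j, \<beta>) \<in> supp x" by (simp add: supp_def)
            then have "(j, \<beta>) \<in> C" using x unfolding C_def by blast
            then show False using \<theta>[of "(j, \<beta>)" x] 0 \<open>ca \<beta> (co j x) \<noteq> \<zero>\<^bsub>R\<^esub>\<close> by simp
          qed
        qed
        then show ?thesis using V(7)[of x] V(2) x by auto
      qed
    qed
  qed
qed

section \<open>Construction inside the completion\<close>

text \<open>Gives the lower bound for the cardinality of \<open>G\<close>. At a node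
  \<open>j\<close> of level \<open>m\<close> on \<open>\<eta>\<close> but not on
  \<open>\<eta>'\<close>, beyond the nodes in both vectors, the coordinate of
  \<open>p ^ level_pos 0\<close> times the branch element is \<open>p ^ level_pos m\<close> for
  \<open>\<eta>\<close> and zero for \<open>\<eta>'\<close>, modulo \<open>p ^ N\<close>.\<close>

lemma (in branch_module) inj_Y: "inj_on (\<lambda>\<eta>. Y \<eta> 0) L"
proof (rule inj_onI, rule ccontr)
  fix \<eta> \<eta>' assume \<eta>: "\<eta> \<in> L" "\<eta>' \<in> L" "Y \<eta> 0 = Y \<eta>' 0" "\<eta> \<noteq> \<eta>'"
  have large: "\<forall>\<^sub>F l in sequentially. (m::nat) < 2 ^ l" for m
    unfolding eventually_sequentially
      by (meson less_exp less_le_trans one_le_numeral power_increasing)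
  obtain k where k: "\<one>\<^bsub>A\<^esub> \<notin> A.pmult k" using A.pmult_separated[OF A.one_closed] nontrivial by blast
  have "\<forall>\<^sub>F m in sequentially. nd \<eta> m \<noteq> nd \<eta>' m \<and> k < 2 ^ m \<and> fst (snd (b \<eta>)) < 2 ^ m
      \<and> snd (snd (b \<eta>)) < 2 ^ m
     \<and> fst (snd (b \<eta>')) < 2 ^ m \<and> snd (snd (b \<eta>')) < 2 ^ m"
    by (intro eventually_conj large eventually_nd_distinct \<eta>)
  then obtain m
    where m: "nd \<eta> m \<noteq> nd \<eta>' m" "k < 2 ^ m" "fst (snd (b \<eta>)) < 2 ^ m" "snd (snd (b \<eta>)) < 2 ^ m"
     "fst (snd (b \<eta>')) < 2 ^ m" "snd (snd (b \<eta>')) < 2 ^ m" unfolding eventually_sequentially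
       by blast
  define j where "j = nd \<eta> m"
  define N where "N = level_pos m + k"
  define Z where "Z = {x \<in> carrier G. cf j N x \<in> A.pmult N}"
  have Z: "submod Z" unfolding Z_def by (rule submod_cf)
  have j: "2 ^ m \<le> j" unfolding j_def by (rule node_ge)
  have EZ: "E i \<in> Z" if "i \<noteq> j" for i using cf_E_other[OF that] by (simp add: Z_def)
  have bZ: "bvec (b \<xi>) \<in> Z" if "\<xi> \<in> L" "fst (snd (b \<xi>)) < 2 ^ m" "snd (snd (b \<xi>)) < 2 ^ m" for \<xi>
    using cf_bvec[of "b \<xi>" j N] b_closed[OF that(1)] that(2,3) j by (simp add: Z_def)
  have top: "sc (level_pos (Suc m)) (Y \<xi> (Suc m)) \<in> Z" if "\<xi> \<in> L" for \<xi>
  proof -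
    have "N \<le> level_pos (Suc m)" using level_pos_Suc[of m] m(2) by (simp add: N_def)
    then have "sc (level_pos (Suc m)) (Y \<xi> (Suc m)) \<in> scaled N" using that
      by (intro sc_in_scaled) auto
    then show ?thesis using cf_scaled that by (simp add: Z_def)
  qed
  \<comment> \<open>In coordinate \<open>j\<close> only the tree term of level \<open>m\<close> can
    survive: other levels have other nodes, the vectors avoid \<open>j\<close>, and the rest is
    divisible by \<open>p ^ N\<close>.\<close>
  have iff: "sc (level_pos n) (Y \<xi> n) \<in> Z \<longleftrightarrow> sc (level_pos m) (E (nd \<xi> m)) \<in> Z"
    if \<xi>: "\<xi> \<in> L" "fst (snd (b \<xi>)) < 2 ^ m" "snd (snd (b \<xi>)) < 2 ^ m" and "n \<le> m" for \<xi> n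
    using \<open>n \<le> m\<close>
  proof (induction n rule: inc_induct)
    case base
    have "sc (node_pos (nd \<xi> (Suc m))) (bvec (b \<xi>)) \<oplus> sc (level_pos (Suc m)) (Y \<xi> (Suc m)) \<in> Z"
      by (rule submod_add[OF Z submod_act[OF Z _ bZ[OF \<xi>]] top[OF \<xi>(1)]]) simp
    then show ?case unfolding Y_step_scaled[OF \<xi>(1), of m]
      using submod_cancel'[OF Z, of _ "sc (level_pos m) (E (nd \<xi> m))"] submod_add[OF Z]
        by (meson E_closed act_cl pw_closed)
  next
    case (step n)
    have "nd \<xi> n \<noteq> j" unfolding j_def using node_level step.hyps by (metis less_irrefl)
    then have e: "sc (level_pos n) (E (nd \<xi> n)) \<in> Z" using EZ submod_act[OF Z] by simp
    have v: "sc (node_pos (nd \<xi> (Suc n))) (bvec (b \<xi>)) \<in> Z"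
      by (rule submod_act[OF Z _ bZ[OF \<xi>]]) simp
    have y: "sc (level_pos (Suc n)) (Y \<xi> (Suc n)) \<in> carrier G" using \<xi>(1) by simp
    have "sc (level_pos n) (Y \<xi> n) \<in> Z \<longleftrightarrow> sc (level_pos (Suc n)) (Y \<xi> (Suc n)) \<in> Z"
    proof
      assume "sc (level_pos n) (Y \<xi> n) \<in> Z"
      then have "sc (node_pos (nd \<xi> (Suc n))) (bvec (b \<xi>)) \<oplus> sc (level_pos (Suc n)) (Y \<xi> (Suc n))
          \<in> Z"
        unfolding Y_step_scaled[OF \<xi>(1), of n]
          by (rule submod_cancel[OF Z e]) (use y v submod_closed[OF Z] in simp)
      then show "sc (level_pos (Suc n)) (Y \<xi> (Suc n)) \<in> Z" by (rule submod_cancel[OF Z v _ y])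
    next
      assume "sc (level_pos (Suc n)) (Y \<xi> (Suc n)) \<in> Z"
      then show "sc (level_pos n) (Y \<xi> n) \<in> Z"
        unfolding Y_step_scaled[OF \<xi>(1), of n] by (intro submod_add[OF Z e] submod_add[OF Z v])
    qed
    then show ?case using step.IH by simp
  qed
  have "sc (level_pos m) (E (nd \<eta>' m)) \<in> Z" using EZ[of "nd \<eta>' m"] m(1) submod_act[OF Z]
    by (simp add: j_def)
  then have "sc (level_pos 0) (Y \<eta>' 0) \<in> Z" using iff[OF \<eta>(2) m(5,6), of 0] by simp
  then have "sc (level_pos m) (E j) \<in> Z" using iff[OF \<eta>(1) m(3,4), of 0] \<eta>(3) by (simp add: j_def)
  then have "pw (level_pos m) \<in> A.pmult N" using act_E_cf[of "pw (level_pos m)" j N]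
    by (simp add: Z_def)
  then have "pw (level_pos m) \<otimes>\<^bsub>A\<^esub> \<one>\<^bsub>A\<^esub> \<in> A.pmult (level_pos m + k)" by (simp add: N_def)
  then show False using A.pmult_cancel[OF A.one_closed] k by blast
qed

text \<open>Elements of the \<open>p\<close>-adic completion of the direct sum of copies of \<open>A\<close> indexed by the nodes are
  represented by coherent families \<open>v j n\<close> of approximations of the \<open>j\<close>-th coordinate modulo \<open>p ^ n\<close>.\<close>

locale branch_data = central_element A p
  for A :: "('a, 'x) ring_scheme" (structure) and p +
  fixes L :: "'l set" and sel :: "'l \<Rightarrow> nat set" and b :: "'l \<Rightarrow> 'a \<times> nat \<times> nat"
  assumes nontrivial: "\<one> \<noteq> \<zero>"
    and sel_inj: "inj_on sel L"
    and b_closed: "\<eta> \<in> L \<Longrightarrow> fst (b \<eta>) \<in> carrier A"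
begin

definition coherent :: "(nat \<Rightarrow> nat \<Rightarrow> 'a) set" where
  "coherent = {v. \<forall>j n. v j n \<in> carrier A \<and> v j (Suc n) \<ominus> v j n \<in> pmult n}"

definition vadd :: "(nat \<Rightarrow> nat \<Rightarrow> 'a) \<Rightarrow> (nat \<Rightarrow> nat \<Rightarrow> 'a) \<Rightarrow> nat \<Rightarrow> nat \<Rightarrow> 'a" where
  "vadd v w = (\<lambda>j n. v j n \<oplus> w j n)"

definition vact :: "'a \<Rightarrow> (nat \<Rightarrow> nat \<Rightarrow> 'a) \<Rightarrow> nat \<Rightarrow> nat \<Rightarrow> 'a" where
  "vact a v = (\<lambda>j n. a \<otimes> v j n)"

text \<open>Equality of the limits in the completion.\<close>

definition vequiv :: "(nat \<Rightarrow> nat \<Rightarrow> 'a) \<Rightarrow> (nat \<Rightarrow> nat \<Rightarrow> 'a) \<Rightarrow> bool" where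
  "vequiv v w \<longleftrightarrow> (\<forall>j n. v j n \<ominus> w j n \<in> pmult n)"

definition vE :: "nat \<Rightarrow> nat \<Rightarrow> nat \<Rightarrow> 'a" where
  "vE i = (\<lambda>j n. if i = j then \<one> else \<zero>)"

definition vb :: "'a \<times> nat \<times> nat \<Rightarrow> nat \<Rightarrow> nat \<Rightarrow> 'a" where
  "vb = (\<lambda>(x, t, s). vadd (vact x (vE t)) (vE s))"

text \<open>The sum of the first \<open>k\<close> terms of the series for \<open>Y \<eta> n\<close>.
  Each level shifts by at least one factor \<open>p\<close>, so the remainder is divisible by
  \<open>p ^ k\<close> and this partial sum may serve as the approximation modulo
  \<open>p ^ k\<close>.\<close>

primrec approx :: "nat \<Rightarrow> 'l \<Rightarrow> nat \<Rightarrow> nat \<Rightarrow> 'a" where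
  "approx 0 \<eta> n j = \<zero>"
| "approx (Suc k) \<eta> n j = vE (node (sel \<eta>) n) j k \<oplus>
    (p [^] (node_pos (node (sel \<eta>) (Suc n)) - level_pos n) \<otimes> vb (b \<eta>) j k \<oplus>
     p [^] (level_pos (Suc n) - level_pos n) \<otimes> approx k \<eta> (Suc n) j)"

definition vY :: "'l \<Rightarrow> nat \<Rightarrow> nat \<Rightarrow> nat \<Rightarrow> 'a" where
  "vY \<eta> n = (\<lambda>j k. approx k \<eta> n j)"

lemma coherentD: "v \<in> coherent \<Longrightarrow> v j n \<in> carrier A" "v \<in> coherent \<Longrightarrow> v j (Suc n) \<ominus> v j n \<in> pmult n"
  by (simp_all add: coherent_def)

lemma minus_self: "x \<in> carrier A \<Longrightarrow> x \<ominus> x = \<zero>"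
  by (simp add: a_minus_def r_neg)

lemma minus_add_add:
  assumes "x \<in> carrier A" "y \<in> carrier A" "x' \<in> carrier A" "y' \<in> carrier A"
  shows "(x \<oplus> y) \<ominus> (x' \<oplus> y') = (x \<ominus> x') \<oplus> (y \<ominus> y')"
  using assms by algebra

lemma mult_minus: "a \<in> carrier A \<Longrightarrow> x \<in> carrier A \<Longrightarrow> y \<in> carrier A \<Longrightarrow> a \<otimes> (x \<ominus> y) = a \<otimes> x \<ominus> a \<otimes> y"
  by (simp add: a_minus_def r_distr r_minus)

lemma vadd_coherent: "v \<in> coherent \<Longrightarrow> w \<in> coherent \<Longrightarrow> vadd v w \<in> coherent"
  by (simp add: coherent_def vadd_def minus_add_add pmult_add)

lemma vact_coherent: "a \<in> carrier A \<Longrightarrow> v \<in> coherent \<Longrightarrow> vact a v \<in> coherent"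
  by (simp add: coherent_def vact_def mult_minus[symmetric] pmult_lmult)

lemma vE_coherent: "vE i \<in> coherent"
  by (simp add: coherent_def vE_def minus_self pmult_zero)

lemma vb_coherent: "fst x \<in> carrier A \<Longrightarrow> vb x \<in> coherent"
  by (cases x) (simp add: vb_def vadd_coherent vact_coherent vE_coherent)

lemma vb_const: "vb x j k = vb x j k'"
  by (cases x) (simp add: vb_def vadd_def vact_def vE_def)

lemma approx_closed: assumes "\<eta> \<in> L" shows "approx k \<eta> n j \<in> carrier A"
proof (induction k arbitrary: n)
  case (Suc k)
  then show ?case
    using coherentD(1)[OF vE_coherent] coherentD(1)[OF vb_coherent[OF b_closed[OF assms]]] by simp
qed simp

lemma pmult_0: "x \<in> carrier A \<Longrightarrow> x \<in> pmult 0"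
  using pmultI[of x 0] by simp

lemma approx_coherent: assumes \<eta>: "\<eta> \<in> L" shows "approx (Suc k) \<eta> n j \<ominus> approx k \<eta> n j \<in> pmult k"
proof (induction k arbitrary: n)
  case 0
  show ?case using approx_closed[OF \<eta>, of "Suc 0" n j]
    by (intro pmult_0) (simp del: approx.simps(2))
next
  case (Suc k)
  let ?g = "level_pos (Suc n) - level_pos n"
    and ?e = "node_pos (node (sel \<eta>) (Suc n)) - level_pos n"
  have v: "vE i j l \<in> carrier A" "vb (b \<eta>) j l \<in> carrier A" for i l
    using coherentD(1)[OF vE_coherent] coherentD(1)[OF vb_coherent[OF b_closed[OF \<eta>]]] by auto
  have eq: "vE i j (Suc k) = vE i j k" "vb (b \<eta>) j (Suc k) = vb (b \<eta>) j k" for i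
    using vb_const by (simp_all add: vE_def)
  note cl = approx_closed[OF \<eta>]
  have "approx (Suc (Suc k)) \<eta> n j \<ominus> approx (Suc k) \<eta> n j = p [^] ?g \<otimes> (approx (Suc k) \<eta> (Suc n) j
      \<ominus> approx k \<eta> (Suc n) j)"
    unfolding approx.simps(2)[of "Suc k" \<eta> n] approx.simps(2)[of k \<eta> n] eq
    using cl v by (simp add: minus_add_add minus_self mult_minus del: approx.simps(2))
  moreover have "\<dots> \<in> pmult (?g + k)" using Suc.IH by (rule pmult_pow)
  moreover have "Suc k \<le> ?g + k" using level_pos_Suc[of n] by linarith
  ultimately show ?case using pmult_mono by metis
qed

lemma vY_coherent: "\<eta> \<in> L \<Longrightarrow> vY \<eta> n \<in> coherent"
  using approx_closed approx_coherent by (simp add: coherent_def vY_def del: approx.simps(2))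

lemma vY_step:
  assumes "\<eta> \<in> L"
  shows "vequiv (vY \<eta> n) (vadd (vE (node (sel \<eta>) n)) (vadd
    (vact (p [^] (node_pos (node (sel \<eta>) (Suc n)) - level_pos n)) (vb (b \<eta>)))
    (vact (p [^] (level_pos (Suc n) - level_pos n)) (vY \<eta> (Suc n)))))"
proof -
  have "approx k \<eta> n j \<ominus> approx (Suc k) \<eta> n j \<in> pmult k" for j k
  proof -
    have "approx k \<eta> n j \<ominus> approx (Suc k) \<eta> n j = \<ominus> (approx (Suc k) \<eta> n j \<ominus> approx k \<eta> n j)"
      using approx_closed[OF assms, of k n j] approx_closed[OF assms, of "Suc k" n j]
      by (simp add: a_minus_def minus_add a_comm del: approx.simps(2))
    then show ?thesis using pmult_neg[OF approx_coherent[OF assms, of k n j]] by simp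
  qed
  then show ?thesis unfolding vequiv_def vadd_def vact_def vY_def by simp
qed

lemma vequiv_refl: "v \<in> coherent \<Longrightarrow> vequiv v v"
  by (simp add: vequiv_def minus_self coherentD pmult_zero)

lemma vequiv_sym: assumes "v \<in> coherent" "w \<in> coherent" "vequiv v w" shows "vequiv w v"
  unfolding vequiv_def
proof (intro allI)
  fix j n
  have "w j n \<ominus> v j n = \<ominus> (v j n \<ominus> w j n)"
    using coherentD(1)[OF assms(1)] coherentD(1)[OF assms(2)]
      by (simp add: a_minus_def minus_add a_comm)
  then show "w j n \<ominus> v j n \<in> pmult n" using assms(3) pmult_neg by (simp add: vequiv_def)
qed

lemma vequiv_trans:
  assumes "u \<in> coherent" "v \<in> coherent" "w \<in> coherent" "vequiv u v" "vequiv v w" shows "vequiv u w"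
  using assms(4,5) pmult_diff_trans coherentD(1)[OF assms(1)] coherentD(1)[OF assms(2)] coherentD(1)[OF assms(3)]
  unfolding vequiv_def by blast

lemma vequiv_add:
  assumes "v \<in> coherent" "v' \<in> coherent" "w \<in> coherent" "w' \<in> coherent" "vequiv v v'" "vequiv w w'"
  shows "vequiv (vadd v w) (vadd v' w')"
  using assms by (simp add: vequiv_def vadd_def minus_add_add coherentD pmult_add)

lemma vequiv_act:
  assumes "a \<in> carrier A" "v \<in> coherent" "w \<in> coherent" "vequiv v w"
  shows "vequiv (vact a v) (vact a w)"
  using assms by (simp add: vequiv_def vact_def mult_minus[symmetric] coherentD pmult_lmult)

section \<open>The generated module and its quotient\<close>

primrec gen :: "nat + 'l \<times> nat \<Rightarrow> nat \<Rightarrow> nat \<Rightarrow> 'a" where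
  "gen (Inl j) = vE j"
| "gen (Inr q) = vY (fst q) (snd q)"

text \<open>Elements of the module are values of finite words in scalars and generators, which
  bounds their number by that of a set of lists.\<close>

primrec comb :: "('a \<times> (nat + 'l \<times> nat)) list \<Rightarrow> nat \<Rightarrow> nat \<Rightarrow> 'a" where
  "comb [] = (\<lambda>j n. \<zero>)"
| "comb (x # xs) = vadd (vact (fst x) (gen (snd x))) (comb xs)"

definition words :: "('a \<times> (nat + 'l \<times> nat)) list set" where
  "words = lists (carrier A \<times> (UNIV <+> L \<times> UNIV))"

definition gens :: "(nat \<Rightarrow> nat \<Rightarrow> 'a) set" where "gens = comb ` words"

lemma words_Cons: "x # xs \<in> words \<longleftrightarrow> fst x \<in> carrier A \<and> snd x \<in> UNIV <+> L \<times> UNIV \<and> xs \<in> words"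
  by (simp add: words_def mem_Times_iff)

lemma gen_coherent: "q \<in> UNIV <+> L \<times> UNIV \<Longrightarrow> gen q \<in> coherent"
  using vE_coherent vY_coherent by auto

lemma zero_coherent: "(\<lambda>j n. \<zero>) \<in> coherent"
  by (simp add: coherent_def minus_self pmult_zero)

lemma comb_coherent: assumes "xs \<in> words" shows "comb xs \<in> coherent"
  using assms
proof (induction xs)
  case (Cons x xs)
  then show ?case using gen_coherent[of "snd x"]
    by (simp add: words_Cons vadd_coherent vact_coherent)
qed (simp add: zero_coherent)

lemma gens_coherent: "v \<in> gens \<Longrightarrow> v \<in> coherent"
  using comb_coherent by (auto simp: gens_def)

lemma comb_append: assumes "xs \<in> words" "ys \<in> words"
  shows "comb (xs @ ys) = vadd (comb xs) (comb ys)"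
  using assms(1)
proof (induction xs)
  case Nil
  then show ?case using coherentD(1)[OF comb_coherent[OF assms(2)]] by (simp add: vadd_def)
next
  case (Cons x xs)
  have "gen (snd x) \<in> coherent" "fst x \<in> carrier A" "comb xs \<in> coherent"
    using Cons.prems gen_coherent[of "snd x"] comb_coherent[of xs] by (simp_all add: words_Cons)
  then show ?case using Cons.IH Cons.prems coherentD(1) comb_coherent[OF assms(2)]
    by (simp add: words_Cons vadd_def vact_def a_assoc)
qed

lemma gens_add: "v \<in> gens \<Longrightarrow> w \<in> gens \<Longrightarrow> vadd v w \<in> gens"
proof -
  assume "v \<in> gens" "w \<in> gens"
  then obtain xs ys where x: "xs \<in> words" "v = comb xs" "ys \<in> words" "w = comb ys"
    by (auto simp: gens_def)
  then have "xs @ ys \<in> words" by (auto simp: words_def)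
  moreover have "vadd v w = comb (xs @ ys)" using comb_append x by simp
  ultimately show ?thesis unfolding gens_def by blast
qed

lemma gens_act: assumes a: "a \<in> carrier A" and v: "v \<in> gens" shows "vact a v \<in> gens"
proof -
  obtain xs where xs: "xs \<in> words" "v = comb xs" using v by (auto simp: gens_def)
  have "vact a (comb xs) = comb (map (\<lambda>(c, g). (a \<otimes> c, g)) xs) \<and> map (\<lambda>(c, g). (a \<otimes> c, g)) xs
      \<in> words"
    using xs(1)
  proof (induction xs)
    case Nil
    then show ?case using a by (simp add: vact_def words_def)
  next
    case (Cons x xs)
    obtain c g where x: "x = (c, g)" by (cases x)
    have "gen g \<in> coherent" "c \<in> carrier A" "comb xs \<in> coherent"
      using Cons.prems gen_coherent[of g] comb_coherent[of xs] by (simp_all add: words_Cons x)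
    then have "vact a (comb (x # xs)) = vadd (vact (a \<otimes> c) (gen g)) (vact a (comb xs))"
      using coherentD(1) a by (simp add: x vadd_def vact_def r_distr m_assoc)
    then show ?case using Cons x a by (simp add: words_Cons)
  qed
  then show ?thesis unfolding xs(2) gens_def by blast
qed

lemma gens_zero: "(\<lambda>j n. \<zero>) \<in> gens"
  unfolding gens_def by (rule image_eqI[of _ _ "[]"]) (simp_all add: words_def)

lemma gens_gen: assumes "q \<in> UNIV <+> L \<times> UNIV" shows "gen q \<in> gens"
proof -
  have "comb [(\<one>, q)] = gen q" using coherentD(1)[OF gen_coherent[OF assms]]
    by (simp add: vadd_def vact_def)
  moreover have "[(\<one>, q)] \<in> words" using assms by (simp add: words_def)
  ultimately show ?thesis unfolding gens_def by (metis imageI)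
qed

lemma vE_gens: "vE j \<in> gens"
  using gens_gen[OF InlI, of j] by simp

lemma vY_gens: "\<eta> \<in> L \<Longrightarrow> vY \<eta> n \<in> gens"
  using gens_gen[OF InrI, of "(\<eta>, n)"] by simp

definition mod_act :: "((nat \<Rightarrow> nat \<Rightarrow> 'a) \<Rightarrow> 'g) \<Rightarrow> 'a \<Rightarrow> 'g \<Rightarrow> 'g" where
  "mod_act h = (\<lambda>a x. h (vact a (inv_into gens h x)))"

text \<open>\<open>h\<close> is meant to be any map whose fibres on \<open>gens\<close> are the
  classes of \<open>vequiv\<close>; the operations are carried out on chosen preimages. The free
  target type permits naming the elements later by those of a prescribed set.\<close>

definition quot_mod :: "((nat \<Rightarrow> nat \<Rightarrow> 'a) \<Rightarrow> 'g) \<Rightarrow> ('r \<Rightarrow> 'a) \<Rightarrow> ('r, 'g) module" where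
  "quot_mod h \<rho> = \<lparr>carrier = h ` gens, monoid.mult = (\<lambda>x y. x), one = h (\<lambda>j n. \<zero>), ring.zero
      = h (\<lambda>j n. \<zero>),
     ring.add = (\<lambda>x y. h (vadd (inv_into gens h x) (inv_into gens h y))), smult = (\<lambda>r. mod_act h (\<rho> r))\<rparr>"

text \<open>The coordinates of an element are the entries of one chosen representative. The choice
  is not additive, which is why the laws for \<open>cf\<close> in \<open>branch_module\<close> are
  congruences modulo \<open>p ^ n\<close>.\<close>

lemma branch_module_quot_mod:
  fixes h :: "(nat \<Rightarrow> nat \<Rightarrow> 'a) \<Rightarrow> 'g"
  assumes h: "\<And>v w. v \<in> gens \<Longrightarrow> w \<in> gens \<Longrightarrow> h v = h w \<longleftrightarrow> vequiv v w"
  shows "branch_module A p (quot_mod h \<rho>) (mod_act h) L sel b (\<lambda>j. h (vE j)) (\<lambda>\<eta> n. h (vY \<eta> n))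
    (\<lambda>j n x. inv_into gens h x j n)"
proof -
  let ?G = "quot_mod h \<rho>" and ?hi = "inv_into gens h"
  have car: "carrier ?G = h ` gens" by (simp add: quot_mod_def)
  have hi: "?hi (h v) \<in> gens" "vequiv (?hi (h v)) v" "h (?hi (h v)) = h v" if "v \<in> gens" for v
  proof -
    show 1: "?hi (h v) \<in> gens" using that by (intro inv_into_into) blast
    show 2: "h (?hi (h v)) = h v" using imageI[OF that] by (rule f_inv_into_f)
    then show "vequiv (?hi (h v)) v" using h[OF 1 that] by simp
  qed
  have add: "h v \<oplus>\<^bsub>?G\<^esub> h w = h (vadd v w)" if "v \<in> gens" "w \<in> gens" for v w
  proof -
    have "vequiv (vadd (?hi (h v)) (?hi (h w))) (vadd v w)"
      by (intro vequiv_add hi gens_coherent that)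
    then show ?thesis using h[OF gens_add[OF hi(1)[OF that(1)] hi(1)[OF that(2)]] gens_add[OF that]]
      by (simp add: quot_mod_def)
  qed
  have act: "mod_act h a (h v) = h (vact a v)" if "a \<in> carrier A" "v \<in> gens" for a v
  proof -
    have "vequiv (vact a (?hi (h v))) (vact a v)"
      by (intro vequiv_act hi gens_coherent that)
    then show ?thesis using h[OF gens_act[OF that(1) hi(1)[OF that(2)]] gens_act[OF that]]
      by (simp add: mod_act_def)
  qed
  have zero: "\<zero>\<^bsub>?G\<^esub> = h (\<lambda>j n. \<zero>)" by (simp add: quot_mod_def)
  have cl: "v j n \<in> carrier A" if "v \<in> gens" for v j n
    using coherentD(1)[OF gens_coherent[OF that]] .
  have abel: "abelian_group ?G"
  proof (rule abelian_groupI)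
    fix x y assume "x \<in> carrier ?G" "y \<in> carrier ?G"
    then obtain v w where v: "v \<in> gens" "x = h v" and w: "w \<in> gens" "y = h w" by (auto simp: car)
    show "x \<oplus>\<^bsub>?G\<^esub> y \<in> carrier ?G" unfolding v(2) w(2) add[OF v(1) w(1)] car
      using gens_add[OF v(1) w(1)] by blast
    have "vadd v w = vadd w v" using cl[OF v(1)] cl[OF w(1)] by (simp add: vadd_def a_comm)
    then show "x \<oplus>\<^bsub>?G\<^esub> y = y \<oplus>\<^bsub>?G\<^esub> x" unfolding v(2) w(2) add[OF v(1) w(1)] add[OF w(1) v(1)]
      by simp
    fix z assume "z \<in> carrier ?G"
    then obtain u where u: "u \<in> gens" "z = h u" by (auto simp: car)
    have "vadd (vadd v w) u = vadd v (vadd w u)" using cl[OF v(1)] cl[OF w(1)] cl[OF u(1)]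
      by (simp add: vadd_def a_assoc)
    then show "(x \<oplus>\<^bsub>?G\<^esub> y) \<oplus>\<^bsub>?G\<^esub> z = x \<oplus>\<^bsub>?G\<^esub> (y \<oplus>\<^bsub>?G\<^esub> z)"
      unfolding v(2) w(2) u(2) add[OF v(1) w(1)] add[OF w(1) u(1)] add[OF gens_add[OF v(1) w(1)] u(1)] add[OF v(1) gens_add[OF w(1) u(1)]] by simp
  next
    fix x assume "x \<in> carrier ?G"
    then obtain v where v: "v \<in> gens" "x = h v" by (auto simp: car)
    have "vadd (\<lambda>j n. \<zero>) v = v" using cl[OF v(1)] by (simp add: vadd_def)
    then show "\<zero>\<^bsub>?G\<^esub> \<oplus>\<^bsub>?G\<^esub> x = x" unfolding v(2) zero add[OF gens_zero v(1)] by simp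
    have m: "vact (\<ominus> \<one>) v \<in> gens" by (rule gens_act[OF _ v(1)]) simp
    have "vadd (vact (\<ominus> \<one>) v) v = (\<lambda>j n. \<zero>)" using cl[OF v(1)]
      by (simp add: vadd_def vact_def l_minus l_neg)
    then show "\<exists>y\<in>carrier ?G. y \<oplus>\<^bsub>?G\<^esub> x = \<zero>\<^bsub>?G\<^esub>"
      unfolding v(2) zero car using add[OF m v(1)] m by (intro bexI[of _ "h (vact (\<ominus> \<one>) v)"]) auto
  next
    show "\<zero>\<^bsub>?G\<^esub> \<in> carrier ?G" unfolding zero car using gens_zero by blast
  qed
  have lm: "left_module A ?G (mod_act h)"
  proof (intro left_module.intro left_module_axioms.intro ring_axioms abel)
    fix a c x assume ac: "a \<in> carrier A" "c \<in> carrier A" and "x \<in> carrier ?G"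
    then obtain v where v: "v \<in> gens" "x = h v" by (auto simp: car)
    have "vact (a \<oplus> c) v = vadd (vact a v) (vact c v)" using cl[OF v(1)] ac
      by (simp add: vadd_def vact_def l_distr)
    then show "mod_act h (a \<oplus> c) x = mod_act h a x \<oplus>\<^bsub>?G\<^esub> mod_act h c x"
      using ac by (simp add: v act add gens_act)
    have "vact (a \<otimes> c) v = vact a (vact c v)" using cl[OF v(1)] ac by (simp add: vact_def m_assoc)
    then show "mod_act h (a \<otimes> c) x = mod_act h a (mod_act h c x)"
      using ac by (simp add: v act gens_act)
  next
    fix a x y assume a: "a \<in> carrier A" and "x \<in> carrier ?G" "y \<in> carrier ?G"
    then obtain v w where v: "v \<in> gens" "x = h v" and w: "w \<in> gens" "y = h w" by (auto simp: car)
    have "vact a (vadd v w) = vadd (vact a v) (vact a w)" using cl[OF v(1)] cl[OF w(1)] a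
      by (simp add: vadd_def vact_def r_distr)
    then show "mod_act h a (x \<oplus>\<^bsub>?G\<^esub> y) = mod_act h a x \<oplus>\<^bsub>?G\<^esub> mod_act h a y"
      using a by (simp add: v w act add gens_act gens_add)
  next
    fix a x assume a: "a \<in> carrier A" and "x \<in> carrier ?G"
    then obtain v where v: "v \<in> gens" "x = h v" by (auto simp: car)
    show "mod_act h a x \<in> carrier ?G" unfolding v(2) act[OF a v(1)] car using gens_act[OF a v(1)]
      by blast
  next
    fix x assume "x \<in> carrier ?G"
    then obtain v where v: "v \<in> gens" "x = h v" by (auto simp: car)
    have "vact \<one> v = v" using cl[OF v(1)] by (simp add: vact_def)
    then show "mod_act h \<one> x = x" by (simp add: v act)
  qed
  have hE: "h (vE j) \<in> carrier ?G" for j unfolding car using vE_gens by blast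
  have hb: "mod_act h x (h (vE t)) \<oplus>\<^bsub>?G\<^esub> h (vE s) = h (vb (x, t, s))" if "x \<in> carrier A" for x t s
    using that by (simp add: act add vE_gens gens_act vb_def)
  have vbg: "vb x \<in> gens" if "fst x \<in> carrier A" for x
    using that by (cases x) (simp add: vb_def gens_add gens_act vE_gens)
  show ?thesis
  proof (intro branch_module.intro branch_module_axioms.intro central_element_axioms lm nontrivial sel_inj b_closed hE)
    show "h (vY \<eta> n) \<in> carrier ?G" if "\<eta> \<in> L" for \<eta> n unfolding car using vY_gens[OF that] by blast
  next
    fix \<eta> n assume \<eta>: "\<eta> \<in> L"
    let ?e = "p [^] (node_pos (node (sel \<eta>) (Suc n)) - level_pos n)"
      and ?g = "p [^] (level_pos (Suc n) - level_pos n)"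
    have bb: "(case b \<eta> of (x, t, s) \<Rightarrow> mod_act h x (h (vE t)) \<oplus>\<^bsub>?G\<^esub> h (vE s)) = h (vb (b \<eta>))"
      using hb b_closed[OF \<eta>] by (cases "b \<eta>") simp
    have g: "vact ?e (vb (b \<eta>)) \<in> gens" "vact ?g (vY \<eta> (Suc n)) \<in> gens"
      using vbg[OF b_closed[OF \<eta>]] vY_gens[OF \<eta>] gens_act by simp_all
    have "h (vY \<eta> n) = h (vadd (vE (node (sel \<eta>) n)) (vadd (vact ?e (vb (b \<eta>))) (vact ?g (vY \<eta> (Suc n)))))"
      using h[OF vY_gens[OF \<eta>] gens_add[OF vE_gens gens_add[OF g]]] vY_step[OF \<eta>] by blast
    then show "h (vY \<eta> n) = h (vE (node (sel \<eta>) n)) \<oplus>\<^bsub>?G\<^esub> (mod_act h ?e (case b \<eta> of (x, t, s) \<Rightarrow> mod_act h x (h (vE t)) \<oplus>\<^bsub>?G\<^esub> h (vE s)) \<oplus>\<^bsub>?G\<^esub>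
        mod_act h ?g (h (vY \<eta> (Suc n))))"
      unfolding bb using g vbg[OF b_closed[OF \<eta>]] vY_gens[OF \<eta>] vE_gens
        by (simp add: act add gens_add)
  next
    fix x U
    assume "x \<in> carrier ?G" and U: "\<And>a j. a \<in> carrier A \<Longrightarrow> mod_act h a (h (vE j)) \<in> U"
      "\<And>a \<eta> n. a \<in> carrier A \<Longrightarrow> \<eta> \<in> L \<Longrightarrow> mod_act h a (h (vY \<eta> n)) \<in> U"
      "\<And>x y. x \<in> U \<Longrightarrow> y \<in> U \<Longrightarrow> x \<oplus>\<^bsub>?G\<^esub> y \<in> U"
    then obtain xs where xs: "xs \<in> words" "x = h (comb xs)" by (auto simp: car gens_def)
    have "h (comb xs) \<in> U" using xs(1)
    proof (induction xs)
      case Nil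
      have "vact \<zero> (vE 0) = (\<lambda>j n. \<zero>)" using cl[OF vE_gens[of 0]] by (simp add: vact_def)
      then show ?case using U(1)[of \<zero> 0] act[of \<zero> "vE 0"] vE_gens by simp
    next
      case (Cons q xs)
      obtain c g where q: "q = (c, g)" by (cases q)
      have cg: "c \<in> carrier A" "g \<in> UNIV <+> L \<times> UNIV" "comb xs \<in> gens"
        using Cons.prems q unfolding gens_def by (auto simp: words_Cons)
      have "mod_act h c (h (gen g)) \<in> U" using U(1,2) cg(1,2) by (cases g) auto
      then have "h (vact c (gen g)) \<in> U" using act[OF cg(1) gens_gen[OF cg(2)]] by simp
      then have "h (vact c (gen g)) \<oplus>\<^bsub>?G\<^esub> h (comb xs) \<in> U" using Cons.IH Cons.prems U(3) words_Cons
        by blast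
      then show ?case using add[OF gens_act[OF cg(1) gens_gen[OF cg(2)]] cg(3)] by (simp add: q)
    qed
    then show "x \<in> U" using xs(2) by simp
  next
    fix x j n assume "x \<in> carrier ?G"
    then obtain v where v: "v \<in> gens" "x = h v" by (auto simp: car)
    show "?hi x j n \<in> carrier A" unfolding v(2) by (rule cl[OF hi(1)[OF v(1)]])
    show "?hi x j (Suc n) \<ominus> ?hi x j n \<in> pmult n" unfolding v(2)
      by (rule coherentD(2)[OF gens_coherent[OF hi(1)[OF v(1)]]])
  next
    fix x y j n assume "x \<in> carrier ?G" "y \<in> carrier ?G"
    then obtain v w where v: "v \<in> gens" "x = h v" and w: "w \<in> gens" "y = h w" by (auto simp: car)
    let ?v = "?hi x" and ?w = "?hi y"
    have g: "?v \<in> gens" "?w \<in> gens" "h ?v = x" "h ?w = y" using v w hi by simp_all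
    have "x \<oplus>\<^bsub>?G\<^esub> y = h (vadd ?v ?w)" using add[OF g(1,2)] g(3,4) by simp
    then have "vequiv (?hi (x \<oplus>\<^bsub>?G\<^esub> y)) (vadd ?v ?w)" using hi(2)[OF gens_add[OF g(1,2)]] by simp
    then show "?hi (x \<oplus>\<^bsub>?G\<^esub> y) j n \<ominus> (?v j n \<oplus> ?w j n) \<in> pmult n" by (simp add: vequiv_def vadd_def)
  next
    fix a x j n assume a: "a \<in> carrier A" and "x \<in> carrier ?G"
    then obtain v where v: "v \<in> gens" "x = h v" by (auto simp: car)
    let ?v = "?hi x"
    have g: "?v \<in> gens" "h ?v = x" using v hi by simp_all
    have "vequiv (?hi (mod_act h a x)) (vact a ?v)" using hi(2)[OF gens_act[OF a g(1)]]
      by (simp add: mod_act_def)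
    then show "?hi (mod_act h a x) j n \<ominus> a \<otimes> ?v j n \<in> pmult n" by (simp add: vequiv_def vact_def)
  next
    fix j n i
    show "?hi (h (vE i)) j n \<ominus> (if i = j then \<one> else \<zero>) \<in> pmult n"
      using hi(2)[OF vE_gens[of i]] unfolding vequiv_def vE_def by blast
  next
    fix x assume "x \<in> carrier ?G" and 0: "\<And>j n. ?hi x j n \<in> pmult n"
    then obtain v where v: "v \<in> gens" "x = h v" by (auto simp: car)
    let ?v = "?hi x"
    have g: "?v \<in> gens" "h ?v = x" using v hi by simp_all
    have "vequiv ?v (\<lambda>j n. \<zero>)" using 0 cl[OF g(1)] by (simp add: vequiv_def a_minus_def)
    then show "x = \<zero>\<^bsub>?G\<^esub>" using h[OF g(1) gens_zero] g(2) zero by simp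
  qed
qed

end

section \<open>Cardinalities and the endomorphism algebra\<close>

text \<open>In a finite ring two powers of \<open>p\<close> coincide; cancelling gives
  \<open>p [^] k = \<one>\<close> with \<open>k > 0\<close>, and then \<open>\<one>\<close> is
  divisible by all powers of \<open>p\<close>, against separation.\<close>

lemma (in central_element) infinite_carrier:
  assumes "\<one> \<noteq> \<zero>" shows "infinite (carrier A)"
proof
  assume "finite (carrier A)"
  moreover have "(\<lambda>n::nat. p [^] n) ` UNIV \<subseteq> carrier A" by auto
  ultimately have "\<not> inj (\<lambda>n::nat. p [^] n)" using finite_imageD finite_subset infinite_UNIV_nat
    by metis
  then obtain m n :: nat where mn: "m < n" "p [^] m = p [^] n"
    unfolding inj_def by (metis linorder_neqE_nat)
  define k where "k = n - m"
  have "p [^] m \<otimes> (\<one> \<ominus> p [^] k) = p [^] m \<ominus> p [^] (m + k)"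
    by (simp add: a_minus_def r_distr r_minus nat_pow_mult)
  also have "\<dots> = \<zero>" using mn by (simp add: k_def a_minus_def r_neg)
  finally have "\<one> \<ominus> p [^] k = \<zero>" using pow_cancel[of "\<one> \<ominus> p [^] k" m] by simp
  then have one: "p [^] k = \<one>" by simp
  have "\<one> \<in> pmult i" for i
  proof -
    have "p [^] (k * i) = \<one>" using one by (simp add: nat_pow_pow[symmetric])
    then have "\<one> \<in> pmult (k * i)" using pmultI[of \<one> "k * i"] by simp
    moreover have "i \<le> k * i" using mn(1) by (cases k) (simp_all add: k_def)
    ultimately show ?thesis using pmult_mono by blast
  qed
  then show False using pmult_separated[of \<one>] assms by blast
qed

text \<open>Scalar multiples of the identity are central. Cancellation and separation hold in
  \<open>R\<close> for a nonzero nonunit \<open>q\<close>, and freeness of \<open>A\<close>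
  transfers them coordinate by coordinate.\<close>

lemma central_element_of_free_algebra:
  assumes PID: "principal_domain R" and nf: "\<not> field R" and A: "assoc_algebra R A"
    and free: "free_module R A"
  obtains q where "q \<in> carrier R" "central_element A (q \<odot>\<^bsub>A\<^esub> \<one>\<^bsub>A\<^esub>)"
    "\<And>n::nat. (q \<odot>\<^bsub>A\<^esub> \<one>\<^bsub>A\<^esub>) [^]\<^bsub>A\<^esub> n = (q [^]\<^bsub>R\<^esub> n) \<odot>\<^bsub>A\<^esub> \<one>\<^bsub>A\<^esub>"
proof -
  interpret R: principal_domain R by (rule PID)
  interpret A: assoc_algebra R A by (rule A)
  interpret FA: free_module R A by (rule free)
  obtain ca :: "'c \<Rightarrow> 'c \<Rightarrow> 'a" where ca:
    "\<And>\<beta> a. a \<in> carrier A \<Longrightarrow> ca \<beta> a \<in> carrier R"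
    "\<And>\<beta> a a'. a \<in> carrier A \<Longrightarrow> a' \<in> carrier A \<Longrightarrow> ca \<beta> (a \<oplus>\<^bsub>A\<^esub> a') = ca \<beta> a \<oplus>\<^bsub>R\<^esub> ca \<beta> a'"
    "\<And>\<beta> r a. r \<in> carrier R \<Longrightarrow> a \<in> carrier A \<Longrightarrow> ca \<beta> (r \<odot>\<^bsub>A\<^esub> a) = r \<otimes>\<^bsub>R\<^esub> ca \<beta> a"
    "\<And>a. a \<in> carrier A \<Longrightarrow> finite {\<beta>. ca \<beta> a \<noteq> \<zero>\<^bsub>R\<^esub>}"
    "\<And>a. a \<in> carrier A \<Longrightarrow> (\<And>\<beta>. ca \<beta> a = \<zero>\<^bsub>R\<^esub>) \<Longrightarrow> a = \<zero>\<^bsub>A\<^esub>"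
    by (rule FA.coordinates) blast
  have ca0: "ca \<beta> \<zero>\<^bsub>A\<^esub> = \<zero>\<^bsub>R\<^esub>" for \<beta>
    using ca(3)[of "\<zero>\<^bsub>R\<^esub>" "\<zero>\<^bsub>A\<^esub>" \<beta>] ca(1)[of "\<zero>\<^bsub>A\<^esub>" \<beta>] by simp
  have "Units R \<noteq> carrier R - {\<zero>\<^bsub>R\<^esub>}"
  proof
    assume "Units R = carrier R - {\<zero>\<^bsub>R\<^esub>}"
    then have "field R" by (intro field.intro field_axioms.intro R.domain_axioms)
    then show False using nf by blast
  qed
  moreover have "\<zero>\<^bsub>R\<^esub> \<notin> Units R"
  proof
    assume "\<zero>\<^bsub>R\<^esub> \<in> Units R"
    then have "\<zero>\<^bsub>R\<^esub> \<otimes>\<^bsub>R\<^esub> inv\<^bsub>R\<^esub> \<zero>\<^bsub>R\<^esub> = \<one>\<^bsub>R\<^esub>" "inv\<^bsub>R\<^esub> \<zero>\<^bsub>R\<^esub> \<in> carrier R"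
      by (rule R.Units_r_inv, rule R.Units_inv_closed)
    then show False by simp
  qed
  moreover have "Units R \<subseteq> carrier R" using R.Units_closed by blast
  ultimately obtain q where q: "q \<in> carrier R" "q \<noteq> \<zero>\<^bsub>R\<^esub>" "q \<notin> Units R" by blast
  define p where "p = q \<odot>\<^bsub>A\<^esub> \<one>\<^bsub>A\<^esub>"
  have pA: "p \<in> carrier A" using q(1) by (simp add: p_def)
  have left: "(r \<odot>\<^bsub>A\<^esub> \<one>\<^bsub>A\<^esub>) \<otimes>\<^bsub>A\<^esub> a = r \<odot>\<^bsub>A\<^esub> a" if "r \<in> carrier R" "a \<in> carrier A" for r a
    using A.smult_mult_left[OF that(1) _ that(2), of "\<one>\<^bsub>A\<^esub>"] that by simp
  have right: "a \<otimes>\<^bsub>A\<^esub> (r \<odot>\<^bsub>A\<^esub> \<one>\<^bsub>A\<^esub>) = r \<odot>\<^bsub>A\<^esub> a" if "r \<in> carrier R" "a \<in> carrier A" for r a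
    using A.smult_mult_right[OF that, of "\<one>\<^bsub>A\<^esub>"] that by simp
  have pow: "p [^]\<^bsub>A\<^esub> n = (q [^]\<^bsub>R\<^esub> n) \<odot>\<^bsub>A\<^esub> \<one>\<^bsub>A\<^esub>" for n :: nat
  proof (induction n)
    case (Suc n)
    have "p [^]\<^bsub>A\<^esub> Suc n = ((q [^]\<^bsub>R\<^esub> n) \<odot>\<^bsub>A\<^esub> \<one>\<^bsub>A\<^esub>) \<otimes>\<^bsub>A\<^esub> p" using Suc by simp
    also have "\<dots> = (q [^]\<^bsub>R\<^esub> n) \<odot>\<^bsub>A\<^esub> p" using left q(1) pA by simp
    also have "\<dots> = (q [^]\<^bsub>R\<^esub> Suc n) \<odot>\<^bsub>A\<^esub> \<one>\<^bsub>A\<^esub>" using q(1) by (simp add: p_def A.smult_assoc1)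
    finally show ?case .
  qed simp
  have "central_element A p"
  proof (intro central_element.intro central_element_axioms.intro A.ring_axioms pA)
    fix a assume a: "a \<in> carrier A"
    show "p \<otimes>\<^bsub>A\<^esub> a = a \<otimes>\<^bsub>A\<^esub> p" unfolding p_def left[OF q(1) a] right[OF q(1) a] ..
    show "a = \<zero>\<^bsub>A\<^esub>" if "p \<otimes>\<^bsub>A\<^esub> a = \<zero>\<^bsub>A\<^esub>"
    proof (rule ca(5)[OF a])
      fix \<beta>
      have "q \<otimes>\<^bsub>R\<^esub> ca \<beta> a = \<zero>\<^bsub>R\<^esub>" using that ca(3)[OF q(1) a, of \<beta>] ca0
        unfolding p_def left[OF q(1) a] by simp
      then show "ca \<beta> a = \<zero>\<^bsub>R\<^esub>" using R.integral[of q "ca \<beta> a"] q ca(1)[OF a] by blast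
    qed
    show "a = \<zero>\<^bsub>A\<^esub>" if "\<And>n::nat. \<exists>c\<in>carrier A. a = p [^]\<^bsub>A\<^esub> n \<otimes>\<^bsub>A\<^esub> c"
    proof (rule ca(5)[OF a])
      fix \<beta>
      show "ca \<beta> a = \<zero>\<^bsub>R\<^esub>"
      proof (rule R.eq_zero_if_all_powers_divide[OF q(1,3) ca(1)[OF a]])
        fix n :: nat
        obtain c where c: "c \<in> carrier A" "a = p [^]\<^bsub>A\<^esub> n \<otimes>\<^bsub>A\<^esub> c"
          using \<open>\<And>n::nat. \<exists>c\<in>carrier A. a = p [^]\<^bsub>A\<^esub> n \<otimes>\<^bsub>A\<^esub> c\<close> by blast
        have "a = (q [^]\<^bsub>R\<^esub> n) \<odot>\<^bsub>A\<^esub> c" unfolding c(2) pow using left c(1) q(1) by simp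
        then have "ca \<beta> a = q [^]\<^bsub>R\<^esub> n \<otimes>\<^bsub>R\<^esub> ca \<beta> c" using ca(3) c(1) q(1) by simp
        then show "\<exists>s\<in>carrier R. ca \<beta> a = q [^]\<^bsub>R\<^esub> n \<otimes>\<^bsub>R\<^esub> s" using ca(1)[OF c(1)] by blast
      qed
    qed
  qed
  then show thesis using that[of q] q(1) pow unfolding p_def by blast
qed

text \<open>Identify \<open>L\<close> with \<open>V \<times> L\<close> and project to the first
  factor.\<close>

lemma ex_fibres_of_full_size:
  assumes L: "infinite L" and V: "|V| \<le>o |L|" "V \<noteq> {}"
  obtains b :: "'l \<Rightarrow> 'v" where "\<And>\<eta>. \<eta> \<in> L \<Longrightarrow> b \<eta> \<in> V" "\<And>v. v \<in> V \<Longrightarrow> |L| \<le>o |{\<eta> \<in> L. b \<eta> = v}|"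
proof -
  have "|V \<times> L| =o |L|"
    using card_of_Times_infinite[OF L V(2,1)] by blast
  then obtain f where f: "bij_betw f L (V \<times> L)" using card_of_ordIso ordIso_symmetric by blast
  show thesis
  proof (rule that[of "fst \<circ> f"])
    show "(fst \<circ> f) \<eta> \<in> V" if "\<eta> \<in> L" for \<eta> using bij_betwE[OF f] that by auto
    show "|L| \<le>o |{\<eta> \<in> L. (fst \<circ> f) \<eta> = v}|" if v: "v \<in> V" for v
    proof (rule surj_imp_ordLeq[of _ "snd \<circ> f"], rule subsetI)
      fix x assume "x \<in> L"
      then have "(v, x) \<in> f ` L" using v bij_betw_imp_surj_on[OF f] by blast
      then obtain \<eta> where "\<eta> \<in> L" "f \<eta> = (v, x)" by (metis imageE)
      then show "x \<in> (snd \<circ> f) ` {\<eta> \<in> L. (fst \<circ> f) \<eta> = v}" by force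
    qed
  qed
qed

context branch_data
begin

lemma card_gens:
  assumes "infinite L" "|carrier A| \<le>o |L|" shows "|gens| \<le>o |L|"
proof -
  have "|UNIV :: nat set| \<le>o |L|" using assms(1) infinite_iff_card_of_nat by blast
  moreover have "|L| \<le>o |L|" by simp
  ultimately have "|carrier A \<times> ((UNIV :: nat set) <+> L \<times> (UNIV :: nat set))| \<le>o |L|"
    using assms by (intro card_of_Times_ordLeq_infinite card_of_Plus_ordLeq_infinite)
  then have "|words| \<le>o |L|" unfolding words_def by (rule lists_ordLeq_infinite[OF assms(1)])
  then show ?thesis unfolding gens_def using card_of_image ordLeq_transitive by blast
qed

text \<open>The quotient of \<open>gens\<close> has the cardinality of \<open>L\<close>, so its elements can be renamed to those of \<open>L\<close>.\<close>

lemma ex_quotient_map: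
  assumes "infinite L" "|carrier A| \<le>o |L|"
  obtains h :: "(nat \<Rightarrow> nat \<Rightarrow> 'a) \<Rightarrow> 'l" where
    "\<And>v w. v \<in> gens \<Longrightarrow> w \<in> gens \<Longrightarrow> h v = h w \<longleftrightarrow> vequiv v w" "h ` gens = L"
proof -
  define rep where "rep v = (SOME w. w \<in> gens \<and> vequiv w v)" for v
  have rep: "rep v \<in> gens \<and> vequiv (rep v) v" if "v \<in> gens" for v
    unfolding rep_def by (rule someI[of _ v]) (simp add: that vequiv_refl gens_coherent)
  have rep_iff: "rep v = rep w \<longleftrightarrow> vequiv v w" if vw: "v \<in> gens" "w \<in> gens" for v w
  proof
    note c = gens_coherent[OF vw(1)] gens_coherent[OF vw(2)]
    have c': "rep v \<in> coherent" "rep w \<in> coherent" using rep vw gens_coherent by blast+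
    show "vequiv v w" if "rep v = rep w"
      using vequiv_trans[OF c(1) c'(1) c(2)] vequiv_sym[OF c'(1) c(1)] rep[OF vw(1)] rep[OF vw(2)] that by simp
    assume vw': "vequiv v w"
    have "vequiv u v \<longleftrightarrow> vequiv u w" if "u \<in> gens" for u
      using vequiv_trans[OF gens_coherent[OF that] c(1,2)] vequiv_trans[OF gens_coherent[OF that] c(2,1)]
        vequiv_sym[OF c vw'] vw' by blast
    then have "(\<lambda>u. u \<in> gens \<and> vequiv u v) = (\<lambda>u. u \<in> gens \<and> vequiv u w)" by blast
    then show "rep v = rep w" unfolding rep_def by simp
  qed
  \<comment> \<open>A preliminary copy of the module, with classes named by representatives, only
    serves to count: \<open>inj_Y\<close> gives at least \<open>|L|\<close> classes. The renaming to
    \<open>L\<close> follows.\<close>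
  interpret B: branch_module A p "quot_mod rep (\<lambda>a. a)" "mod_act rep" L sel b "\<lambda>j. rep (vE j)"
    "\<lambda>\<eta> n. rep (vY \<eta> n)"
    "\<lambda>j n x. inv_into gens rep x j n"
      "\<lambda>(x, t, s). mod_act rep x (rep (vE t)) \<oplus>\<^bsub>quot_mod rep (\<lambda>a. a)\<^esub> rep (vE s)"
    by (rule branch_module_quot_mod[OF rep_iff])
  have "(\<lambda>\<eta>. rep (vY \<eta> 0)) ` L \<subseteq> rep ` gens" using vY_gens by blast
  then have "|L| \<le>o |rep ` gens|" using B.inj_Y by (intro card_of_ordLeq[THEN iffD1] exI conjI)
  moreover have "|rep ` gens| \<le>o |L|" using card_gens[OF assms] card_of_image ordLeq_transitive
    by blast
  ultimately have "|rep ` gens| =o |L|" by (simp add: ordIso_iff_ordLeq)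
  then obtain f where f: "bij_betw f (rep ` gens) L" using card_of_ordIso by blast
  show thesis
  proof (rule that[of "f \<circ> rep"])
    show "(f \<circ> rep) v = (f \<circ> rep) w \<longleftrightarrow> vequiv v w" if "v \<in> gens" "w \<in> gens" for v w
      using inj_on_eq_iff[OF bij_betw_imp_inj_on[OF f], of "rep v" "rep w"] rep_iff[OF that] that
        by simp
    show "(f \<circ> rep) ` gens = L" using bij_betw_imp_surj_on[OF f] by (simp add: image_comp)
  qed
qed

end

text \<open>Every power of \<open>p\<close> comes from a scalar in \<open>R\<close>, so an
  \<open>R\<close>-linear map commutes with \<open>sc n\<close>, which together with additivity is
  what \<open>endomorphism_is_scalar\<close> asks for. Injectivity is read off at the coordinate of
  \<open>E 0\<close>.\<close>

lemma algebra_iso_branch_module: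
  fixes R :: "('r, 'x) ring_scheme" and A :: "('r, 'a, 'y) module_scheme"
    and G :: "('r, 'g, 'z) module_scheme"
  assumes B: "branch_module A p G act L sel b E Y cf" and A: "assoc_algebra R A"
    and smult: "\<And>r x. r \<in> carrier R \<Longrightarrow> x \<in> carrier G \<Longrightarrow> r \<odot>\<^bsub>G\<^esub> x = act (r \<odot>\<^bsub>A\<^esub> \<one>\<^bsub>A\<^esub>) x"
    and pow: "\<And>n::nat. \<exists>r\<in>carrier R. p [^]\<^bsub>A\<^esub> n = r \<odot>\<^bsub>A\<^esub> \<one>\<^bsub>A\<^esub>"
    and fibre: "\<And>x t s. x \<in> carrier A \<Longrightarrow> |carrier A| <o |{\<eta> \<in> L. b \<eta> = (x, t, s)}|"
  shows "(\<lambda>a. \<lambda>x\<in>carrier G. act a x) \<in> algebra_iso R A (End_alg R G)"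
proof -
  interpret B: branch_module A p G act L sel b E Y cf "\<lambda>(x, t, s). act x (E t) \<oplus>\<^bsub>G\<^esub> E s"
    by (rule B)
  interpret A: assoc_algebra R A by (rule A)
  let ?h = "\<lambda>a. \<lambda>x\<in>carrier G. act a x" and ?E = "End_alg R G"
  have left: "(r \<odot>\<^bsub>A\<^esub> \<one>\<^bsub>A\<^esub>) \<otimes>\<^bsub>A\<^esub> a = r \<odot>\<^bsub>A\<^esub> a" if "r \<in> carrier R" "a \<in> carrier A" for r a
    using A.smult_mult_left[OF that(1) _ that(2), of "\<one>\<^bsub>A\<^esub>"] that by simp
  have right: "a \<otimes>\<^bsub>A\<^esub> (r \<odot>\<^bsub>A\<^esub> \<one>\<^bsub>A\<^esub>) = r \<odot>\<^bsub>A\<^esub> a" if "r \<in> carrier R" "a \<in> carrier A" for r a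
    using A.smult_mult_right[OF that, of "\<one>\<^bsub>A\<^esub>"] that by simp
  have smult_act: "r \<odot>\<^bsub>G\<^esub> act a x = act (r \<odot>\<^bsub>A\<^esub> a) x" "act a (r \<odot>\<^bsub>G\<^esub> x) = act (r \<odot>\<^bsub>A\<^esub> a) x"
    if "r \<in> carrier R" "a \<in> carrier A" "x \<in> carrier G" for r a x
    using left[OF that(1,2)] right[OF that(1,2)] that
    by (simp_all add: smult B.G.act_mult[symmetric])
  have car: "carrier ?E = module_hom R G G \<inter> extensional (carrier G)" by (simp add: End_alg_def)
  have closed: "?h a \<in> carrier ?E" if a: "a \<in> carrier A" for a
  proof -
    have sG: "r \<odot>\<^bsub>G\<^esub> x \<in> carrier G" if "r \<in> carrier R" "x \<in> carrier G" for r x using that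
      by (simp add: smult)
    have "?h a \<in> module_hom R G G" unfolding module_hom_def
      using a smult_act sG by (auto simp: B.G.act_add_right)
    then show ?thesis unfolding car by simp
  qed
  have hom: "?h \<in> ring_hom A ?E"
  proof (rule ring_hom_memI)
    fix a c assume ac: "a \<in> carrier A" "c \<in> carrier A"
    show "?h a \<in> carrier ?E" by (rule closed[OF ac(1)])
    show "?h (a \<otimes>\<^bsub>A\<^esub> c) = ?h a \<otimes>\<^bsub>?E\<^esub> ?h c"
      using ac by (auto simp: End_alg_def compose_def B.G.act_mult fun_eq_iff restrict_def)
    show "?h (a \<oplus>\<^bsub>A\<^esub> c) = ?h a \<oplus>\<^bsub>?E\<^esub> ?h c"
      using ac by (auto simp: End_alg_def B.G.act_add_left fun_eq_iff restrict_def)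
  next
    show "?h \<one>\<^bsub>A\<^esub> = \<one>\<^bsub>?E\<^esub>" by (auto simp: End_alg_def B.G.act_one fun_eq_iff restrict_def)
  qed
  have "inj_on ?h (carrier A)"
  proof (rule inj_onI)
    fix a c assume ac: "a \<in> carrier A" "c \<in> carrier A" "?h a = ?h c"
    have "act a (E 0) = act c (E 0)" using fun_cong[OF ac(3), of "E 0"] by simp
    then have "act (a \<ominus>\<^bsub>A\<^esub> c) (E 0) = \<zero>\<^bsub>G\<^esub>"
      using ac(1,2) by (simp add: a_minus_def B.G.act_add_left B.act_neg_left B.G.M.r_neg)
    then have "act (a \<ominus>\<^bsub>A\<^esub> c) (E 0) \<in> B.scaled n" for n using B.submod_zero[OF B.submod_scaled]
      by simp
    then have "a \<ominus>\<^bsub>A\<^esub> c \<in> B.A.pmult n" for n using B.cf_scaled B.act_E_cf[of "a \<ominus>\<^bsub>A\<^esub> c" 0 n] ac(1,2)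
      by simp
    then have "a \<ominus>\<^bsub>A\<^esub> c = \<zero>\<^bsub>A\<^esub>" using B.A.pmult_separated ac(1,2) by simp
    then show "a = c" using ac(1,2) by simp
  qed
  moreover have "carrier ?E \<subseteq> ?h ` carrier A"
  proof
    fix \<phi> assume "\<phi> \<in> carrier ?E"
    then have \<phi>: "\<phi> \<in> module_hom R G G" "\<phi> \<in> extensional (carrier G)" by (auto simp: car)
    have cl: "\<phi> x \<in> carrier G" if "x \<in> carrier G" for x using module_hom_closed[OF \<phi>(1)] that
      by blast
    have "\<exists>a\<in>carrier A. \<forall>x\<in>carrier G. \<phi> x = act a x"
    proof (rule B.endomorphism_is_scalar[OF cl _ _ B.A.infinite_carrier[OF B.nontrivial] fibre])
      show "\<phi> (x \<oplus>\<^bsub>G\<^esub> y) = \<phi> x \<oplus>\<^bsub>G\<^esub> \<phi> y" if "x \<in> carrier G" "y \<in> carrier G" for x y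
        by (rule module_hom_add[OF \<phi>(1) that])
      show "\<phi> (act (p [^]\<^bsub>A\<^esub> n) x) = act (p [^]\<^bsub>A\<^esub> n) (\<phi> x)" if "x \<in> carrier G" for x and n :: nat
      proof -
        obtain r where r: "r \<in> carrier R" "p [^]\<^bsub>A\<^esub> n = r \<odot>\<^bsub>A\<^esub> \<one>\<^bsub>A\<^esub>" using pow by blast
        show ?thesis unfolding r(2)
          using module_hom_smult[OF \<phi>(1) r(1) that] smult[OF r(1)] that cl[OF that] by simp
      qed
    qed
    then obtain a where a: "a \<in> carrier A" "\<forall>x\<in>carrier G. \<phi> x = act a x" by blast
    then have "\<phi> = ?h a" using \<phi>(2) by (intro extensionalityI[of _ "carrier G"]) auto
    then show "\<phi> \<in> ?h ` carrier A" using a(1) by blast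
  qed
  ultimately have "bij_betw ?h (carrier A) (carrier ?E)"
    using closed unfolding bij_betw_def by blast
  moreover have "?h (r \<odot>\<^bsub>A\<^esub> a) = r \<odot>\<^bsub>?E\<^esub> ?h a" if "r \<in> carrier R" "a \<in> carrier A" for r a
    using smult_act(1)[OF that] by (auto simp: End_alg_def fun_eq_iff restrict_def)
  ultimately show ?thesis using hom by (simp add: algebra_iso_def ring_iso_def)
qed

theorem corollary3p1:
  fixes R :: "('r, 'x) ring_scheme"
    and A :: "('r, 'a, 'y) module_scheme"
    and \<kappa> :: "'l rel"
  assumes "principal_domain R" and "countable (carrier R)" and "\<not> field R"
    and "assoc_algebra R A" and "carrier A \<noteq> {\<zero>\<^bsub>A\<^esub>}" and "free_module R A"
    and "Card_order \<kappa>" and "|carrier A| <o \<kappa>" and "\<kappa> \<le>o ctwo ^c natLeq"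
  shows "\<exists>(G :: ('r, 'l) module) act.
    aleph1_free_module R G \<and> |carrier G| =o \<kappa> \<and>
    left_module A G act \<and>
    (\<forall>r \<in> carrier R. \<forall>x \<in> carrier G. act (r \<odot>\<^bsub>A\<^esub> \<one>\<^bsub>A\<^esub>) x = r \<odot>\<^bsub>G\<^esub> x) \<and>
    (\<lambda>a. \<lambda>x\<in>carrier G. act a x) \<in> algebra_iso R A (End_alg R G)"
proof -
  interpret R: principal_domain R by (rule assms(1))
  interpret A: assoc_algebra R A by (rule assms(4))
  obtain q where q: "q \<in> carrier R" "central_element A (q \<odot>\<^bsub>A\<^esub> \<one>\<^bsub>A\<^esub>)"
    "\<And>n::nat. (q \<odot>\<^bsub>A\<^esub> \<one>\<^bsub>A\<^esub>) [^]\<^bsub>A\<^esub> n = (q [^]\<^bsub>R\<^esub> n) \<odot>\<^bsub>A\<^esub> \<one>\<^bsub>A\<^esub>"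
    using central_element_of_free_algebra[OF assms(1,3,4,6)] by blast
  define p where "p = q \<odot>\<^bsub>A\<^esub> \<one>\<^bsub>A\<^esub>"
  interpret C: central_element A p using q(2) by (simp add: p_def)
  have nontrivial: "\<one>\<^bsub>A\<^esub> \<noteq> \<zero>\<^bsub>A\<^esub>" using assms(5) A.carrier_one_zero by auto
  \<comment> \<open>The field of \<open>\<kappa>\<close> indexes the branches and will also be the
    carrier of \<open>G\<close>.\<close>
  define L where "L = Field \<kappa>"
  have L\<kappa>: "|L| =o \<kappa>" unfolding L_def by (rule card_of_Field_ordIso[OF assms(7)])
  have AL: "|carrier A| <o |L|" using assms(8) ordIso_symmetric[OF L\<kappa>]
    by (rule ordLess_ordIso_trans)
  have infA: "infinite (carrier A)" by (rule C.infinite_carrier[OF nontrivial])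
  have infL: "infinite L" using AL infA ordLess_imp_ordLeq card_of_ordLeq_infinite by blast
  have natA: "|UNIV :: nat set| \<le>o |carrier A|" using infA infinite_iff_card_of_nat by blast
  have AL': "|carrier A| \<le>o |L|" using AL by (rule ordLess_imp_ordLeq)
  \<comment> \<open>The bound by the continuum enters here: a branch is given by a set of natural
    numbers, and different indices need different branches.\<close>
  have "|L| \<le>o |UNIV :: nat set set|"
  proof -
    have "|Pow (UNIV :: nat set)| =o |Func (UNIV :: nat set) (UNIV :: bool set)|"
      by (rule card_of_Pow_Func)
    then have "|UNIV :: nat set set| =o ctwo ^c natLeq"
      by (simp add: cexp_def ctwo_def Field_natLeq Field_card_of)
    then show ?thesis using L\<kappa> assms(9) ordIso_ordLeq_trans ordLeq_ordIso_trans ordIso_symmetric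
      by metis
  qed
  then obtain sel :: "'l \<Rightarrow> nat set" where sel: "inj_on sel L" unfolding card_of_ordLeq[symmetric]
    by blast
  let ?V = "carrier A \<times> (UNIV :: nat set) \<times> (UNIV :: nat set)"
  have "|?V| \<le>o |L|"
    by (intro card_of_Times_ordLeq_infinite[OF infL] AL' ordLeq_transitive[OF natA AL'])
  moreover have "?V \<noteq> {}" using A.one_closed by blast
  ultimately obtain b :: "'l \<Rightarrow> 'a \<times> nat \<times> nat" where b: "\<And>\<eta>. \<eta> \<in> L \<Longrightarrow> b \<eta> \<in> ?V"
    "\<And>v. v \<in> ?V \<Longrightarrow> |L| \<le>o |{\<eta> \<in> L. b \<eta> = v}|" using ex_fibres_of_full_size[OF infL] by blast
  interpret D: branch_data A p L sel b
    by unfold_locales (use nontrivial sel b(1) in \<open>auto simp: mem_Times_iff\<close>)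
  obtain h :: "(nat \<Rightarrow> nat \<Rightarrow> 'a) \<Rightarrow> 'l" where h:
    "\<And>v w. v \<in> D.gens \<Longrightarrow> w \<in> D.gens \<Longrightarrow> h v = h w \<longleftrightarrow> D.vequiv v w" "h ` D.gens = L"
    using D.ex_quotient_map[OF infL AL'] by blast
  define \<rho> where "\<rho> r = r \<odot>\<^bsub>A\<^esub> \<one>\<^bsub>A\<^esub>" for r
  define G :: "('r, 'l) module" where "G = D.quot_mod h \<rho>"
  define act where "act = D.mod_act h"
  have B: "branch_module A p G act L sel b (\<lambda>j. h (D.vE j)) (\<lambda>\<eta> n. h (D.vY \<eta> n)) (\<lambda>j n x. inv_into D.gens h x j n)"
    unfolding G_def act_def by (rule D.branch_module_quot_mod[OF h(1)])
  interpret B: branch_module A p G act L sel b "\<lambda>j. h (D.vE j)" "\<lambda>\<eta> n. h (D.vY \<eta> n)"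
    "\<lambda>j n x. inv_into D.gens h x j n"
    "\<lambda>(x, t, s). act x (h (D.vE t)) \<oplus>\<^bsub>G\<^esub> h (D.vE s)"
    by (rule B)
  have carG: "carrier G = L" using h(2) by (simp add: G_def D.quot_mod_def)
  have smult: "r \<odot>\<^bsub>G\<^esub> x = act (r \<odot>\<^bsub>A\<^esub> \<one>\<^bsub>A\<^esub>) x" for r x
    by (simp add: G_def act_def D.quot_mod_def \<rho>_def)
  have G: "module R G"
  proof (rule moduleI)
    show "cring R" by (rule R.is_cring)
    show "abelian_group G" by (rule B.G.M.abelian_group_axioms)
    fix r s x assume r: "r \<in> carrier R" and s: "s \<in> carrier R" and x: "x \<in> carrier G"
    have "(r \<odot>\<^bsub>A\<^esub> \<one>\<^bsub>A\<^esub>) \<otimes>\<^bsub>A\<^esub> (s \<odot>\<^bsub>A\<^esub> \<one>\<^bsub>A\<^esub>) = (r \<otimes>\<^bsub>R\<^esub> s) \<odot>\<^bsub>A\<^esub> \<one>\<^bsub>A\<^esub>"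
      using A.smult_mult_left[OF r, of "\<one>\<^bsub>A\<^esub>" "s \<odot>\<^bsub>A\<^esub> \<one>\<^bsub>A\<^esub>"] r s by (simp add: A.smult_assoc1)
    then show "(r \<otimes>\<^bsub>R\<^esub> s) \<odot>\<^bsub>G\<^esub> x = r \<odot>\<^bsub>G\<^esub> (s \<odot>\<^bsub>G\<^esub> x)"
      using r s x by (simp add: smult B.G.act_mult[symmetric])
    show "(r \<oplus>\<^bsub>R\<^esub> s) \<odot>\<^bsub>G\<^esub> x = r \<odot>\<^bsub>G\<^esub> x \<oplus>\<^bsub>G\<^esub> s \<odot>\<^bsub>G\<^esub> x"
      using r s x by (simp add: smult A.smult_l_distr B.G.act_add_left)
  next
    fix r x y assume "r \<in> carrier R" "x \<in> carrier G" "y \<in> carrier G"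
    then show "r \<odot>\<^bsub>G\<^esub> (x \<oplus>\<^bsub>G\<^esub> y) = r \<odot>\<^bsub>G\<^esub> x \<oplus>\<^bsub>G\<^esub> r \<odot>\<^bsub>G\<^esub> y"
      by (simp add: smult B.G.act_add_right)
  qed (simp_all add: smult B.G.act_one)
  have "aleph1_free_module R G"
    by (rule aleph1_free_branch_module[OF B assms(1,4,6) G]) (simp add: smult)
  moreover have "|carrier G| =o \<kappa>" unfolding carG by (rule L\<kappa>)
  moreover have "left_module A G act" by (rule B.G.left_module_axioms)
  moreover have "(\<lambda>a. \<lambda>x\<in>carrier G. act a x) \<in> algebra_iso R A (End_alg R G)"
  proof (rule algebra_iso_branch_module[OF B assms(4)])
    show "\<exists>r\<in>carrier R. p [^]\<^bsub>A\<^esub> n = r \<odot>\<^bsub>A\<^esub> \<one>\<^bsub>A\<^esub>" for n :: nat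
      unfolding p_def q(3) using q(1) by blast
    show "|carrier A| <o |{\<eta> \<in> L. b \<eta> = (x, t, s)}|" if "x \<in> carrier A" for x t s
      using AL b(2)[of "(x, t, s)"] that ordLess_ordLeq_trans by blast
  qed (simp add: smult)
  ultimately show ?thesis using smult by (intro exI[of _ G] exI[of _ act]) simp
qed

end
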